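(* Fix $\kappa>0$, $\rho>0$, $\gamma>0$, let $p\in\mathbb{N}$, and let one of the following conditions be satisfied: (i) $p=1$ or $p=2$, and $\gamma$ is large enough to ensure $\lambda_p>0$; (ii) $p\in\mathbb{N}$ is arbitrary and $\gamma>4d(\kappa p+\rho)$. Then there exists a strictly positive and summable $l^2$-eigenfunction $v_p$ of $\mathcal{H}^p$ corresponding to $\lambda_p>0$. Assuming $v_p$ to be normed in $l^2(\mathbb{Z}^{pd})$, the large time asymptotics of the $p$-th moment are given, for every $x\in\mathbb{Z}^{pd}$, by $$\tilde m^p_x(t)\sim e^{\lambda_p t}\,v_p(x)\,\|v_p\|_1,\qquad t\to\infty,$$ where $\|\cdot\|_1$ denotes the norm in $l^1(\mathbb{Z}^{pd})$.
   Context: Parabolic Anderson model with a moving catalyst: $u\colon[0,\infty)\times\mathbb{Z}^d\to[0,\infty)$ solves $\frac{\partial}{\partial t}u(t,x)=\kappa\Delta u(t,x)+\gamma\delta_{Y_t}(x)u(t,x)$ with homogeneous initial condition $u(0,\cdot)\equiv1$, where $\Delta f(x)=\sum_{y\in\mathbb{Z}^d:|x-y|=1}[f(y)-f(x)]$, and $Y$ is a continuous-time simple symmetric random walk on $\mathbb{Z}^d$ with generator $\rho\Delta$ started at the origin. The solution is given by the Feynman-Kac formula $u(t,x)=\mathbb{E}^X_x\exp\{\gamma\int_0^t\delta_{Y_{t-s}}(X_s)\,ds\}$, where $X$ is a random walk with generator $\kappa\Delta$ started at $x$, independent of $Y$. $\langle\cdot\rangle$ denotes expectation with respect to $Y$.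 Put $\tilde u(t,x):=u(t,Y_t+x)$ and, for $x=(x_1,\dots,x_p)\in\mathbb{Z}^{pd}$ with $x_i\in\mathbb{Z}^d$, $\tilde m^p_x(t):=\big\langle\prod_{i=1}^p\tilde u(t,x_i)\big\rangle$ (the $p$-th mixed moment at $x$). The $p$-th Hamilton operator is $\mathcal{H}^p:=\mathcal{A}^p+\gamma V^p$ on functions on $\mathbb{Z}^{pd}$, where $(V^pf)(x)=\sum_{i=1}^p\delta_0(x_i)f(x)$ and $$\mathcal{A}^pf(x)=\kappa\sum_{e\in\mathbb{Z}^{pd},\,|e|=1}\big(f(x+e)-f(x)\big)+\rho\sum_{e\in\mathbb{Z}^d,\,|e|=1}\big(f(x_1+e,\dots,x_p+e)-f(x)\big).$$ $\lambda_p$ denotes the supremum of the spectrum of $\mathcal{H}^p$ as a (bounded self-adjoint) operator on $l^2(\mathbb{Z}^{pd})$. $f(t)\sim g(t)$ as $t\to\infty$ means $f(t)/g(t)\to1$. *)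

theory Defs
  imports "HOL-Probability.Probability" "HOL-Library.Landau_Symbols"
begin

text \<open>
  The lattice \<open>\<int>\<^sup>d\<close> is the type \<^typ>\<open>int ^ 'd\<close> with \<open>d = CARD('d)\<close>, and \<open>\<int>\<^sup>p\<^sup>d\<close> is
  \<^typ>\<open>int ^ 'd ^ 'p\<close> with \<open>p = CARD('p)\<close>; the component \<open>x\<^sub>i\<close> of \<open>x \<in> \<int>\<^sup>p\<^sup>d\<close> is \<open>x $ i\<close>.
\<close>

text \<open>The Euclidean norms on \<open>\<int>\<^sup>d\<close> and \<open>\<int>\<^sup>p\<^sup>d\<close>, taken in \<open>\<real>\<^sup>d\<close> and \<open>\<real>\<^sup>p\<^sup>d\<close>.\<close>

definition lnorm :: "int ^ 'd \<Rightarrow> real" where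
  "lnorm x = norm (\<chi> i. real_of_int (x $ i))"

definition lnorm_p :: "int ^ 'd ^ 'p \<Rightarrow> real" where
  "lnorm_p x = norm (\<chi> i j. real_of_int (x $ i $ j))"

definition laplacian :: "(int ^ 'd \<Rightarrow> real) \<Rightarrow> int ^ 'd \<Rightarrow> real" where
  "laplacian f x = (\<Sum>y | lnorm (x - y) = 1. f y - f x)"

text \<open>
  The sums over nearest neighbours are over finite sets, so they do not degenerate to the
  default value that \<^const>\<open>sum\<close> takes on infinite sets.
\<close>

lemma finite_vec_components:
  assumes "finite A"
  shows "finite {x :: 'a ^ 'n. \<forall>i. x $ i \<in> A}"
proof -
  have "{x :: 'a ^ 'n. \<forall>i. x $ i \<in> A} \<subseteq> vec_lambda ` (UNIV \<rightarrow>\<^sub>E A)"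
  proof
    fix x :: "'a ^ 'n"
    assume "x \<in> {x. \<forall>i. x $ i \<in> A}"
    then have "vec_nth x \<in> UNIV \<rightarrow>\<^sub>E A" by (simp add: PiE_def)
    then show "x \<in> vec_lambda ` (UNIV \<rightarrow>\<^sub>E A)"
      by (intro image_eqI[where x = "vec_nth x"]) simp_all
  qed
  then show ?thesis
    using assms by (auto intro!: finite_PiE elim!: finite_subset)
qed

lemma finite_lnorm_eq_1: "finite {e :: int ^ 'd. lnorm e = 1}"
proof (rule finite_subset[OF _ finite_vec_components[of "{-1..1}"]])
  show "{e :: int ^ 'd. lnorm e = 1} \<subseteq> {x. \<forall>i. x $ i \<in> {-1..1}}"
  proof clarify
    fix e :: "int ^ 'd" and i
    assume "lnorm e = 1"
    then have "\<bar>real_of_int (e $ i)\<bar> \<le> 1"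
      using component_le_norm_cart[of "\<chi> i. real_of_int (e $ i)" i] by (simp add: lnorm_def)
    then have "\<bar>e $ i\<bar> \<le> 1" by linarith
    then show "e $ i \<in> {-1..1}" by (simp add: abs_le_iff)
  qed
qed simp

lemma finite_neighbours: "finite {y :: int ^ 'd. lnorm (x - y) = 1}"
proof -
  have "{y. lnorm (x - y) = 1} \<subseteq> (\<lambda>e. x - e) ` {e. lnorm e = 1}"
  proof
    fix y
    assume "y \<in> {y. lnorm (x - y) = 1}"
    then show "y \<in> (\<lambda>e. x - e) ` {e. lnorm e = 1}"
      by (intro image_eqI[where x = "x - y"]) simp_all
  qed
  then show ?thesis
    using finite_lnorm_eq_1 finite_surj by blast
qed

lemma finite_lnorm_p_eq_1: "finite {e :: int ^ 'd ^ 'p. lnorm_p e = 1}"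
proof (rule finite_subset[OF _ finite_vec_components[OF finite_vec_components[of "{-1..1}"]]])
  show "{e :: int ^ 'd ^ 'p. lnorm_p e = 1} \<subseteq> {x. \<forall>i. x $ i \<in> {y. \<forall>j. y $ j \<in> {-1..1}}}"
  proof clarify
    fix e :: "int ^ 'd ^ 'p" and i j
    assume e: "lnorm_p e = 1"
    let ?v = "(\<chi> i j. real_of_int (e $ i $ j)) :: real ^ 'd ^ 'p"
    have "\<bar>?v $ i $ j\<bar> \<le> norm (?v $ i)" by (rule component_le_norm_cart)
    also have "\<dots> \<le> norm ?v" by (rule Finite_Cartesian_Product.norm_nth_le)
    finally have "\<bar>e $ i $ j\<bar> \<le> 1" using e by (simp add: lnorm_p_def)
    then show "e $ i $ j \<in> {-1..1}" by (simp add: abs_le_iff)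
  qed
qed simp


text \<open>
  A continuous-time random walk on \<open>\<int>\<^sup>d\<close> started at the origin, with generator \<open>\<kappa>\<Delta>\<close>: a process
  with stationary independent increments and right-continuous step paths with left limits, whose
  transition semigroup \<open>(P\<^sub>t f)(x) = E f(x + X\<^sub>t)\<close> on the bounded functions with the supremum norm
  has \<open>\<kappa>\<Delta>\<close> as its generator. Since \<open>\<int>\<^sup>d\<close> is discrete, having a one-sided limit means being
  eventually constant. Only the times \<open>t \<ge> 0\<close> are relevant.
\<close>

locale random_walk = prob_space M
  for M :: "'a measure" and \<kappa> :: real and X :: "real \<Rightarrow> 'a \<Rightarrow> int ^ 'd" +
  assumes random_variable: "\<And>t. t \<ge> 0 \<Longrightarrow> X t \<in> measurable M (count_space UNIV)"
    and start: "\<And>\<omega>. \<omega> \<in> space M \<Longrightarrow> X 0 \<omega> = 0"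
    and right_continuous:
      "\<And>\<omega> t. \<omega> \<in> space M \<Longrightarrow> t \<ge> 0 \<Longrightarrow> eventually (\<lambda>s. X s \<omega> = X t \<omega>) (at_right t)"
    and left_limits:
      "\<And>\<omega> t. \<omega> \<in> space M \<Longrightarrow> t > 0 \<Longrightarrow> \<exists>l. eventually (\<lambda>s. X s \<omega> = l) (at_left t)"
    and independent_increments:
      "\<And>(\<tau> :: nat \<Rightarrow> real) n. mono \<tau> \<Longrightarrow> \<tau> 0 \<ge> 0 \<Longrightarrow>
         indep_vars (\<lambda>_. count_space UNIV) (\<lambda>i \<omega>. X (\<tau> (Suc i)) \<omega> - X (\<tau> i) \<omega>) {..<n}"
    and stationary_increments:
      "\<And>s t. s \<ge> 0 \<Longrightarrow> t \<ge> 0 \<Longrightarrow>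
         distr M (count_space UNIV) (\<lambda>\<omega>. X (s + t) \<omega> - X s \<omega>) = distr M (count_space UNIV) (X t)"
    and generator:
      "\<And>f :: int ^ 'd \<Rightarrow> real. bounded (range f) \<Longrightarrow>
         uniform_limit UNIV (\<lambda>h x. (expectation (\<lambda>\<omega>. f (x + X h \<omega>)) - f x) / h)
           (\<lambda>x. \<kappa> * laplacian f x) (at_right 0)"


text \<open>
  The solution \<open>u(t,x)\<close> of the parabolic Anderson model for a fixed trajectory \<open>y\<close> of the
  catalyst, given by the Feynman--Kac formula. As \<open>X\<close> starts at the origin, \<open>x + X\<close> is the walk
  started at \<open>x\<close>. The expectation is over \<open>N\<close> only, which encodes the independence of the
  walk and the catalyst.
\<close>

definition pam_solution ::
  "'a measure \<Rightarrow> (real \<Rightarrow> 'a \<Rightarrow> int ^ 'd) \<Rightarrow> real \<Rightarrow> (real \<Rightarrow> int ^ 'd) \<Rightarrow> real \<Rightarrow> int ^ 'd \<Rightarrow> real"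
  where
  "pam_solution N X \<gamma> y t x =
     (\<integral>\<omega>. exp (\<gamma> * (LINT s:{0..t}|lborel. of_bool (x + X s \<omega> = y (t - s)))) \<partial>N)"

definition shifted_solution ::
  "'a measure \<Rightarrow> (real \<Rightarrow> 'a \<Rightarrow> int ^ 'd) \<Rightarrow> real \<Rightarrow> (real \<Rightarrow> int ^ 'd) \<Rightarrow> real \<Rightarrow> int ^ 'd \<Rightarrow> real"
  where
  "shifted_solution N X \<gamma> y t x = pam_solution N X \<gamma> y t (y t + x)"

definition mixed_moment ::
  "'a measure \<Rightarrow> (real \<Rightarrow> 'a \<Rightarrow> int ^ 'd) \<Rightarrow> 'b measure \<Rightarrow> (real \<Rightarrow> 'b \<Rightarrow> int ^ 'd) \<Rightarrow>
   real \<Rightarrow> int ^ 'd ^ 'p \<Rightarrow> real \<Rightarrow> real"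
  where
  "mixed_moment N X M Y \<gamma> x t =
     (\<integral>\<omega>. (\<Prod>i\<in>UNIV. shifted_solution N X \<gamma> (\<lambda>s. Y s \<omega>) t (x $ i)) \<partial>M)"


definition op_A :: "real \<Rightarrow> real \<Rightarrow> (int ^ 'd ^ 'p \<Rightarrow> real) \<Rightarrow> int ^ 'd ^ 'p \<Rightarrow> real" where
  "op_A \<kappa> \<rho> f x =
     \<kappa> * (\<Sum>e | lnorm_p e = 1. f (x + e) - f x) +
     \<rho> * (\<Sum>e | lnorm e = 1. f (\<chi> i. x $ i + e) - f x)"

definition op_V :: "(int ^ 'd ^ 'p \<Rightarrow> real) \<Rightarrow> int ^ 'd ^ 'p \<Rightarrow> real" where
  "op_V f x = (\<Sum>i\<in>UNIV. of_bool (x $ i = 0) * f x)"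

definition hamilton ::
  "real \<Rightarrow> real \<Rightarrow> real \<Rightarrow> (int ^ 'd ^ 'p \<Rightarrow> real) \<Rightarrow> int ^ 'd ^ 'p \<Rightarrow> real" where
  "hamilton \<kappa> \<rho> \<gamma> f x = op_A \<kappa> \<rho> f x + \<gamma> * op_V f x"


definition l1_norm :: "('a \<Rightarrow> real) \<Rightarrow> real" where
  "l1_norm f = (\<Sum>\<^sub>\<infinity>x. \<bar>f x\<bar>)"

definition ell2 :: "('a \<Rightarrow> real) set" where
  "ell2 = {f. (\<lambda>x. (f x)\<^sup>2) summable_on UNIV}"

definition l2_norm :: "('a \<Rightarrow> real) \<Rightarrow> real" where
  "l2_norm f = sqrt (\<Sum>\<^sub>\<infinity>x. (f x)\<^sup>2)"

text \<open>
  The spectrum of an operator \<open>T\<close> on the real Hilbert space \<open>l\<^sup>2\<close>: the \<open>\<mu>\<close> for which \<open>T - \<mu>\<close> is not a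
  bijection of \<open>l\<^sup>2\<close> with bounded inverse. For a bounded self-adjoint operator, this
  is also the spectrum of its complexification.
\<close>

definition l2_spectrum :: "(('a \<Rightarrow> real) \<Rightarrow> 'a \<Rightarrow> real) \<Rightarrow> real set" where
  "l2_spectrum T = {\<mu>. \<not> (bij_betw (\<lambda>f x. T f x - \<mu> * f x) ell2 ell2 \<and>
     (\<exists>C. \<forall>f\<in>ell2. l2_norm f \<le> C * l2_norm (\<lambda>x. T f x - \<mu> * f x)))}"

end

theory Submission
  imports Defs
begin

text \<open>
  Seen from the catalyst, whose trajectory the Feynman--Kac formula reads backwards from time \<open>t\<close>,
  the \<open>p\<close> particles form one random walk \<open>Z\<close> on \<open>\<int>\<^sup>p\<^sup>d\<close> with generator \<open>A\<close>, the operator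
  \<^const>\<open>op_A\<close>: an increment of the catalyst shifts all particles at once. With
  \<open>V(x)\<close> the number of particles at the origin, the mixed moment at \<open>x\<close> is the expectation of
  \<open>exp (\<gamma> \<integral> V(Z\<^sub>s) ds)\<close> for \<open>Z\<close> started at \<open>x\<close>, that is \<open>e\<^sup>t\<^sup>H 1\<close> at \<open>x\<close>, where
  \<open>H = A + \<gamma> V\<close>. For large \<open>c\<close> the operator \<open>B = H + c\<close> is a symmetric matrix with nonnegative
  entries and positive form, and the theorem is Perron--Frobenius theory for \<open>B\<close> on a
  countable index set: a positive eigenvector at the top \<open>K = \<lambda> + c\<close> of the spectrum, and
  convergence of the powers of \<open>B / K\<close> to the projection on it.

  What is not automatic on an infinite set is that the eigenvector exists and is
  summable. Both follow from a single function \<open>h\<close> between positive constants with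
  \<open>(H - W) h \<le> s h\<close>, where \<open>s < \<lambda>\<close> and \<open>W \<ge> 0\<close> has finite support (\<open>ground_state\<close>). In \<open>l\<^sup>2\<close>,
  such an \<open>h\<close> bounds the form of \<open>H - W\<close> by \<open>s\<close> (\<open>supersolution_form_bound\<close>). A sequence that
  maximises the Rayleigh quotient of \<open>H\<close> therefore keeps some mass on the support of \<open>W\<close>, and
  its pointwise limit \<open>v\<close> is not zero; it is an eigenfunction, and positive since zeros of
  nonnegative eigenfunctions spread. In \<open>l\<^sup>1\<close>, the same \<open>h\<close> makes the resolvent of \<open>H - W\<close> at \<open>\<lambda>\<close>
  preserve summability (\<open>summable_resolvent\<close>), and \<open>v\<close> is this resolvent applied to the finitely
  supported function \<open>W v\<close>.

  If \<open>\<lambda> > (p - 1) \<gamma>\<close>, then \<open>h = 1\<close> is possible, because only at the origin do all particles meet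
  the catalyst. This covers \<open>p = 1\<close> and, as \<open>\<lambda>\<close> is at least the diagonal entry of
  \<open>H\<close> at the origin, also \<open>\<gamma> > 4 d (\<kappa> p + \<rho>)\<close>. For \<open>p = 2\<close>, take
  \<open>h(x) = 1 + c (G(x\<^sub>1) + G(x\<^sub>2))\<close> with the Green function \<open>G\<close> of one particle at level
  \<open>\<lambda>\<close> and \<open>c = \<gamma> / (1 - \<gamma> G(0))\<close> (\<open>two_particle_supersolution\<close>). The choice of \<open>c\<close> lets
  the jumps of \<open>G\<close> at the origin absorb the potential up to an error that is small off a
  finite set, and the level drops below \<open>\<lambda>\<close> because of the constant 1 in \<open>h\<close>. That
  \<open>\<gamma> G(0) < 1\<close>, which says that one particle alone grows at a rate below \<open>\<lambda>\<close>,
  follows by testing \<open>H\<close> with \<open>G \<otimes> G\<close> (\<open>tensor_rayleigh\<close>): sharing the catalyst only increases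
  correlations, so that two particles grow at least twice as fast as one.

  For the convergence, put \<open>T = B / K\<close>. The numbers \<open>\<langle>\<delta>\<^sub>x, T\<^sup>n \<delta>\<^sub>x\<rangle>\<close> decrease in \<open>n\<close>, so
  \<open>T\<^sup>n \<delta>\<^sub>x\<close> is a Cauchy sequence in \<open>l\<^sup>2\<close>, and simplicity of the ground state
  identifies the limit as \<open>v(x) v\<close>. Since \<open>\<delta>\<^sub>x \<le> v / v(x)\<close>, the sequence is dominated by a summable
  function, and summation gives \<open>T\<^sup>n 1 (x) \<longlonglongrightarrow> v(x) \<parallel>v\<parallel>\<^sub>1\<close> (\<open>power_convergence\<close>).
  Finally \<open>e\<^sup>t\<^sup>H 1\<close> is \<open>e\<^sup>\<lambda>\<^sup>t\<close> times the average of \<open>T\<^sup>n 1\<close> over a Poisson distribution of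
  mean \<open>K t\<close> (\<open>poisson_average\<close>).

  The identification of the moment with \<open>e\<^sup>t\<^sup>H 1\<close> (\<open>moment_formula\<close>) uses a grid of mesh \<open>t / n\<close>. Step
  paths have finitely many jumps, so the time integral is a limit of Riemann sums;
  the increments of the walks over the grid are independent, so the expectation of the
  exponential of such a sum is the \<open>n\<close>-th power of a one-step operator applied to 1; and the
  generators of the walks give this operator as \<open>1 + h H + o(h)\<close> in the supremum norm, where
  \<open>h = t / n\<close>.
\<close>

section \<open>Square-summable functions\<close>

definition ip :: "('a \<Rightarrow> real) \<Rightarrow> ('a \<Rightarrow> real) \<Rightarrow> real" where
  "ip f g = (\<Sum>\<^sub>\<infinity>x. f x * g x)"

lemma summable_on_real_comparison:
  fixes f g :: "'a \<Rightarrow> real"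
  assumes "g summable_on A" "\<And>x. x \<in> A \<Longrightarrow> \<bar>f x\<bar> \<le> g x"
  shows "f summable_on A"
proof -
  have "(\<lambda>x. norm (f x)) summable_on A"
    by (rule Infinite_Sum.abs_summable_on_comparison_test'[OF assms(1)]) (use assms(2) in auto)
  then show ?thesis by (rule abs_summable_summable)
qed

lemma summable_on_abs:
  fixes f :: "'a \<Rightarrow> real"
  shows "f summable_on A \<Longrightarrow> (\<lambda>x. \<bar>f x\<bar>) summable_on A"
  using summable_on_iff_abs_summable_on_real[of f A] by simp

lemma summable_on_shift_iff:
  fixes f :: "'a :: group_add \<Rightarrow> real"
  shows "(\<lambda>x. f (x + e)) summable_on UNIV \<longleftrightarrow> f summable_on UNIV"
  by (rule summable_on_reindex_bij_witness[where i = "\<lambda>x. x - e" and j = "\<lambda>x. x + e"]) auto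

lemma infsum_shift:
  fixes f :: "'a :: group_add \<Rightarrow> real"
  shows "(\<Sum>\<^sub>\<infinity>x. f (x + e)) = (\<Sum>\<^sub>\<infinity>x. f x)"
  by (rule infsum_reindex_bij_witness[where i = "\<lambda>x. x - e" and j = "\<lambda>x. x + e"]) auto

lemma summable_on_sum:
  fixes f :: "'i \<Rightarrow> 'a \<Rightarrow> real"
  assumes "\<And>i. i \<in> I \<Longrightarrow> f i summable_on A"
  shows "(\<lambda>x. \<Sum>i\<in>I. f i x) summable_on A"
  using assms by (induction I rule: infinite_finite_induct) (auto intro: summable_on_add)

lemma infsum_sum:
  fixes f :: "'i \<Rightarrow> 'a \<Rightarrow> real"
  assumes "\<And>i. i \<in> I \<Longrightarrow> f i summable_on A"
  shows "(\<Sum>\<^sub>\<infinity>x\<in>A. \<Sum>i\<in>I. f i x) = (\<Sum>i\<in>I. \<Sum>\<^sub>\<infinity>x\<in>A. f i x)"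
  using assms
  by (induction I rule: infinite_finite_induct) (auto simp: infsum_add summable_on_sum)

lemma ell2_mult_summable:
  assumes "f \<in> ell2" "g \<in> ell2"
  shows "(\<lambda>x. f x * g x) summable_on UNIV"
proof (rule summable_on_real_comparison)
  show "(\<lambda>x. (f x)\<^sup>2 + (g x)\<^sup>2) summable_on UNIV"
    using assms by (auto simp: ell2_def intro: summable_on_add)
  show "\<bar>f x * g x\<bar> \<le> (f x)\<^sup>2 + (g x)\<^sup>2" for x
    using sum_squares_bound[of "f x" "g x"] sum_squares_bound[of "f x" "- g x"]
    zero_le_power2[of "f x"] zero_le_power2[of "g x"]
    by (simp add: abs_le_iff)
qed

lemma ell2_dominated:
  assumes "g \<in> ell2" "\<And>x. \<bar>f x\<bar> \<le> c * \<bar>g x\<bar>"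
  shows "f \<in> ell2"
  unfolding ell2_def mem_Collect_eq
proof (rule summable_on_real_comparison)
  show "(\<lambda>x. c\<^sup>2 * (g x)\<^sup>2) summable_on UNIV"
    using assms(1) by (auto simp: ell2_def intro: summable_on_cmult_right)
  show "\<bar>(f x)\<^sup>2\<bar> \<le> c\<^sup>2 * (g x)\<^sup>2" for x
    using power_mono[OF assms(2)[of x], of 2] by (simp add: power_mult_distrib)
qed

lemma ell2_cmult: "f \<in> ell2 \<Longrightarrow> (\<lambda>x. c * f x) \<in> ell2"
  by (rule ell2_dominated[where g = f and c = "\<bar>c\<bar>"]) (auto simp: abs_mult)

lemma ell2_add:
  assumes "f \<in> ell2" "g \<in> ell2"
  shows "(\<lambda>x. f x + g x) \<in> ell2"
proof -
  have "(\<lambda>x. (f x)\<^sup>2 + (2 * (f x * g x) + (g x)\<^sup>2)) summable_on UNIV"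
    using assms ell2_mult_summable[OF assms]
    by (intro summable_on_add summable_on_cmult_right) (auto simp: ell2_def)
  then show ?thesis by (simp add: ell2_def power2_sum algebra_simps)
qed

lemma ell2_diff: "f \<in> ell2 \<Longrightarrow> g \<in> ell2 \<Longrightarrow> (\<lambda>x. f x - g x) \<in> ell2"
  using ell2_add[of f "\<lambda>x. (-1) * g x"] ell2_cmult[of g "-1"] by simp

lemma ell2_zero: "(\<lambda>x. 0) \<in> ell2"
  by (simp add: ell2_def)

lemma ell2_sum: "(\<And>i. i \<in> I \<Longrightarrow> f i \<in> ell2) \<Longrightarrow> (\<lambda>x. \<Sum>i\<in>I. f i x) \<in> ell2"
  by (induction I rule: infinite_finite_induct) (auto intro: ell2_add simp: ell2_zero)

lemma ell2_shift: "f \<in> ell2 \<Longrightarrow> (\<lambda>x :: 'a :: group_add. f (x + e)) \<in> ell2"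
  using summable_on_shift_iff[of "\<lambda>x. (f x)\<^sup>2" e] by (simp add: ell2_def)

lemma ell2_abs: "f \<in> ell2 \<Longrightarrow> (\<lambda>x. \<bar>f x\<bar>) \<in> ell2"
  by (rule ell2_dominated[where g = f and c = 1]) auto

lemma ell2_finite_support:
  assumes "finite A" "\<And>x. x \<notin> A \<Longrightarrow> f x = 0"
  shows "f \<in> ell2"
  unfolding ell2_def mem_Collect_eq
  by (rule finite_nonzero_values_imp_summable_on)
     (use assms in \<open>auto intro: finite_subset[of _ A]\<close>)

lemma summable_bounded:
  fixes f :: "'a \<Rightarrow> real"
  assumes "f summable_on UNIV" "\<And>x. 0 \<le> f x"
  shows "f x \<le> (\<Sum>\<^sub>\<infinity>x. f x)"
  using finite_sum_le_infsum[of f UNIV "{x}"] assms by auto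

lemma summable_imp_ell2:
  assumes "f summable_on UNIV" "\<And>x. 0 \<le> f x"
  shows "f \<in> ell2"
  unfolding ell2_def mem_Collect_eq
proof (rule summable_on_real_comparison)
  show "(\<lambda>x. infsum f UNIV * f x) summable_on UNIV"
    using assms(1) by (rule summable_on_cmult_right)
  show "\<bar>(f x)\<^sup>2\<bar> \<le> infsum f UNIV * f x" for x
    using mult_right_mono[OF summable_bounded[OF assms, of x] assms(2)[of x]]
    by (simp add: power2_eq_square)
qed

lemma ip_commute: "ip f g = ip g f"
  by (simp add: ip_def mult.commute)

lemma ip_nonneg: "0 \<le> ip f f"
  by (auto simp: ip_def intro!: infsum_nonneg)

lemma ip_diff_right:
  "f \<in> ell2 \<Longrightarrow> g \<in> ell2 \<Longrightarrow> h \<in> ell2 \<Longrightarrow> ip f (\<lambda>x. g x - h x) = ip f g - ip f h"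
  using infsum_add[of "\<lambda>x. f x * g x" UNIV "\<lambda>x. - (f x * h x)"]
  by (auto simp: ip_def ell2_mult_summable infsum_uminus summable_on_uminus algebra_simps)

lemma ip_cmult_right: "ip f (\<lambda>x. c * g x) = c * ip f g"
  unfolding ip_def by (subst infsum_cmult_right'[symmetric]) (simp add: algebra_simps)

lemma ip_diff_left:
  "f \<in> ell2 \<Longrightarrow> g \<in> ell2 \<Longrightarrow> h \<in> ell2 \<Longrightarrow> ip (\<lambda>x. g x - h x) f = ip g f - ip h f"
  by (metis ip_commute ip_diff_right)

lemma ip_cmult_left: "ip (\<lambda>x. c * g x) f = c * ip g f"
  by (metis ip_commute ip_cmult_right)

lemma ip_eq_0_iff:
  assumes "f \<in> ell2"
  shows "ip f f = 0 \<longleftrightarrow> (\<forall>x. f x = 0)"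
proof
  assume *: "ip f f = 0"
  show "\<forall>x. f x = 0"
  proof
    fix x
    have "f x * f x = 0"
      by (rule nonneg_infsum_le_0D[of "\<lambda>x. f x * f x" UNIV])
         (use * ell2_mult_summable[OF assms assms] in \<open>auto simp: ip_def\<close>)
    then show "f x = 0" by simp
  qed
qed (simp add: ip_def)

lemma square_le_ip:
  assumes "f \<in> ell2"
  shows "(f x)\<^sup>2 \<le> ip f f"
  using summable_bounded[of "\<lambda>x. f x * f x" x] ell2_mult_summable[OF assms assms]
  by (auto simp: ip_def power2_eq_square)

lemma l2_norm_eq: "l2_norm f = sqrt (ip f f)"
  by (simp add: l2_norm_def ip_def power2_eq_square)

lemma l2_norm_power2: "(l2_norm f)\<^sup>2 = ip f f"
  by (simp add: l2_norm_eq ip_nonneg)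

lemma ip_indicator: "ip (indicator {x}) f = f x"
proof -
  have "ip (indicator {x}) f = (\<Sum>\<^sub>\<infinity>y\<in>{x}. indicator {x} y * f y)"
    unfolding ip_def by (rule infsum_cong_neutral) auto
  then show ?thesis by simp
qed

lemma indicator_ell2: "indicator {x} \<in> ell2"
  by (rule ell2_finite_support[of "{x}"]) auto

text \<open>
  Completing the square with the form of \<open>T\<close> itself: \<open>0 \<le> \<langle>u, T u\<rangle>\<close> for \<open>u = f - T f / K\<close>.
\<close>

lemma form_bound_imp_norm_bound:
  assumes lin: "\<And>f g c. T (\<lambda>x. f x - c * g x) = (\<lambda>x. T f x - c * T g x)"
    and maps: "\<And>f. f \<in> ell2 \<Longrightarrow> T f \<in> ell2"
    and sym: "\<And>f g. f \<in> ell2 \<Longrightarrow> g \<in> ell2 \<Longrightarrow> ip f (T g) = ip (T f) g"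
    and nonneg: "\<And>f. f \<in> ell2 \<Longrightarrow> 0 \<le> ip f (T f)"
    and bound: "\<And>f. f \<in> ell2 \<Longrightarrow> ip f (T f) \<le> K * ip f f"
    and "0 < K" and f: "f \<in> ell2"
  shows "ip (T f) (T f) \<le> K * ip f (T f)"
proof -
  let ?g = "T f"
  \<comment> \<open>the minimiser of \<open>c\<^sup>2 K - 2 c\<close>, to which the estimate below reduces\<close>
  let ?c = "inverse K"
  let ?u = "\<lambda>x. f x - ?c * ?g x"
  have g: "?g \<in> ell2" and Tg: "T ?g \<in> ell2"
    using maps f by auto
  note mem = f g Tg ell2_cmult[OF g, of ?c] ell2_cmult[OF Tg, of ?c]
    ell2_diff[OF g ell2_cmult[OF Tg, of ?c]]
  have "0 \<le> ip ?u (T ?u)" by (intro nonneg ell2_diff ell2_cmult f g)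
  also have "ip ?u (T ?u) = ip f ?g - ?c * ip f (T ?g) - ?c * ip ?g ?g + ?c * ?c * ip ?g (T ?g)"
    using mem by (simp add: lin ip_diff_left ip_diff_right ip_cmult_left ip_cmult_right algebra_simps)
  also have "ip f (T ?g) = ip ?g ?g" using sym[OF f g] .
  also have "ip f ?g - ?c * ip ?g ?g - ?c * ip ?g ?g + ?c * ?c * ip ?g (T ?g)
      \<le> ip f ?g - ?c * ip ?g ?g - ?c * ip ?g ?g + ?c * ?c * (K * ip ?g ?g)"
    using bound[OF g] by (intro add_left_mono mult_left_mono) auto
  also have "\<dots> = ip f ?g - ?c * ip ?g ?g" using \<open>0 < K\<close> by (simp add: algebra_simps)
  finally show ?thesis using \<open>0 < K\<close> by (simp add: field_simps)
qed

section \<open>Hopping operators\<close>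

text \<open>
  The shape of \<open>H + c\<close>: hops at rates that are the same at every site, and a diagonal that carries
  the potential and the shift \<open>c\<close>.
\<close>

definition hop :: "'x::ab_group_add set \<Rightarrow> ('x \<Rightarrow> real) \<Rightarrow> ('x \<Rightarrow> real) \<Rightarrow> ('x \<Rightarrow> real) \<Rightarrow> 'x \<Rightarrow> real"
  where "hop E a \<beta> f x = (\<Sum>e\<in>E. a e * f (x + e)) + \<beta> x * f x"

lemma hop_linear: "hop E a \<beta> (\<lambda>x. f x - c * g x) = (\<lambda>x. hop E a \<beta> f x - c * hop E a \<beta> g x)"
  by (simp add: hop_def fun_eq_iff algebra_simps sum_subtractf sum_distrib_left)

lemma hop_cmult: "hop E a \<beta> (\<lambda>x. c * f x) = (\<lambda>x. c * hop E a \<beta> f x)"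
  by (simp add: hop_def fun_eq_iff algebra_simps sum_distrib_left)

lemma hop_sum: "hop E a \<beta> (\<lambda>x. \<Sum>i\<in>I. f i x) = (\<lambda>x. \<Sum>i\<in>I. hop E a \<beta> (f i) x)"
  by (simp add: hop_def fun_eq_iff sum_distrib_left sum.distrib sum.swap[of _ I E])

lemma hop_pow_cmult: "(hop E a \<beta> ^^ n) (\<lambda>x. c * f x) = (\<lambda>x. c * (hop E a \<beta> ^^ n) f x)"
  by (induction n) (auto simp: hop_cmult)

text \<open>
  Even rates on a symmetric set of hops make the operator symmetric, nonnegative entries make it
  monotone, and the bound on the diagonal makes it bounded, both on \<open>l\<^sup>2\<close> and in the supremum norm.
\<close>

locale hopping =
  fixes E :: "'x :: {ab_group_add, countable} set" and a \<beta> :: "'x \<Rightarrow> real" and b :: real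
  assumes finite_E: "finite E"
    and neg_E: "e \<in> E \<Longrightarrow> - e \<in> E"
    and a_neg: "a (- e) = a e"
    and a_pos: "e \<in> E \<Longrightarrow> 0 < a e"
    and \<beta>_nonneg: "0 \<le> \<beta> x"
    and \<beta>_le: "\<beta> x \<le> b"
begin

abbreviation B :: "('x \<Rightarrow> real) \<Rightarrow> 'x \<Rightarrow> real" where "B \<equiv> hop E a \<beta>"

lemma sum_neg_E: "(\<Sum>e\<in>E. F (- e)) = (\<Sum>e\<in>E. F e)"
  by (rule sum.reindex_bij_witness[where i = uminus and j = uminus]) (auto simp: neg_E)

lemma a_nonneg: "e \<in> E \<Longrightarrow> 0 \<le> a e"
  using a_pos by (simp add: less_imp_le)

lemma B_mono: "(\<And>x. f x \<le> g x) \<Longrightarrow> B f x \<le> B g x"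
  unfolding hop_def by (intro add_mono sum_mono mult_left_mono a_nonneg \<beta>_nonneg) auto

lemma B_nonneg: "(\<And>x. 0 \<le> f x) \<Longrightarrow> 0 \<le> B f x"
  unfolding hop_def by (intro add_nonneg_nonneg sum_nonneg mult_nonneg_nonneg a_nonneg \<beta>_nonneg) auto

lemma B_abs: "\<bar>B f x\<bar> \<le> B (\<lambda>x. \<bar>f x\<bar>) x"
proof -
  have "\<bar>B f x\<bar> \<le> (\<Sum>e\<in>E. \<bar>a e * f (x + e)\<bar>) + \<bar>\<beta> x * f x\<bar>"
    unfolding hop_def by (rule order.trans[OF abs_triangle_ineq add_mono[OF sum_abs order.refl]])
  also have "\<dots> = B (\<lambda>x. \<bar>f x\<bar>) x"
    unfolding hop_def using a_nonneg \<beta>_nonneg by (simp add: abs_mult)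
  finally show ?thesis .
qed

lemma Bn_nonneg: "(\<And>x. 0 \<le> f x) \<Longrightarrow> 0 \<le> (B ^^ n) f x"
  by (induction n arbitrary: x) (auto intro!: B_nonneg)

lemma Bn_mono: "(\<And>x. f x \<le> g x) \<Longrightarrow> (B ^^ n) f x \<le> (B ^^ n) g x"
  by (induction n arbitrary: x) (auto intro!: B_mono)

lemma B_ell2: "f \<in> ell2 \<Longrightarrow> B f \<in> ell2"
  unfolding hop_def
  by (intro ell2_add ell2_sum ell2_cmult ell2_shift ell2_dominated[of f "\<lambda>x. \<beta> x * f x" b])
     (auto simp: abs_mult \<beta>_nonneg \<beta>_le intro: mult_right_mono)

lemma Bn_ell2: "f \<in> ell2 \<Longrightarrow> (B ^^ n) f \<in> ell2"
  by (induction n) (auto intro: B_ell2)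

text \<open>
  Shift the summation variable and exchange \<open>e\<close> with \<open>- e\<close>. Stated for any pair with summable
  products, so as to cover both \<open>l\<^sup>2\<close> against \<open>l\<^sup>2\<close> and \<open>l\<^sup>1\<close> against bounded functions.
\<close>

lemma B_symmetric_aux:
  assumes "\<And>e. (\<lambda>x. f x * g (x + e)) summable_on UNIV"
  shows "(\<lambda>x. f x * B g x) summable_on UNIV" "(\<lambda>x. B f x * g x) summable_on UNIV"
    "ip f (B g) = ip (B f) g"
proof -
  have s2: "(\<lambda>x. f (x + e) * g x) summable_on UNIV" for e
    using summable_on_shift_iff[of "\<lambda>y. f y * g (y + (- e))" e] assms[of "- e"] by simp
  have i2: "(\<Sum>\<^sub>\<infinity>x. f (x + e) * g x) = (\<Sum>\<^sub>\<infinity>x. f x * g (x + (- e)))" for e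
    using infsum_shift[of "\<lambda>y. f y * g (y + (- e))" e] by simp
  have s0: "(\<lambda>x. \<beta> x * (f x * g x)) summable_on UNIV"
  proof (rule summable_on_real_comparison)
    have "(\<lambda>x. \<bar>f x * g x\<bar>) summable_on UNIV"
      using summable_on_abs[OF assms[of 0]] by simp
    then show "(\<lambda>x. b * \<bar>f x * g x\<bar>) summable_on UNIV"
      by (rule summable_on_cmult_right)
  qed (auto simp: abs_mult \<beta>_nonneg \<beta>_le intro!: mult_right_mono)
  have e1: "f x * B g x = (\<Sum>e\<in>E. a e * (f x * g (x + e))) + \<beta> x * (f x * g x)"
    and e2: "B f x * g x = (\<Sum>e\<in>E. a e * (f (x + e) * g x)) + \<beta> x * (f x * g x)" for x
    by (simp_all add: hop_def algebra_simps sum_distrib_left)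
  show "(\<lambda>x. f x * B g x) summable_on UNIV" "(\<lambda>x. B f x * g x) summable_on UNIV"
    unfolding e1 e2
    by (intro summable_on_add summable_on_sum summable_on_cmult_right assms s0 s2)+
  have "ip f (B g) = (\<Sum>e\<in>E. a e * (\<Sum>\<^sub>\<infinity>x. f x * g (x + e))) + (\<Sum>\<^sub>\<infinity>x. \<beta> x * (f x * g x))"
    unfolding ip_def e1
    by (simp add: infsum_add summable_on_sum summable_on_cmult_right assms s0 infsum_sum
        infsum_cmult_right')
  also have "(\<Sum>e\<in>E. a e * (\<Sum>\<^sub>\<infinity>x. f x * g (x + e))) =
      (\<Sum>e\<in>E. a (- e) * (\<Sum>\<^sub>\<infinity>x. f x * g (x + (- e))))"
    by (rule sum_neg_E[symmetric])
  also have "\<dots> + (\<Sum>\<^sub>\<infinity>x. \<beta> x * (f x * g x)) = ip (B f) g"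
    unfolding ip_def e2
    by (simp add: infsum_add summable_on_sum summable_on_cmult_right s2 s0 infsum_sum
        infsum_cmult_right' i2 a_neg)
  finally show "ip f (B g) = ip (B f) g" .
qed

lemma B_symmetric: "f \<in> ell2 \<Longrightarrow> g \<in> ell2 \<Longrightarrow> ip f (B g) = ip (B f) g"
  by (rule B_symmetric_aux(3)) (intro ell2_mult_summable ell2_shift)

lemma Bn_symmetric: "f \<in> ell2 \<Longrightarrow> g \<in> ell2 \<Longrightarrow> ip f ((B ^^ n) g) = ip ((B ^^ n) f) g"
proof (induction n arbitrary: f g)
  case (Suc n)
  then have "ip f (B ((B ^^ n) g)) = ip (B f) ((B ^^ n) g)"
    by (intro B_symmetric Bn_ell2)
  also have "\<dots> = ip ((B ^^ n) (B f)) g"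
    by (intro Suc B_ell2)
  finally show ?case by (simp add: funpow_swap1)
qed simp

lemma B_bounded:
  assumes "\<And>x. \<bar>g x\<bar> \<le> C"
  shows "\<bar>B g x\<bar> \<le> (sum a E + b) * C"
proof -
  have C: "0 \<le> C" using assms[of 0] by linarith
  have "\<bar>B g x\<bar> \<le> B (\<lambda>x. \<bar>g x\<bar>) x" by (rule B_abs)
  also have "\<dots> \<le> (\<Sum>e\<in>E. a e * C) + b * C"
    unfolding hop_def
    by (intro add_mono sum_mono mult_left_mono mult_mono a_nonneg \<beta>_nonneg \<beta>_le assms) (auto intro: order.trans[OF \<beta>_nonneg \<beta>_le])
  finally show ?thesis by (simp add: sum_distrib_right[symmetric] algebra_simps sum_distrib_left[symmetric])
qed

lemma Bn_bounded:
  assumes "\<And>x. \<bar>g x\<bar> \<le> C"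
  shows "\<bar>(B ^^ n) g x\<bar> \<le> (sum a E + b) ^ n * C"
  using assms
proof (induction n arbitrary: g C)
  case (Suc n)
  have "\<bar>(B ^^ n) (B g) x\<bar> \<le> (sum a E + b) ^ n * ((sum a E + b) * C)"
    by (rule Suc.IH) (rule B_bounded, rule Suc.prems)
  then show ?case by (simp add: funpow_swap1 algebra_simps)
qed simp

lemma summable_mult_bounded:
  assumes "f summable_on UNIV" "\<And>x. \<bar>g x\<bar> \<le> C"
  shows "(\<lambda>x. f x * g x :: real) summable_on UNIV"
proof (rule summable_on_real_comparison)
  show "(\<lambda>x. \<bar>f x\<bar> * C) summable_on UNIV"
    by (intro summable_on_cmult_left summable_on_abs assms(1))
  show "\<bar>f x * g x\<bar> \<le> \<bar>f x\<bar> * C" for x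
    using assms(2)[of x] by (simp add: abs_mult mult_left_mono)
qed

text \<open>
  The duality through which bounded test functions, such as a supersolution or the constant 1,
  control \<open>l\<^sup>1\<close> norms.
\<close>

lemma Bn_symmetric_l1_bounded:
  assumes "f summable_on UNIV" "\<And>x. \<bar>g x\<bar> \<le> C"
  shows "(B ^^ n) f summable_on UNIV" "ip f ((B ^^ n) g) = ip ((B ^^ n) f) g"
proof -
  have aux: "B f summable_on UNIV" "ip f (B g) = ip (B f) g"
    if "f summable_on UNIV" "\<And>x. \<bar>g x\<bar> \<le> C" for f g C
  proof -
    show "ip f (B g) = ip (B f) g"
      by (rule B_symmetric_aux(3), rule summable_mult_bounded) (use that in auto)
    have "(\<lambda>x. B f x * 1) summable_on UNIV"
      by (rule B_symmetric_aux(2)) (use that in auto)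
    then show "B f summable_on UNIV" by simp
  qed
  have "(B ^^ n) f summable_on UNIV \<and> ip f ((B ^^ n) g) = ip ((B ^^ n) f) g"
    using assms
  proof (induction n arbitrary: f g C)
    case (Suc n)
    have "ip f (B ((B ^^ n) g)) = ip (B f) ((B ^^ n) g)"
      by (rule aux(2)[OF _ Bn_bounded]) (use Suc.prems in auto)
    moreover have "(B ^^ n) (B f) summable_on UNIV \<and> ip (B f) ((B ^^ n) g) = ip ((B ^^ n) (B f)) g"
      by (rule Suc.IH[OF aux(1)[OF Suc.prems] Suc.prems(2)])
    ultimately show ?case
      unfolding funpow_Suc_right o_def by (simp add: funpow_swap1[symmetric])
  qed simp
  then show "(B ^^ n) f summable_on UNIV" "ip f ((B ^^ n) g) = ip ((B ^^ n) f) g" by auto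
qed

text \<open>
  Schur's test with weight \<open>h\<close>. By \<open>2 f(x) f(x+e) \<le> f(x)\<^sup>2 h(x+e)/h(x) + f(x+e)\<^sup>2 h(x)/h(x+e)\<close>, every hop
  is charged to its two end points in the proportion of \<open>h\<close>, and the total charge to \<open>f(x)\<^sup>2\<close> is
  \<open>(B h)(x) / h(x) \<le> s\<close>.
\<close>

lemma supersolution_form_bound:
  assumes h: "\<And>x. 0 < h x" and super: "\<And>x. B h x \<le> s * h x" and f: "f \<in> ell2"
  shows "ip f (B f) \<le> s * ip f f"
proof -
  define r where "r e x = h (x + e) / h x" for e x
  have r_pos: "0 < r e x" for e x using h by (simp add: r_def)
  have total: "(\<Sum>e\<in>E. a e * r e x) + \<beta> x \<le> s" for x
  proof -
    have "((\<Sum>e\<in>E. a e * r e x) + \<beta> x) * h x = B h x"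
      using h[of x] by (simp add: hop_def r_def field_simps sum_distrib_left)
    then show ?thesis using super[of x] h[of x] by (metis mult_right_le_imp_le)
  qed
  have r_le: "r e x \<le> s / a e" if "e \<in> E" for e x
  proof -
    have "a e * r e x \<le> (\<Sum>e\<in>E. a e * r e x)"
      using that finite_E a_nonneg r_pos
      by (intro member_le_sum) (auto intro!: mult_nonneg_nonneg simp: less_imp_le)
    then have "a e * r e x \<le> s" using total[of x] \<beta>_nonneg[of x] by linarith
    then show ?thesis using a_pos[OF that] by (simp add: field_simps)
  qed
  have f2: "(\<lambda>x. f x * f x) summable_on UNIV" by (rule ell2_mult_summable[OF f f])
  have sr: "(\<lambda>x. (f x * f x) * r e x) summable_on UNIV" if "e \<in> E" for e
    by (rule summable_mult_bounded[OF f2, of _ "s / a e"])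
       (use r_le[OF that] r_pos in \<open>auto simp: abs_of_pos\<close>)
  have s2: "(\<lambda>x. f (x + e) * f (x + e) * r (- e) (x + e)) summable_on UNIV" if "e \<in> E" for e
    using summable_on_shift_iff[of "\<lambda>y. f y * f y * r (- e) y" e] sr[OF neg_E[OF that]] by simp
  have i2: "(\<Sum>\<^sub>\<infinity>x. f (x + e) * f (x + e) * r (- e) (x + e)) = (\<Sum>\<^sub>\<infinity>x. f x * f x * r (- e) x)" for e
    using infsum_shift[of "\<lambda>y. f y * f y * r (- e) y" e] by simp
  have s1: "(\<lambda>x. f x * f (x + e)) summable_on UNIV" for e
    by (intro ell2_mult_summable ell2_shift f)
  have pair: "(\<Sum>\<^sub>\<infinity>x. f x * f (x + e)) \<le>
     1/2 * (\<Sum>\<^sub>\<infinity>x. f x * f x * r e x) + 1/2 * (\<Sum>\<^sub>\<infinity>x. f x * f x * r (- e) x)" if "e \<in> E" for e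
  proof -
    have "f x * f (x + e) \<le>
        1/2 * (f x * f x * r e x) + 1/2 * (f (x + e) * f (x + e) * r (- e) (x + e))" for x
    proof -
      have hx: "0 < h x" "0 < h (x + e)" using h by auto
      have "0 \<le> (f x * h (x + e) - f (x + e) * h x)\<^sup>2 / (h x * h (x + e))"
        using hx by simp
      also have "\<dots> = f x * f x * r e x + f (x + e) * f (x + e) * r (- e) (x + e) - 2 * (f x * f (x + e))"
        using hx by (simp add: r_def field_simps power2_eq_square)
      finally show ?thesis by simp
    qed
    then have "(\<Sum>\<^sub>\<infinity>x. f x * f (x + e)) \<le> (\<Sum>\<^sub>\<infinity>x. 1/2 * (f x * f x * r e x)
        + 1/2 * (f (x + e) * f (x + e) * r (- e) (x + e)))"
      by (intro infsum_mono s1 summable_on_add summable_on_cmult_right sr s2 that)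
    also have "\<dots> = 1/2 * (\<Sum>\<^sub>\<infinity>x. f x * f x * r e x)
        + 1/2 * (\<Sum>\<^sub>\<infinity>x. f (x + e) * f (x + e) * r (- e) (x + e))"
      by (subst infsum_add) (intro summable_on_cmult_right sr s2 that, intro summable_on_cmult_right sr s2 that,
          simp only: infsum_cmult_right')
    finally show ?thesis unfolding i2 .
  qed
  have s0: "(\<lambda>x. (f x * f x) * \<beta> x) summable_on UNIV"
    by (rule summable_mult_bounded[OF f2, of _ b]) (use \<beta>_le \<beta>_nonneg in auto)
  have "ip f (B f) = (\<Sum>e\<in>E. a e * (\<Sum>\<^sub>\<infinity>x. f x * f (x + e))) + (\<Sum>\<^sub>\<infinity>x. f x * f x * \<beta> x)"
  proof -
    have e1: "f x * B f x = (\<Sum>e\<in>E. a e * (f x * f (x + e))) + (f x * f x) * \<beta> x" for x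
      by (simp add: hop_def algebra_simps sum_distrib_left)
    show ?thesis
      unfolding ip_def e1
      by (simp add: infsum_add summable_on_sum summable_on_cmult_right s1 s0 infsum_sum
          infsum_cmult_right')
  qed
  also have "\<dots> \<le> (\<Sum>e\<in>E. a e * (1/2 * (\<Sum>\<^sub>\<infinity>x. f x * f x * r e x)
      + 1/2 * (\<Sum>\<^sub>\<infinity>x. f x * f x * r (- e) x))) + (\<Sum>\<^sub>\<infinity>x. f x * f x * \<beta> x)"
    by (intro add_right_mono sum_mono mult_left_mono pair a_nonneg)
  also have "(\<Sum>e\<in>E. a e * (1/2 * (\<Sum>\<^sub>\<infinity>x. f x * f x * r e x) + 1/2 * (\<Sum>\<^sub>\<infinity>x. f x * f x * r (- e) x)))
     = 1/2 * (\<Sum>e\<in>E. a e * (\<Sum>\<^sub>\<infinity>x. f x * f x * r e x))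
      + 1/2 * (\<Sum>e\<in>E. a (- e) * (\<Sum>\<^sub>\<infinity>x. f x * f x * r (- e) x))"
    by (simp add: sum.distrib sum_distrib_left algebra_simps a_neg)
  also have "\<dots> = (\<Sum>e\<in>E. a e * (\<Sum>\<^sub>\<infinity>x. f x * f x * r e x))"
    by (subst sum_neg_E) simp
  also have "\<dots> + (\<Sum>\<^sub>\<infinity>x. f x * f x * \<beta> x)
      = (\<Sum>\<^sub>\<infinity>x. (\<Sum>e\<in>E. a e * (f x * f x * r e x)) + f x * f x * \<beta> x)"
    by (simp add: infsum_add summable_on_sum summable_on_cmult_right sr s0 infsum_sum
          infsum_cmult_right')
  also have "\<dots> \<le> (\<Sum>\<^sub>\<infinity>x. s * (f x * f x))"
  proof (rule infsum_mono)
    show "(\<lambda>x. (\<Sum>e\<in>E. a e * (f x * f x * r e x)) + f x * f x * \<beta> x) summable_on UNIV"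
      by (intro summable_on_add summable_on_sum summable_on_cmult_right sr s0)
    show "(\<lambda>x. s * (f x * f x)) summable_on UNIV" by (rule summable_on_cmult_right[OF f2])
    show "(\<Sum>e\<in>E. a e * (f x * f x * r e x)) + f x * f x * \<beta> x \<le> s * (f x * f x)" for x
      using mult_right_mono[OF total[of x], of "f x * f x"]
      by (simp add: algebra_simps sum_distrib_left)
  qed
  also have "\<dots> = s * ip f f" by (simp add: ip_def infsum_cmult_right')
  finally show ?thesis .
qed

text \<open>
  The Neumann series of the resolvent is taken site by site, because it is used in \<open>l\<^sup>2\<close> as well
  as in \<open>l\<^sup>1\<close>. As \<open>B\<close> has finite range, it can be applied term by term.
\<close>

lemma neumann:
  assumes bound: "\<And>n x. \<bar>(B ^^ n) g x\<bar> \<le> C x * s ^ n" and s: "0 \<le> s" "s < S"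
  defines "f \<equiv> \<lambda>x. \<Sum>n. (B ^^ n) g x / S ^ Suc n"
  shows "summable (\<lambda>n. (B ^^ n) g x / S ^ Suc n)" "S * f x - B f x = g x"
proof -
  have S: "0 < S" using s by simp
  have geo: "summable (\<lambda>n. (C x / S) * (s / S) ^ n)" for x
    using s S by (intro summable_mult summable_geometric) auto
  have sm: "summable (\<lambda>n. (B ^^ n) g x / S ^ Suc n)" for x
  proof (rule summable_comparison_test'[OF geo, of 0])
    show "norm ((B ^^ n) g x / S ^ Suc n) \<le> (C x / S) * (s / S) ^ n" for n
      using bound[of n x] S by (simp add: field_simps power_divide)
  qed
  then show "summable (\<lambda>n. (B ^^ n) g x / S ^ Suc n)" .
  define t where "t n x = (B ^^ n) g x / S ^ Suc n" for n x
  have smt: "summable (\<lambda>n. t n x)" and ft: "f x = (\<Sum>n. t n x)" for x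
    using sm by (auto simp: t_def f_def)
  have "B f x = (\<Sum>e\<in>E. a e * (\<Sum>n. t n (x + e))) + \<beta> x * (\<Sum>n. t n x)"
    by (simp only: hop_def[of E a \<beta> f] ft)
  also have "(\<Sum>e\<in>E. a e * (\<Sum>n. t n (x + e))) = (\<Sum>n. \<Sum>e\<in>E. a e * t n (x + e))"
    by (subst suminf_sum) (auto intro: summable_mult smt simp: suminf_mult[OF smt])
  also have "\<beta> x * (\<Sum>n. t n x) = (\<Sum>n. \<beta> x * t n x)"
    by (rule suminf_mult[OF smt, symmetric])
  also have "(\<Sum>n. \<Sum>e\<in>E. a e * t n (x + e)) + (\<Sum>n. \<beta> x * t n x)
      = (\<Sum>n. (\<Sum>e\<in>E. a e * t n (x + e)) + \<beta> x * t n x)"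
    by (intro suminf_add summable_sum summable_mult smt)
  also have "\<dots> = (\<Sum>n. (B ^^ Suc n) g x / S ^ Suc n)"
    by (intro suminf_cong)
       (simp add: hop_def t_def sum_divide_distrib add_divide_distrib del: power_Suc)
  finally have Bf: "B f x = (\<Sum>n. (B ^^ Suc n) g x / S ^ Suc n)" .
  have sm': "summable (\<lambda>n. (B ^^ n) g x / S ^ n)"
    using summable_mult[OF sm[of x], of S] S by simp
  have "S * f x = (\<Sum>n. (B ^^ n) g x / S ^ n)"
    unfolding f_def using suminf_mult[OF sm[of x], of S] S by simp
  also have "\<dots> = (\<Sum>n. (B ^^ Suc n) g x / S ^ Suc n) + g x"
    using suminf_split_initial_segment[OF sm', of 1] by simp
  finally show "S * f x - B f x = g x" by (simp add: Bf)
qed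

end

section \<open>Numerical range and spectrum\<close>

lemma abs_le_l2_norm: "f \<in> ell2 \<Longrightarrow> \<bar>f x\<bar> \<le> l2_norm f"
  using square_le_ip[of f x] real_sqrt_le_mono by (fastforce simp: l2_norm_eq)

lemma L2_set_le_l2_norm:
  assumes "f \<in> ell2" "finite A"
  shows "L2_set f A \<le> l2_norm f"
  unfolding L2_set_def l2_norm_def
  using assms by (intro real_sqrt_le_mono finite_sum_le_infsum) (auto simp: ell2_def)

text \<open>
  Diagonal dominance makes the quadratic form nonnegative. Then the largest spectral value is
  also the norm, and the powers of the normalised operator converge instead of oscillating.
\<close>

locale positive_hopping = hopping +
  assumes \<beta>_ge: "sum a E < \<beta> x"
begin

lemma \<beta>_pos: "0 < \<beta> x"
  using \<beta>_ge[of x] sum_nonneg[of E a] a_nonneg by force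

text \<open>
  By \<open>2 f(x) f(x+e) \<ge> - f(x)\<^sup>2 - f(x+e)\<^sup>2\<close>, the hops cost at most \<open>sum a E\<close> times \<open>\<parallel>f\<parallel>\<^sup>2\<close>, which the diagonal
  pays for.
\<close>

lemma form_nonneg:
  assumes f: "f \<in> ell2"
  shows "0 \<le> ip f (B f)"
proof -
  have f2: "(\<lambda>x. f x * f x) summable_on UNIV" by (rule ell2_mult_summable[OF f f])
  have f2e: "(\<lambda>x. f (x + e) * f (x + e)) summable_on UNIV" for e
    by (intro ell2_mult_summable ell2_shift f)
  have s1: "(\<lambda>x. f x * f (x + e)) summable_on UNIV" for e
    by (intro ell2_mult_summable ell2_shift f)
  have pair: "- ip f f \<le> (\<Sum>\<^sub>\<infinity>x. f x * f (x + e))" for e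
  proof -
    have "(\<Sum>\<^sub>\<infinity>x. (- 1/2) * (f x * f x) + (- 1/2) * (f (x + e) * f (x + e))) \<le> (\<Sum>\<^sub>\<infinity>x. f x * f (x + e))"
    proof (intro infsum_mono s1 summable_on_add summable_on_cmult_right f2 f2e)
      show "(- 1/2) * (f x * f x) + (- 1/2) * (f (x + e) * f (x + e)) \<le> f x * f (x + e)" for x
        using zero_le_power2[of "f x + f (x + e)"] by (simp add: power2_eq_square algebra_simps)
    qed
    also have "(\<Sum>\<^sub>\<infinity>x. (- 1/2) * (f x * f x) + (- 1/2) * (f (x + e) * f (x + e)))
        = (- 1/2) * ip f f + (- 1/2) * (\<Sum>\<^sub>\<infinity>x. f (x + e) * f (x + e))"
      by (subst infsum_add) (intro summable_on_cmult_right f2 f2e, intro summable_on_cmult_right f2 f2e,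
          simp only: infsum_cmult_right' ip_def)
    also have "(\<Sum>\<^sub>\<infinity>x. f (x + e) * f (x + e)) = ip f f"
      using infsum_shift[of "\<lambda>x. f x * f x" e] by (simp add: ip_def)
    finally show ?thesis by simp
  qed
  have s0: "(\<lambda>x. (f x * f x) * \<beta> x) summable_on UNIV"
    by (rule summable_mult_bounded[OF f2, of _ b]) (use \<beta>_le \<beta>_nonneg in auto)
  have e1: "f x * B f x = (\<Sum>e\<in>E. a e * (f x * f (x + e))) + (f x * f x) * \<beta> x" for x
    by (simp add: hop_def algebra_simps sum_distrib_left)
  have "0 = (\<Sum>e\<in>E. a e * (- ip f f)) + (\<Sum>\<^sub>\<infinity>x. sum a E * (f x * f x))"
    by (simp only: infsum_cmult_right' ip_def[symmetric] sum_distrib_right[symmetric] minus_mult_right[symmetric] mult_minus_right sum_negf)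
  also have "\<dots> \<le> (\<Sum>e\<in>E. a e * (\<Sum>\<^sub>\<infinity>x. f x * f (x + e))) + (\<Sum>\<^sub>\<infinity>x. f x * f x * \<beta> x)"
  proof (intro add_mono sum_mono mult_left_mono pair a_nonneg infsum_mono summable_on_cmult_right f2 s0)
    show "sum a E * (f x * f x) \<le> f x * f x * \<beta> x" for x
      using mult_right_mono[OF less_imp_le[OF \<beta>_ge[of x]], of "f x * f x"] by (simp add: mult.commute)
  qed
  also have "\<dots> = ip f (B f)"
      unfolding ip_def e1
      by (simp add: infsum_add summable_on_sum summable_on_cmult_right s1 s0 infsum_sum
          infsum_cmult_right')
  finally show ?thesis .
qed

definition K :: real where "K = Sup {ip f (B f) | f. f \<in> ell2 \<and> ip f f = 1}"

lemma rayleigh_bdd: "bdd_above {ip f (B f) | f. f \<in> ell2 \<and> ip f f = 1}"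
proof (rule bdd_aboveI)
  fix r assume "r \<in> {ip f (B f) | f. f \<in> ell2 \<and> ip f f = 1}"
  then obtain f where f: "f \<in> ell2" "ip f f = 1" "r = ip f (B f)" by auto
  have "B (\<lambda>_. 1) x \<le> (sum a E + b) * 1" for x
    using B_bounded[of "\<lambda>_. 1" 1 x] by simp
  from supersolution_form_bound[of "\<lambda>_. 1", OF _ this f(1)] f
  show "r \<le> sum a E + b" by simp
qed

lemma rayleigh_le:
  assumes f: "f \<in> ell2"
  shows "ip f (B f) \<le> K * ip f f"
proof (cases "ip f f = 0")
  case True
  then have "f = (\<lambda>_. 0)" using ip_eq_0_iff[OF f] by auto
  then show ?thesis by (simp add: ip_def)
next
  case False
  then have pos: "0 < ip f f" using ip_nonneg[of f] by simp
  let ?c = "inverse (sqrt (ip f f))"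
  let ?g = "\<lambda>x. ?c * f x"
  have cc: "?c * ?c = inverse (ip f f)" using pos by (simp flip: inverse_mult_distrib)
  have "?g \<in> ell2" "ip ?g ?g = 1"
    using pos cc f by (auto simp: ip_cmult_left ip_cmult_right ell2_cmult mult.assoc[symmetric])
  then have "ip ?g (B ?g) \<le> K"
    unfolding K_def by (intro cSup_upper rayleigh_bdd) auto
  moreover have "ip ?g (B ?g) = inverse (ip f f) * ip f (B f)"
    using cc by (simp add: hop_cmult ip_cmult_left ip_cmult_right mult.assoc[symmetric])
  ultimately have "inverse (ip f f) * ip f (B f) \<le> K" by simp
  then show ?thesis using pos by (simp add: field_simps)
qed

lemma rayleigh_approx:
  assumes "0 < \<epsilon>"
  shows "\<exists>f\<in>ell2. ip f f = 1 \<and> K - \<epsilon> < ip f (B f)"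
proof -
  have "{ip f (B f) | f. f \<in> ell2 \<and> ip f f = 1} \<noteq> {}"
    using indicator_ell2[of 0] ip_indicator[of 0 "indicator {0} :: 'a \<Rightarrow> real"] by fastforce
  moreover have "K - \<epsilon> < Sup {ip f (B f) | f. f \<in> ell2 \<and> ip f f = 1}"
    using assms by (simp flip: K_def)
  ultimately show ?thesis
    using less_cSup_iff[OF _ rayleigh_bdd] by blast
qed

lemma B_indicator_diag: "B (indicator {x}) x \<ge> \<beta> x"
  unfolding hop_def by (auto intro!: sum_nonneg mult_nonneg_nonneg a_nonneg)

lemma \<beta>_le_K: "\<beta> x \<le> K"
  using rayleigh_le[OF indicator_ell2[of x]] B_indicator_diag[of x] by (simp add: ip_indicator)

lemma K_pos: "0 < K"
  using \<beta>_pos[of 0] \<beta>_le_K[of 0] by simp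

lemma B_norm_bound: "f \<in> ell2 \<Longrightarrow> ip (B f) (B f) \<le> K * ip f (B f)"
  by (rule form_bound_imp_norm_bound[OF hop_linear B_ell2 B_symmetric form_nonneg rayleigh_le K_pos])

lemma K_minus_B_norm_bound:
  assumes f: "f \<in> ell2"
  shows "ip (\<lambda>x. K * f x - B f x) (\<lambda>x. K * f x - B f x) \<le> K * (K * ip f f - ip f (B f))"
proof -
  let ?T = "\<lambda>f x. K * f x - B f x"
  have eq: "ip f (?T g) = K * ip f g - ip f (B g)" "ip (?T f) g = K * ip f g - ip (B f) g"
    if "f \<in> ell2" "g \<in> ell2" for f g
    using that by (simp_all add: ip_diff_right ip_diff_left ell2_cmult B_ell2 ip_cmult_left ip_cmult_right)
  have "ip (?T f) (?T f) \<le> K * ip f (?T f)"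
  proof (rule form_bound_imp_norm_bound[OF _ _ _ _ _ K_pos f])
    show "?T (\<lambda>x. f x - c * g x) = (\<lambda>x. ?T f x - c * ?T g x)" for f g c
      by (simp add: hop_linear algebra_simps)
    show "?T f \<in> ell2" if "f \<in> ell2" for f
      by (intro ell2_diff ell2_cmult B_ell2 that)
    show "ip f (?T g) = ip (?T f) g" if "f \<in> ell2" "g \<in> ell2" for f g
      by (simp add: eq that B_symmetric)
    show "0 \<le> ip f (?T f)" "ip f (?T f) \<le> K * ip f f" if "f \<in> ell2" for f
      using rayleigh_le[OF that] form_nonneg[OF that] by (simp_all only: eq[OF that that] diff_ge_0_iff_ge diff_le_eq)
  qed
  then show ?thesis by (simp only: eq[OF f f])
qed

lemma Bn_norm_bound:
  assumes f: "f \<in> ell2"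
  shows "l2_norm ((B ^^ n) f) \<le> K ^ n * l2_norm f"
proof (induction n)
  case (Suc n)
  let ?g = "(B ^^ n) f"
  have "ip (B ?g) (B ?g) \<le> K * (K * ip ?g ?g)"
    using B_norm_bound[OF Bn_ell2[OF f], of n] rayleigh_le[OF Bn_ell2[OF f], of n] K_pos
    by (meson mult_left_mono order.trans less_imp_le)
  then have "l2_norm (B ?g) \<le> sqrt (K * K * ip ?g ?g)"
    unfolding l2_norm_eq by (intro real_sqrt_le_mono) (simp add: mult.assoc)
  also have "\<dots> = K * l2_norm ?g"
    using K_pos by (simp add: real_sqrt_mult l2_norm_eq)
  also have "\<dots> \<le> K * (K ^ n * l2_norm f)"
    using Suc K_pos by (intro mult_left_mono) auto
  finally show ?case by (simp add: mult.assoc)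
qed simp

text \<open>
  The pointwise Neumann series is in \<open>l\<^sup>2\<close> because \<open>\<parallel>B\<^sup>n g\<parallel> \<le> K\<^sup>n \<parallel>g\<parallel>\<close>: on finite sets its partial sums
  obey a uniform \<open>l\<^sup>2\<close> bound, which passes to the limit.
\<close>

lemma resolvent_ell2:
  assumes g: "g \<in> ell2" and S: "K < S"
  shows "\<exists>f\<in>ell2. (\<lambda>x. S * f x - B f x) = g"
proof -
  define t where "t n x = (B ^^ n) g x / S ^ Suc n" for n x
  define f where "f x = (\<Sum>n. t n x)" for x
  have Sp: "0 < S" using S K_pos by simp
  have bound: "\<bar>(B ^^ n) g x\<bar> \<le> l2_norm g * K ^ n" for n x
    using abs_le_l2_norm[OF Bn_ell2[OF g], of n x] Bn_norm_bound[OF g, of n] by (simp add: mult.commute)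
  note neu = neumann[OF bound less_imp_le[OF K_pos] S]
  have sm: "summable (\<lambda>n. t n x)" and eq: "S * f x - B f x = g x" for x
    using neu[of x] unfolding f_def t_def by auto
  define D where "D = l2_norm g / S * (\<Sum>n. (K / S) ^ n)"
  have geo: "summable (\<lambda>n. (K / S) ^ n)"
    using S K_pos by (intro summable_geometric) auto
  have partial: "L2_set (\<lambda>x. \<Sum>n<N. t n x) A \<le> l2_norm g / S * (\<Sum>n<N. (K / S) ^ n)" if "finite A" for N A
  proof (induction N)
    case (Suc N)
    have "L2_set (t N) A \<le> l2_norm (t N)"
      by (intro L2_set_le_l2_norm that)
         (use ell2_cmult[OF Bn_ell2[OF g], of "1 / S ^ Suc N" N] in \<open>simp add: t_def[abs_def]\<close>)
    also have "l2_norm (t N) = l2_norm ((B ^^ N) g) / S ^ Suc N"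
    proof -
      have "t N = (\<lambda>x. (1 / S ^ Suc N) * (B ^^ N) g x)" by (simp add: t_def[abs_def])
      then have "ip (t N) (t N) = (1 / S ^ Suc N)\<^sup>2 * ip ((B ^^ N) g) ((B ^^ N) g)"
        by (simp only: ip_cmult_left ip_cmult_right power2_eq_square mult.assoc)
      then show ?thesis using Sp by (simp add: l2_norm_eq real_sqrt_mult)
    qed
    also have "\<dots> \<le> (K ^ N * l2_norm g) / S ^ Suc N"
      using Bn_norm_bound[OF g] Sp by (intro divide_right_mono) auto
    also have "\<dots> = l2_norm g / S * (K / S) ^ N" by (simp add: power_divide)
    finally show ?case
      using Suc L2_set_triangle_ineq[of "\<lambda>x. \<Sum>n<N. t n x" "t N" A] by (simp add: algebra_simps)
  qed (simp add: L2_set_def)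
  have le: "L2_set (\<lambda>x. \<Sum>n<N. t n x) A \<le> D" if "finite A" for N A
    by (rule order.trans[OF partial[OF that]])
       (use sum_le_suminf[OF geo, of "{..<N}"] K_pos Sp in \<open>auto simp: D_def l2_norm_eq ip_nonneg intro!: mult_left_mono divide_right_mono\<close>)
  have lim: "(\<lambda>N. L2_set (\<lambda>x. \<Sum>n<N. t n x) A) \<longlonglongrightarrow> L2_set f A" for A
    unfolding L2_set_def f_def by (intro tendsto_intros summable_LIMSEQ sm)
  have fin: "L2_set f A \<le> D" if "finite A" for A
    by (rule LIMSEQ_le_const2[OF lim]) (use le[OF that] in auto)
  have "f \<in> ell2"
    unfolding ell2_def mem_Collect_eq
  proof (rule nonneg_bdd_above_summable_on)
    show "bdd_above (sum (\<lambda>x. (f x)\<^sup>2) ` {F. F \<subseteq> UNIV \<and> finite F})"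
    proof (rule bdd_aboveI2)
      fix A assume "A \<in> {F. F \<subseteq> (UNIV :: 'a set) \<and> finite F}"
      then have "sqrt (\<Sum>x\<in>A. (f x)\<^sup>2) \<le> D" using fin by (simp add: L2_set_def)
      then show "(\<Sum>x\<in>A. (f x)\<^sup>2) \<le> D\<^sup>2"
        by (rule sqrt_le_D)
    qed
  qed simp
  with eq show ?thesis by blast
qed

text \<open>
  The spectrum of \<open>B\<close> is bounded by the numerical range, whose supremum is an approximate
  eigenvalue because \<open>\<parallel>(K - B) f\<parallel>\<^sup>2 \<le> K \<langle>f, (K - B) f\<rangle>\<close>.
\<close>

lemma Sup_spectrum: "Sup (l2_spectrum (\<lambda>f x. B f x - c * f x)) = K - c"
proof (rule cSup_eq_maximum)
  have "\<not> (\<exists>C. \<forall>f\<in>ell2. l2_norm f \<le> C * l2_norm (\<lambda>x. B f x - c * f x - (K - c) * f x))"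
  proof
    assume "\<exists>C. \<forall>f\<in>ell2. l2_norm f \<le> C * l2_norm (\<lambda>x. B f x - c * f x - (K - c) * f x)"
    then obtain C where C: "\<And>f. f \<in> ell2 \<Longrightarrow> l2_norm f \<le> C * l2_norm (\<lambda>x. B f x - c * f x - (K - c) * f x)"
      by blast
    \<comment> \<open>chosen to make \<open>C\<^sup>2 K \<epsilon> < 1\<close> in the last step\<close>
    define \<epsilon> where "\<epsilon> = 1 / (K * (C\<^sup>2 + 1))"
    have \<epsilon>: "0 < \<epsilon>" using K_pos by (auto simp: \<epsilon>_def intro!: divide_pos_pos mult_pos_pos add_nonneg_pos)
    obtain f where f: "f \<in> ell2" "ip f f = 1" "K - \<epsilon> < ip f (B f)"
      using rayleigh_approx[OF \<epsilon>] by blast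
    let ?u = "\<lambda>x. K * f x - B f x"
    have "(\<lambda>x. B f x - c * f x - (K - c) * f x) = (\<lambda>x. (-1) * ?u x)"
      by (simp add: algebra_simps)
    then have "l2_norm (\<lambda>x. B f x - c * f x - (K - c) * f x) = l2_norm ?u"
      by (simp only: l2_norm_eq ip_cmult_left ip_cmult_right) simp
    then have "1 \<le> C * l2_norm ?u" using C[OF f(1)] f(2) by (simp add: l2_norm_eq[of f])
    then have "1\<^sup>2 \<le> (C * l2_norm ?u)\<^sup>2" by (intro power_mono) auto
    also have "\<dots> = C\<^sup>2 * ip ?u ?u" by (simp add: power_mult_distrib l2_norm_power2)
    also have "\<dots> \<le> C\<^sup>2 * (K * (K * ip f f - ip f (B f)))"
      by (intro mult_left_mono K_minus_B_norm_bound f) simp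
    also have "\<dots> \<le> C\<^sup>2 * (K * \<epsilon>)"
      using f K_pos by (intro mult_left_mono) auto
    also have "\<dots> < 1"
      using K_pos by (simp add: \<epsilon>_def field_simps add_pos_nonneg)
    finally show False by simp
  qed
  then show "K - c \<in> l2_spectrum (\<lambda>f x. B f x - c * f x)"
    by (simp add: l2_spectrum_def)
next
  fix \<mu> assume \<mu>: "\<mu> \<in> l2_spectrum (\<lambda>f x. B f x - c * f x)"
  show "\<mu> \<le> K - c"
  proof (rule ccontr)
    assume "\<not> \<mu> \<le> K - c"
    define S where "S = \<mu> + c"
    have S: "K < S" using \<open>\<not> \<mu> \<le> K - c\<close> by (simp add: S_def)
    let ?T = "\<lambda>f x. B f x - c * f x - \<mu> * f x"
    have T: "?T f = (\<lambda>x. B f x - S * f x)" for f by (simp add: S_def algebra_simps)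
    have Tmem: "(\<lambda>x. B f x - S * f x) \<in> ell2" if "f \<in> ell2" for f
      using that by (intro ell2_diff ell2_cmult B_ell2)
    \<comment> \<open>expand \<open>0 \<le> \<parallel>(B - S) f + (S - K) f\<parallel>\<^sup>2\<close> and use \<open>\<langle>f, B f\<rangle> \<le> K \<parallel>f\<parallel>\<^sup>2\<close>\<close>
    have lower: "(S - K)\<^sup>2 * ip f f \<le> ip (?T f) (?T f)" if f: "f \<in> ell2" for f
    proof -
      define \<delta> u w where "\<delta> = S - K" and "u = (\<lambda>x. B f x - S * f x)" and "w = (\<lambda>x. (- \<delta>) * f x)"
      have u: "u \<in> ell2" using Tmem[OF f] by (simp add: u_def)
      have w: "w \<in> ell2" unfolding w_def by (rule ell2_cmult[OF f])
      have "0 \<le> ip (\<lambda>x. u x - w x) (\<lambda>x. u x - w x)" by (rule ip_nonneg)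
      also have "\<dots> = ip u u - ip w u - (ip u w - ip w w)"
        by (simp add: ip_diff_left ip_diff_right ell2_diff u w)
      also have "ip w u = - \<delta> * ip f u" unfolding w_def by (rule ip_cmult_left)
      also have "ip u w = - \<delta> * ip f u" unfolding w_def by (metis ip_cmult_right ip_commute)
      also have "ip w w = \<delta> * \<delta> * ip f f" unfolding w_def ip_cmult_left ip_cmult_right by simp
      finally have "0 \<le> ip u u + 2 * \<delta> * ip f u + \<delta> * \<delta> * ip f f" by simp
      also have "ip f u = ip f (B f) - S * ip f f"
        using f by (simp add: u_def ip_diff_right B_ell2 ell2_cmult ip_cmult_right)
      also have "ip u u + 2 * \<delta> * (ip f (B f) - S * ip f f) + \<delta> * \<delta> * ip f f
          \<le> ip u u + 2 * \<delta> * (K * ip f f - S * ip f f) + \<delta> * \<delta> * ip f f"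
        using S rayleigh_le[OF f] by (simp add: \<delta>_def)
      finally show ?thesis unfolding T u_def[symmetric] by (simp add: power2_eq_square algebra_simps \<delta>_def)
    qed
    have bd: "l2_norm f \<le> 1 / (S - K) * l2_norm (?T f)" if "f \<in> ell2" for f
    proof -
      have "(S - K) * l2_norm f = sqrt ((S - K)\<^sup>2 * ip f f)"
        using S by (simp add: real_sqrt_mult l2_norm_eq)
      also have "\<dots> \<le> l2_norm (?T f)"
        unfolding l2_norm_eq[of "?T f"] by (intro real_sqrt_le_mono lower that)
      finally show ?thesis using S by (simp add: field_simps)
    qed
    have inj: "inj_on ?T ell2"
    proof (rule inj_onI)
      fix f g :: "'a \<Rightarrow> real" assume f: "f \<in> ell2" and g: "g \<in> ell2" and eq: "?T f = ?T g"
      let ?d = "\<lambda>x. f x - 1 * g x"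
      have d: "?d \<in> ell2" using ell2_diff[OF f g] by simp
      have "?T ?d x = ?T f x - ?T g x" for x
        by (simp only: hop_linear) (simp add: algebra_simps)
      then have "?T ?d = (\<lambda>_. 0)" using eq by (simp add: fun_eq_iff)
      then have "ip (?T ?d) (?T ?d) = 0" by (simp add: ip_def)
      then have "ip ?d ?d \<le> 0" using lower[OF d] S by (simp add: mult_le_0_iff)
      then show "f = g" using ip_eq_0_iff[OF d] ip_nonneg[of ?d] by (auto simp: fun_eq_iff)
    qed
    have surj: "?T ` ell2 = ell2"
    proof (intro equalityI subsetI)
      fix g :: "'a \<Rightarrow> real" assume "g \<in> ell2"
      then obtain f where f: "f \<in> ell2" "(\<lambda>x. S * f x - B f x) = (\<lambda>x. (-1) * g x)"
        using resolvent_ell2[OF ell2_cmult S] by blast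
      have "?T f = g" unfolding T using f(2) by (auto simp: fun_eq_iff algebra_simps)
      with f show "g \<in> ?T ` ell2" by blast
    qed (use Tmem T in auto)
    have bex: "\<exists>C. \<forall>f\<in>ell2. l2_norm f \<le> C * l2_norm (?T f)"
      using bd by blast
    have "\<mu> \<notin> l2_spectrum (\<lambda>f x. B f x - c * f x)"
      using inj surj bex unfolding l2_spectrum_def bij_betw_def by blast
    with \<mu> show False by simp
  qed
qed

end

section \<open>Ground states\<close>

text \<open>
  The product of the intervals is compact by Tychonoff's theorem, and sequentially compact since
  there are only countably many factors.
\<close>

lemma bounded_pointwise_subsequence:
  fixes f :: "nat \<Rightarrow> 'x :: countable \<Rightarrow> real"
  assumes "\<And>n x. \<bar>f n x\<bar> \<le> C"
  shows "\<exists>r l. strict_mono r \<and> (\<forall>x. (\<lambda>n. f (r n) x) \<longlonglongrightarrow> l x)"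
proof -
  let ?K = "PiE UNIV (\<lambda>_. {- C..C}) :: ('x \<Rightarrow> real) set"
  have "compact ?K"
    using compactin_PiE[of "\<lambda>_. euclidean" UNIV "\<lambda>_ :: 'x. {- C..C}"]
    by (simp add: euclidean_product_topology)
  then have "seq_compact ?K" by (rule compact_imp_seq_compact)
  moreover have "f n \<in> ?K" for n using assms by (auto simp: abs_le_iff minus_le_iff)
  ultimately obtain l r where r: "strict_mono r" and lim: "(f \<circ> r) \<longlonglongrightarrow> l"
    unfolding seq_compact_def by metis
  have "(\<lambda>n. f (r n) x) \<longlonglongrightarrow> l x" for x
  proof -
    have "isCont (\<lambda>g :: 'x \<Rightarrow> real. g x) l"
      using continuous_on_product_coordinates[where 'a = 'x and 'b = real, of x]
      unfolding continuous_on_eq_continuous_at[OF open_UNIV] by blast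
    from isCont_tendsto_compose[OF this lim] show ?thesis by (simp add: o_def)
  qed
  with r show ?thesis by blast
qed

text \<open>
  Summation against \<open>h\<close> is contracted by the adjoint action: \<open>\<langle>B\<^sup>n g, h\<rangle> = \<langle>g, B\<^sup>n h\<rangle> \<le> s\<^sup>n \<langle>g, h\<rangle>\<close>. As \<open>h\<close> lies
  between positive constants, this is decay of the \<open>l\<^sup>1\<close> norms, and the Neumann series
  converges in \<open>l\<^sup>1\<close> at every level above \<open>s\<close>.
\<close>

lemma (in hopping) summable_resolvent:
  assumes h: "\<And>x. 1 \<le> h x" "\<And>x. h x \<le> C" and super: "\<And>x. B h x \<le> s * h x" and S: "s < S"
    and g_nonneg: "\<And>x. 0 \<le> g x" and g_summable: "g summable_on UNIV"
  shows "\<exists>\<psi>. (\<forall>x. 0 \<le> \<psi> x) \<and> \<psi> summable_on UNIV \<and> (\<forall>x. S * \<psi> x - B \<psi> x = g x)"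
proof -
  have h_pos: "0 < h x" for x using h(1)[of x] by simp
  have h_abs: "\<bar>h x\<bar> \<le> C" for x using h(2)[of x] h_pos[of x] by simp
  have s: "0 \<le> s"
  proof -
    have "0 \<le> B h 0" by (rule B_nonneg) (rule less_imp_le[OF h_pos])
    then have "0 \<le> s * h 0" using super[of 0] by simp
    then show ?thesis using h_pos[of 0] by (simp add: zero_le_mult_iff)
  qed
  have S_pos: "0 < S" using s S by simp
  have Bn_h: "(B ^^ n) h x \<le> s ^ n * h x" for n x
  proof (induction n arbitrary: x)
    case (Suc n)
    have "B ((B ^^ n) h) x \<le> B (\<lambda>x. s ^ n * h x) x" by (rule B_mono) (rule Suc)
    also have "\<dots> \<le> s ^ n * (s * h x)" unfolding hop_cmult by (intro mult_left_mono super) (simp add: s)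
    finally show ?case by (simp add: mult_ac)
  qed simp
  have Bn_g_nonneg: "0 \<le> (B ^^ n) g x" for n x by (rule Bn_nonneg[OF g_nonneg])
  have Bn_g_sum: "(B ^^ n) g summable_on UNIV" "infsum ((B ^^ n) g) UNIV \<le> ip g h * s ^ n" for n
  proof -
    note sym = Bn_symmetric_l1_bounded[OF g_summable h_abs, of n]
    show sm: "(B ^^ n) g summable_on UNIV" by (rule sym)
    have "infsum ((B ^^ n) g) UNIV \<le> ip ((B ^^ n) g) h"
      unfolding ip_def
    proof (intro infsum_mono sm summable_mult_bounded[OF sm h_abs])
      show "(B ^^ n) g x \<le> (B ^^ n) g x * h x" for x
        using mult_left_mono[OF h(1)[of x] Bn_g_nonneg[of n x]] by simp
    qed
    also have "\<dots> = ip g ((B ^^ n) h)" by (rule sym(2)[symmetric])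
    also have "\<dots> \<le> (\<Sum>\<^sub>\<infinity>x. s ^ n * (g x * h x))"
      unfolding ip_def
    proof (rule infsum_mono)
      show "(\<lambda>x. g x * (B ^^ n) h x) summable_on UNIV"
        by (rule summable_mult_bounded[OF g_summable Bn_bounded[OF h_abs]])
      show "(\<lambda>x. s ^ n * (g x * h x)) summable_on UNIV"
        by (intro summable_on_cmult_right summable_mult_bounded[OF g_summable h_abs])
      show "g x * (B ^^ n) h x \<le> s ^ n * (g x * h x)" for x
        using mult_left_mono[OF Bn_h[of n x] g_nonneg[of x]] by (simp add: mult_ac)
    qed
    also have "\<dots> = ip g h * s ^ n" by (simp add: infsum_cmult_right' ip_def)
    finally show "infsum ((B ^^ n) g) UNIV \<le> ip g h * s ^ n" .
  qed
  have Bn_g_le: "\<bar>(B ^^ n) g x\<bar> \<le> ip g h * s ^ n" for n x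
    using summable_bounded[where f = "(B ^^ n) g" and x = x, OF Bn_g_sum(1) Bn_g_nonneg] Bn_g_sum(2)[of n]
      Bn_g_nonneg[of n x] by simp
  define \<psi> where "\<psi> x = (\<Sum>n. (B ^^ n) g x / S ^ Suc n)" for x
  note neu = neumann[OF Bn_g_le s S]
  have \<psi>: "summable (\<lambda>n. (B ^^ n) g x / S ^ Suc n)" "S * \<psi> x - B \<psi> x = g x" for x
    using neu[of x] unfolding \<psi>_def[abs_def] by auto
  have \<psi>_nonneg: "0 \<le> \<psi> x" for x
    unfolding \<psi>_def using Bn_g_nonneg S_pos by (intro suminf_nonneg \<psi>(1)) auto
  have "\<psi> summable_on UNIV"
  proof (rule nonneg_bdd_above_summable_on)
    have geo: "summable (\<lambda>n. ip g h / S * (s / S) ^ n)"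
      using s S by (intro summable_mult summable_geometric) auto
    show "bdd_above (sum \<psi> ` {F. F \<subseteq> UNIV \<and> finite F})"
    proof (rule bdd_aboveI2)
      fix A assume "A \<in> {F. F \<subseteq> (UNIV :: 'x set) \<and> finite F}"
      then have A: "finite A" by simp
      have "sum \<psi> A = (\<Sum>n. \<Sum>x\<in>A. (B ^^ n) g x / S ^ Suc n)"
        unfolding \<psi>_def by (rule suminf_sum[symmetric]) (rule \<psi>(1))
      also have "\<dots> \<le> (\<Sum>n. ip g h / S * (s / S) ^ n)"
      proof (rule suminf_le[OF _ summable_sum geo])
        fix n
        have "(\<Sum>x\<in>A. (B ^^ n) g x) \<le> ip g h * s ^ n"
          using finite_sum_le_infsum[OF Bn_g_sum(1)[of n] A] Bn_g_sum(2)[of n] Bn_g_nonneg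
          by force
        then show "(\<Sum>x\<in>A. (B ^^ n) g x / S ^ Suc n) \<le> ip g h / S * (s / S) ^ n"
          using S_pos by (simp add: sum_divide_distrib[symmetric] power_divide divide_right_mono)
      qed (rule \<psi>(1))
      finally show "sum \<psi> A \<le> (\<Sum>n. ip g h / S * (s / S) ^ n)" .
    qed
  qed (rule \<psi>_nonneg)
  with \<psi> \<psi>_nonneg show ?thesis by blast
qed

context positive_hopping
begin

lemma ip_pointwise_finite:
  assumes "finite A" "\<And>x. x \<notin> A \<Longrightarrow> f x * g x = 0"
  shows "ip f g = (\<Sum>x\<in>A. f x * g x)"
proof -
  have "ip f g = (\<Sum>\<^sub>\<infinity>x\<in>A. f x * g x)"
    unfolding ip_def by (rule infsum_cong_neutral) (use assms in auto)
  then show ?thesis using assms(1) by simp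
qed

text \<open>
  Taking absolute values does not lower the Rayleigh quotient of a matrix with nonnegative entries,
  so it can be maximised among nonnegative functions.
\<close>

lemma abs_form:
  assumes f: "f \<in> ell2"
  shows "ip f (B f) \<le> ip (\<lambda>x. \<bar>f x\<bar>) (B (\<lambda>x. \<bar>f x\<bar>))"
  unfolding ip_def
proof (rule infsum_mono)
  show "(\<lambda>x. f x * B f x) summable_on UNIV" "(\<lambda>x. \<bar>f x\<bar> * B (\<lambda>x. \<bar>f x\<bar>) x) summable_on UNIV"
    by (intro ell2_mult_summable B_ell2 ell2_abs f)+
  show "f x * B f x \<le> \<bar>f x\<bar> * B (\<lambda>x. \<bar>f x\<bar>) x" for x
    using mult_left_mono[OF B_abs[of f x], of "\<bar>f x\<bar>"] abs_ge_self[of "f x * B f x"]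
    by (simp add: abs_mult)
qed

lemma maximizing_sequence:
  "\<exists>f. \<forall>n. f n \<in> ell2 \<and> (\<forall>x. 0 \<le> f n x) \<and> ip (f n) (f n) = 1 \<and> K - 1 / real (Suc n) < ip (f n) (B (f n))"
proof -
  have "\<exists>f. f \<in> ell2 \<and> (\<forall>x. 0 \<le> f x) \<and> ip f f = 1 \<and> K - 1 / real (Suc n) < ip f (B f)" for n
  proof -
    obtain g where g: "g \<in> ell2" "ip g g = 1" "K - 1 / real (Suc n) < ip g (B g)"
      using rayleigh_approx[of "1 / real (Suc n)"] by auto
    have "ip (\<lambda>x. \<bar>g x\<bar>) (\<lambda>x. \<bar>g x\<bar>) = ip g g" by (simp add: ip_def)
    then show ?thesis
      using g abs_form[OF g(1)] ell2_abs[OF g(1)] by (intro exI[of _ "\<lambda>x. \<bar>g x\<bar>"]) auto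
  qed
  then show ?thesis by metis
qed

text \<open>
  At a zero of \<open>f\<close> all terms of \<open>B f = K f = 0\<close> are nonnegative, so they vanish one by one.
\<close>

lemma zero_set_hop_closed:
  assumes nonneg: "\<And>x. 0 \<le> f x" and Bf: "B f = (\<lambda>x. K * f x)" and x: "f x = 0" and e: "e \<in> E"
  shows "f (x + e) = 0"
proof -
  have "a e * f (x + e) \<le> (\<Sum>e\<in>E. a e * f (x + e))"
    using e by (intro member_le_sum finite_E mult_nonneg_nonneg a_nonneg nonneg) auto
  also have "\<dots> \<le> B f x" unfolding hop_def using \<beta>_nonneg[of x] nonneg[of x] by simp
  also have "\<dots> = 0" using Bf x by simp
  finally show ?thesis using a_pos[OF e] nonneg[of "x + e"] by (simp add: mult_le_0_iff)
qed

text \<open>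
  Let \<open>P = B - W\<close>. Its form is at most \<open>s\<close>, so \<open>\<Sum> W f\<^sub>n\<^sup>2 = \<langle>f\<^sub>n, B f\<^sub>n\<rangle> - \<langle>f\<^sub>n, P f\<^sub>n\<rangle>\<close> is asymptotically at least
  \<open>K - s > 0\<close> along a maximising sequence. This is a sum over the finite set \<open>F\<close> and hence passes
  to a pointwise limit \<open>l\<close>, which therefore is not zero. Summability of \<open>l\<close> comes from
  \<open>(K - P) l = W l\<close>: the equation has a solution in \<open>l\<^sup>1\<close>, and only one in \<open>l\<^sup>2\<close>.
\<close>

lemma ground_state:
  assumes connected: "\<And>S. S \<noteq> {} \<Longrightarrow> (\<And>x e. x \<in> S \<Longrightarrow> e \<in> E \<Longrightarrow> x + e \<in> S) \<Longrightarrow> S = UNIV"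
    and F: "finite F" and W: "\<And>x. 0 \<le> W x" "\<And>x. x \<notin> F \<Longrightarrow> W x = 0" "\<And>x. W x \<le> \<beta> x"
    and h: "\<And>x. 1 \<le> h x" "\<And>x. h x \<le> C" and super: "\<And>x. B h x - W x * h x \<le> s * h x"
    and "s < K"
  shows "\<exists>v. (\<forall>x. 0 < v x) \<and> v summable_on UNIV \<and> ip v v = 1 \<and> B v = (\<lambda>x. K * v x)"
proof -
  interpret P: hopping E a "\<lambda>x. \<beta> x - W x" b
    by unfold_locales
       (use finite_E neg_E a_neg a_pos W \<beta>_le in \<open>auto simp: diff_le_eq intro: order.trans add_increasing2\<close>)
  have PB: "P.B f x = B f x - W x * f x" for f x by (simp add: hop_def algebra_simps)
  have h_pos: "0 < h x" for x using h(1)[of x] by simp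
  have super': "P.B h x \<le> s * h x" for x using super by (simp add: PB)
  have form: "ip f (P.B f) \<le> s * ip f f" if "f \<in> ell2" for f
    by (rule P.supersolution_form_bound[OF h_pos super' that])
  have split: "ip f (B f) = ip f (P.B f) + (\<Sum>x\<in>F. W x * (f x)\<^sup>2)" if f: "f \<in> ell2" for f
  proof -
    have "ip f (B f) - ip f (P.B f) = ip f (\<lambda>x. B f x - P.B f x)"
      by (rule ip_diff_right[symmetric]) (intro f B_ell2 P.B_ell2)+
    also have "\<dots> = ip f (\<lambda>x. W x * f x)" by (simp add: PB)
    also have "\<dots> = (\<Sum>x\<in>F. f x * (W x * f x))"
      by (rule ip_pointwise_finite[OF F]) (simp add: W)
    finally show ?thesis by (simp add: power2_eq_square mult_ac)
  qed
  obtain f where f: "\<And>n. f n \<in> ell2" "\<And>n x. 0 \<le> f n x" "\<And>n. ip (f n) (f n) = 1"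
      "\<And>n. K - 1 / real (Suc n) < ip (f n) (B (f n))"
    using maximizing_sequence by blast
  have f_le: "\<bar>f n x\<bar> \<le> 1" for n x
    using abs_le_l2_norm[OF f(1), of n x] by (simp add: l2_norm_eq f(3))
  obtain r l where r: "strict_mono r" and lim: "\<And>x. (\<lambda>n. f (r n) x) \<longlonglongrightarrow> l x"
    using bounded_pointwise_subsequence[of f 1, OF f_le] by blast
  have inv: "(\<lambda>n. 1 / real (Suc (r n))) \<longlonglongrightarrow> 0"
    using LIMSEQ_subseq_LIMSEQ[OF LIMSEQ_inverse_real_of_nat r] by (simp add: o_def inverse_eq_divide)
  have l_nonneg: "0 \<le> l x" for x
    by (rule LIMSEQ_le_const[OF lim]) (use f(2) in auto)
  \<comment> \<open>the residuals \<open>(K - B) f\<^sub>n\<close> tend to 0 in \<open>l\<^sup>2\<close>, hence at every site\<close>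
  have eig: "K * l x = B l x" for x
  proof -
    have "(K * f (r n) x - B (f (r n)) x)\<^sup>2 \<le> K * (1 / real (Suc (r n)))" for n
    proof -
      let ?f = "f (r n)"
      have "(K * ?f x - B ?f x)\<^sup>2 \<le> ip (\<lambda>x. K * ?f x - B ?f x) (\<lambda>x. K * ?f x - B ?f x)"
        by (rule square_le_ip[where f = "\<lambda>x. K * ?f x - B ?f x"])
           (intro ell2_diff ell2_cmult B_ell2 f(1))
      also have "\<dots> \<le> K * (K * ip ?f ?f - ip ?f (B ?f))" by (rule K_minus_B_norm_bound[OF f(1)])
      also have "\<dots> \<le> K * (1 / real (Suc (r n)))"
        using f(3,4)[of "r n"] K_pos by (intro mult_left_mono) auto
      finally show ?thesis .
    qed
    moreover have "(\<lambda>n. (K * f (r n) x - B (f (r n)) x)\<^sup>2) \<longlonglongrightarrow> (K * l x - B l x)\<^sup>2"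
      unfolding hop_def by (intro tendsto_intros lim)
    moreover have "(\<lambda>n. K * (1 / real (Suc (r n)))) \<longlonglongrightarrow> K * 0"
      by (intro tendsto_intros inv)
    ultimately have "(K * l x - B l x)\<^sup>2 \<le> K * 0"
      by (intro LIMSEQ_le) auto
    then show ?thesis by simp
  qed
  have l_ell2: "l \<in> ell2"
    unfolding ell2_def mem_Collect_eq
  proof (rule nonneg_bdd_above_summable_on)
    show "bdd_above (sum (\<lambda>x. (l x)\<^sup>2) ` {F. F \<subseteq> UNIV \<and> finite F})"
    proof (rule bdd_aboveI2)
      fix A assume "A \<in> {F. F \<subseteq> (UNIV :: 'a set) \<and> finite F}"
      then have A: "finite A" by simp
      have "(\<Sum>x\<in>A. (f n x)\<^sup>2) \<le> 1" for n
        using finite_sum_le_infsum[of "\<lambda>x. (f n x)\<^sup>2" UNIV A] f(1)[of n] f(3)[of n] A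
        by (simp add: ell2_def ip_def power2_eq_square)
      moreover have "(\<lambda>n. \<Sum>x\<in>A. (f (r n) x)\<^sup>2) \<longlonglongrightarrow> (\<Sum>x\<in>A. (l x)\<^sup>2)"
        by (intro tendsto_intros lim)
      ultimately show "(\<Sum>x\<in>A. (l x)\<^sup>2) \<le> 1" by (intro LIMSEQ_le_const2) auto
    qed
  qed simp
  have mass: "K - s \<le> (\<Sum>x\<in>F. W x * (l x)\<^sup>2)"
  proof (rule LIMSEQ_le)
    show "(\<lambda>n. K - 1 / real (Suc (r n)) - s) \<longlonglongrightarrow> K - s"
      using tendsto_diff[OF tendsto_diff[OF tendsto_const inv] tendsto_const, of K s] by simp
    show "(\<lambda>n. \<Sum>x\<in>F. W x * (f (r n) x)\<^sup>2) \<longlonglongrightarrow> (\<Sum>x\<in>F. W x * (l x)\<^sup>2)"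
      by (intro tendsto_intros lim)
    have "K - 1 / real (Suc (r n)) - s \<le> (\<Sum>x\<in>F. W x * (f (r n) x)\<^sup>2)" for n
      using split[OF f(1), of "r n"] form[OF f(1), of "r n"] f(3,4)[of "r n"] by simp
    then show "\<exists>N. \<forall>n\<ge>N. K - 1 / real (Suc (r n)) - s \<le> (\<Sum>x\<in>F. W x * (f (r n) x)\<^sup>2)" by blast
  qed
  have l_pos: "0 < l x" for x
  proof (rule ccontr)
    assume "\<not> 0 < l x"
    then have x: "l x = 0" using l_nonneg[of x] by simp
    have "{x. l x = 0} = UNIV"
    proof (rule connected)
      have "B l = (\<lambda>x. K * l x)" using eig by auto
      then show "y + e \<in> {x. l x = 0}" if "y \<in> {x. l x = 0}" "e \<in> E" for y e
        using zero_set_hop_closed[of l, OF l_nonneg] that by simp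
    qed (use x in auto)
    then have "l y = 0" for y by auto
    then show False using mass \<open>s < K\<close> by simp
  qed
  define g where "g x = W x * l x" for x
  have g_nonneg: "0 \<le> g x" for x by (simp add: g_def W l_nonneg)
  have g_summable: "g summable_on UNIV"
    by (rule finite_nonzero_values_imp_summable_on)
       (use F W in \<open>auto simp: g_def intro!: finite_subset[of _ F]\<close>)
  obtain \<psi> where \<psi>_nonneg: "\<And>x. 0 \<le> \<psi> x" and \<psi>_summable: "\<psi> summable_on UNIV"
      and \<psi>: "\<And>x. K * \<psi> x - P.B \<psi> x = g x"
    using P.summable_resolvent[OF h super' \<open>s < K\<close> g_nonneg g_summable] by blast
  have \<psi>_ell2: "\<psi> \<in> ell2" by (rule summable_imp_ell2[OF \<psi>_summable \<psi>_nonneg])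
  \<comment> \<open>both solve \<open>(K - P) f = W l\<close>, and \<open>K - P \<ge> K - s > 0\<close> in the sense of forms\<close>
  have "l = \<psi>"
  proof -
    let ?d = "\<lambda>x. l x - 1 * \<psi> x"
    have d: "?d \<in> ell2" using ell2_diff[OF l_ell2 \<psi>_ell2] by simp
    have "P.B ?d = (\<lambda>x. K * ?d x)"
    proof
      fix x
      have "P.B ?d x = P.B l x - 1 * P.B \<psi> x" by (simp only: hop_linear)
      also have "\<dots> = K * ?d x" using eig[of x] \<psi>[of x] by (simp add: PB g_def algebra_simps)
      finally show "P.B ?d x = K * ?d x" .
    qed
    then have "K * ip ?d ?d \<le> s * ip ?d ?d" using form[OF d] by (simp only: ip_cmult_right)
    then have "ip ?d ?d = 0" using \<open>s < K\<close> ip_nonneg[of ?d] by (smt (verit) mult_right_less_imp_less mult_less_cancel_right)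
    then show ?thesis using ip_eq_0_iff[OF d] by (auto simp: fun_eq_iff)
  qed
  with \<psi>_summable have l_summable: "l summable_on UNIV" by simp
  have "0 < ip l l"
    using ip_eq_0_iff[OF l_ell2] ip_nonneg[of l] l_pos by (metis less_le less_irrefl)
  then have c: "0 < inverse (sqrt (ip l l))" "inverse (sqrt (ip l l)) * inverse (sqrt (ip l l)) = inverse (ip l l)"
    by (simp_all flip: inverse_mult_distrib)
  show ?thesis
    by (rule exI[of _ "\<lambda>x. inverse (sqrt (ip l l)) * l x"])
       (use c l_pos l_summable eig \<open>0 < ip l l\<close> in \<open>auto simp: ip_cmult_left ip_cmult_right hop_cmult
          mult.assoc[symmetric] fun_eq_iff intro: summable_on_cmult_right\<close>)
qed

text \<open>
  A solution vanishing somewhere vanishes everywhere: \<open>B |w| \<ge> K |w|\<close>, while both sides have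
  the same sum against \<open>v\<close>; so \<open>|w|\<close> is a nonnegative solution, and zeros spread along \<open>E\<close>.
\<close>

lemma ground_state_simple:
  assumes connected: "\<And>S. S \<noteq> {} \<Longrightarrow> (\<And>x e. x \<in> S \<Longrightarrow> e \<in> E \<Longrightarrow> x + e \<in> S) \<Longrightarrow> S = UNIV"
    and v: "\<And>x. 0 < v x" "v \<in> ell2" "B v = (\<lambda>x. K * v x)"
    and w: "w \<in> ell2" "B w = (\<lambda>x. K * w x)" "w x\<^sub>0 = 0"
  shows "w x = 0"
proof -
  let ?u = "\<lambda>x. \<bar>w x\<bar>"
  have u: "?u \<in> ell2" by (rule ell2_abs[OF w(1)])
  have ge: "K * ?u x \<le> B ?u x" for x
    using B_abs[of w x] w(2) K_pos by (simp add: abs_mult)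
  have Ku: "(\<lambda>x. K * ?u x) \<in> ell2" by (rule ell2_cmult[OF u])
  have "ip v (\<lambda>x. B ?u x - K * ?u x) = ip (B v) ?u - K * ip v ?u"
    by (simp add: ip_diff_right[OF v(2) B_ell2[OF u] Ku] ip_cmult_right B_symmetric[OF v(2) u])
  also have "\<dots> = 0" using v(3) by (simp add: ip_cmult_left)
  finally have zero: "infsum (\<lambda>x. v x * (B ?u x - K * ?u x)) UNIV = 0" by (simp add: ip_def)
  have "v x * (B ?u x - K * ?u x) = 0" for x
  proof (rule nonneg_infsum_le_0D[of "\<lambda>x. v x * (B ?u x - K * ?u x)" UNIV])
    show "(\<lambda>x. v x * (B ?u x - K * ?u x)) summable_on UNIV"
      by (intro ell2_mult_summable v ell2_diff B_ell2 u Ku)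
  qed (use zero ge v(1) in \<open>auto simp: less_imp_le\<close>)
  then have Bu: "B ?u = (\<lambda>x. K * ?u x)" using v(1) by (auto simp: fun_eq_iff less_imp_neq[symmetric] dest: less_imp_neq)
  have "{x. ?u x = 0} = UNIV"
  proof (rule connected)
    show "y + e \<in> {x. ?u x = 0}" if "y \<in> {x. ?u x = 0}" "e \<in> E" for y e
      using zero_set_hop_closed[of ?u, OF _ Bu] that by simp
  qed (use w(3) in auto)
  then show ?thesis by auto
qed

end

section \<open>Convergence of powers\<close>

lemma infsum_dominated_convergence:
  fixes f :: "nat \<Rightarrow> 'a :: countable \<Rightarrow> real"
  assumes lim: "\<And>x. (\<lambda>n. f n x) \<longlonglongrightarrow> g x" and bound: "\<And>n x. \<bar>f n x\<bar> \<le> u x"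
    and u: "u summable_on UNIV"
  shows "(\<lambda>n. infsum (f n) UNIV) \<longlonglongrightarrow> infsum g UNIV"
proof -
  have eq: "infsum F UNIV = integral\<^sup>L (count_space UNIV) F" "integrable (count_space UNIV) F"
    if "F summable_on UNIV" for F :: "'a \<Rightarrow> real"
  proof -
    have "Infinite_Set_Sum.abs_summable_on F UNIV"
      using summable_on_iff_abs_summable_on_real[of F UNIV] that abs_summable_equivalent by blast
    then show "infsum F UNIV = integral\<^sup>L (count_space UNIV) F" "integrable (count_space UNIV) F"
      by (simp_all add: infsetsum_infsum[symmetric] infsetsum_def Infinite_Set_Sum.abs_summable_on_def)
  qed
  have f: "f n summable_on UNIV" for n by (rule summable_on_real_comparison[OF u bound])
  have "\<bar>g x\<bar> \<le> u x" for x
    by (rule LIMSEQ_le_const2[OF tendsto_rabs[OF lim]]) (use bound in auto)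
  then have g: "g summable_on UNIV" by (rule summable_on_real_comparison[OF u])
  have "(\<lambda>n. integral\<^sup>L (count_space UNIV) (f n)) \<longlonglongrightarrow> integral\<^sup>L (count_space UNIV) g"
    by (rule integral_dominated_convergence[where w = u])
       (use lim bound eq(2)[OF u] in auto)
  then show ?thesis by (simp add: eq f g)
qed

text \<open>
  Let \<open>T = B / K\<close> and \<open>q\<^sub>n = T\<^sup>n \<delta>\<^sub>x\<close>. By symmetry \<open>\<langle>q\<^sub>m, q\<^sub>n\<rangle> = q\<^sub>m\<^sub>+\<^sub>n(x)\<close>, and \<open>0 \<le> T \<le> 1\<close> makes \<open>q\<^sub>n(x)\<close>
  decreasing, so \<open>\<parallel>q\<^sub>m - q\<^sub>n\<parallel>\<^sup>2 = q\<^sub>2\<^sub>m(x) + q\<^sub>2\<^sub>n(x) - 2 q\<^sub>m\<^sub>+\<^sub>n(x)\<close> tends to 0. The limit is fixed by \<open>T\<close>,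
  hence a multiple of \<open>v\<close>, and the invariant \<open>\<langle>v, q\<^sub>n\<rangle> = v(x)\<close> determines the factor. The domination
  \<open>q\<^sub>n \<le> v / v(x)\<close>, where summability of \<open>v\<close> enters, allows summing over all sites.
\<close>

lemma (in positive_hopping) power_convergence:
  assumes connected: "\<And>S. S \<noteq> {} \<Longrightarrow> (\<And>x e. x \<in> S \<Longrightarrow> e \<in> E \<Longrightarrow> x + e \<in> S) \<Longrightarrow> S = UNIV"
    and v: "\<And>x. 0 < v x" "v summable_on UNIV" "ip v v = 1" "B v = (\<lambda>x. K * v x)"
  shows "(\<lambda>n. (B ^^ n) (\<lambda>_. 1) x / K ^ n) \<longlonglongrightarrow> v x * infsum v UNIV"
proof -
  let ?\<delta> = "indicator {x} :: 'a \<Rightarrow> real"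
  define q where "q n y = (B ^^ n) ?\<delta> y / K ^ n" for n y
  note \<delta> = indicator_ell2[of x]
  have v_ell2: "v \<in> ell2" using summable_imp_ell2[OF v(2)] v(1) by (simp add: less_imp_le)
  have v_le: "\<bar>v y\<bar> \<le> infsum v UNIV" for y
    using summable_bounded[OF v(2), of y] v(1) by (simp add: less_imp_le)
  have Bnv: "(B ^^ n) v = (\<lambda>y. K ^ n * v y)" for n
    by (induction n) (simp_all add: hop_cmult v(4) mult.assoc mult.left_commute[of _ K])
  have q_nonneg: "0 \<le> q n y" for n y
    unfolding q_def by (intro divide_nonneg_nonneg Bn_nonneg) (use K_pos in auto)
  have q_le: "q n y \<le> 1 / v x * v y" for n y
  proof -
    have "(B ^^ n) ?\<delta> y \<le> (B ^^ n) (\<lambda>y. 1 / v x * v y) y"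
      by (rule Bn_mono) (use v(1) in \<open>auto simp: indicator_def field_simps less_imp_le less_imp_neq[symmetric]\<close>)
    also have "\<dots> = K ^ n * (1 / v x * v y)" unfolding hop_pow_cmult by (simp add: Bnv)
    finally show ?thesis using K_pos by (simp add: q_def field_simps)
  qed
  have q_ell2: "q n \<in> ell2" for n
    using ell2_cmult[OF Bn_ell2[OF \<delta>], of "1 / K ^ n" n] by (simp add: q_def[abs_def])
  have inner: "ip ((B ^^ m) ?\<delta>) ((B ^^ n) ?\<delta>) = (B ^^ (m + n)) ?\<delta> x" for m n
    using Bn_symmetric[OF \<delta> Bn_ell2[OF \<delta>], of m n] by (simp add: ip_indicator funpow_add)
  have inner_q: "ip (q m) (q n) = q (m + n) x" for m n
  proof -
    have "q m = (\<lambda>y. 1 / K ^ m * (B ^^ m) ?\<delta> y)" for m by (simp add: q_def[abs_def])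
    then show ?thesis by (simp only: ip_cmult_left ip_cmult_right inner) (simp add: q_def power_add)
  qed
  have q_step: "B (q n) = (\<lambda>y. K * q (Suc n) y)" for n
  proof -
    have "B (\<lambda>y. 1 / K ^ n * (B ^^ n) ?\<delta> y) = (\<lambda>y. 1 / K ^ n * B ((B ^^ n) ?\<delta>) y)" by (rule hop_cmult)
    then show ?thesis using K_pos by (simp add: q_def[abs_def] fun_eq_iff)
  qed
  \<comment> \<open>\<open>T \<le> 1\<close> on \<open>q\<^sub>j\<close> gives the even steps, and \<open>T\<^sup>2 \<le> T\<close> the odd ones\<close>
  have q_dec: "q (Suc n) x \<le> q n x" for n
  proof (cases "even n")
    case True
    then obtain j where n: "n = j + j" by (metis evenE mult_2)
    have "K * q (j + Suc j) x = ip (q j) (B (q j))"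
      by (simp only: q_step ip_cmult_right inner_q)
    also have "\<dots> \<le> K * ip (q j) (q j)" by (rule rayleigh_le[OF q_ell2])
    finally show ?thesis using K_pos by (simp add: inner_q n)
  next
    case False
    then obtain j where n: "n = j + Suc j" by (metis oddE mult_2 add_Suc_right Suc_eq_plus1)
    have "ip (B (q j)) (B (q j)) \<le> K * ip (q j) (B (q j))" by (rule B_norm_bound[OF q_ell2])
    then have "K * (K * q (Suc j + Suc j) x) \<le> K * (K * q (j + Suc j) x)"
      by (simp only: q_step ip_cmult_right ip_cmult_left inner_q)
    then show ?thesis using K_pos by (simp add: n)
  qed
  have "decseq (\<lambda>n. q n x)" using q_dec by (simp add: decseq_Suc_iff)
  then obtain L where L: "(\<lambda>n. q n x) \<longlonglongrightarrow> L"
    by (rule decseq_convergent[where B = 0]) (use q_nonneg in blast)+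
  have "\<exists>g. (\<lambda>n. q n y) \<longlonglongrightarrow> g" for y
  proof -
    have sq: "(q m y - q n y)\<^sup>2 \<le> q (m + m) x + q (n + n) x - 2 * q (m + n) x" for m n
    proof -
      have "(q m y - q n y)\<^sup>2 \<le> ip (\<lambda>y. q m y - q n y) (\<lambda>y. q m y - q n y)"
        by (rule square_le_ip[where f = "\<lambda>y. q m y - q n y"]) (intro ell2_diff q_ell2)
      also have "\<dots> = q (m + m) x + q (n + n) x - 2 * q (m + n) x"
        by (simp add: ip_diff_left ip_diff_right q_ell2 ell2_diff inner_q add.commute)
      finally show ?thesis .
    qed
    have "Cauchy (\<lambda>n. q n y)"
    proof (rule metric_CauchyI)
      fix \<epsilon> :: real assume "0 < \<epsilon>"
      then have "0 < \<epsilon>\<^sup>2 / 4" by simp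
      then obtain N where N: "\<And>n. n \<ge> N \<Longrightarrow> \<bar>q n x - L\<bar> < \<epsilon>\<^sup>2 / 4"
        using L unfolding LIMSEQ_iff by (metis real_norm_def)
      show "\<exists>M. \<forall>m\<ge>M. \<forall>n\<ge>M. dist (q m y) (q n y) < \<epsilon>"
      proof (intro exI[of _ N] allI impI)
        fix m n assume mn: "m \<ge> N" "n \<ge> N"
        have "\<bar>q (m + m) x - L\<bar> < \<epsilon>\<^sup>2 / 4" "\<bar>q (n + n) x - L\<bar> < \<epsilon>\<^sup>2 / 4"
            "\<bar>q (m + n) x - L\<bar> < \<epsilon>\<^sup>2 / 4"
          by (rule N, use mn in linarith)+
        with sq[of m n] have "(q m y - q n y)\<^sup>2 < \<epsilon>\<^sup>2"
          unfolding abs_diff_less_iff by linarith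
        then show "dist (q m y) (q n y) < \<epsilon>"
          using \<open>0 < \<epsilon>\<close> power2_less_imp_less[of "\<bar>q m y - q n y\<bar>" \<epsilon>] by (simp add: dist_real_def)
      qed
    qed
    then show ?thesis by (simp add: Cauchy_convergent_iff convergent_def)
  qed
  then obtain g where g: "\<And>y. (\<lambda>n. q n y) \<longlonglongrightarrow> g y" by metis
  have g_bound: "0 \<le> g y" "g y \<le> 1 / v x * v y" for y
    using LIMSEQ_le_const[OF g] LIMSEQ_le_const2[OF g] q_nonneg q_le by blast+
  have g_ell2: "g \<in> ell2"
    by (rule ell2_dominated[OF v_ell2, of _ "1 / v x"])
       (use g_bound v(1) in \<open>simp add: less_imp_le\<close>)
  have Bg: "B g = (\<lambda>y. K * g y)"
  proof
    fix y
    have "(\<lambda>n. B (q n) y) \<longlonglongrightarrow> B g y" unfolding hop_def by (intro tendsto_intros g)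
    moreover have "(\<lambda>n. K * q (Suc n) y) \<longlonglongrightarrow> K * g y"
      by (intro tendsto_intros LIMSEQ_Suc g)
    ultimately show "B g y = K * g y" unfolding q_step using LIMSEQ_unique by blast
  qed
  \<comment> \<open>with this factor \<open>g - c v\<close> vanishes at \<open>x\<close>, hence everywhere\<close>
  define c where "c = g x / v x"
  have g_eq: "g y = c * v y" for y
  proof -
    have "(\<lambda>y. g y - c * v y) y = 0"
    proof (rule ground_state_simple[OF connected v(1) v_ell2 v(4), where x\<^sub>0 = x])
      show "(\<lambda>y. g y - c * v y) \<in> ell2" by (intro ell2_diff ell2_cmult g_ell2 v_ell2)
      show "B (\<lambda>y. g y - c * v y) = (\<lambda>y. K * (g y - c * v y))"
        by (simp add: hop_linear Bg v(4) algebra_simps)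
      show "g x - c * v x = 0" using v(1)[of x] by (simp add: c_def)
    qed
    then show ?thesis by simp
  qed
  have v_q: "ip v (q n) = v x" for n
  proof -
    have "q n = (\<lambda>y. 1 / K ^ n * (B ^^ n) ?\<delta> y)" by (simp add: q_def[abs_def])
    then have "ip v (q n) = 1 / K ^ n * ip ((B ^^ n) v) ?\<delta>"
      by (simp only: ip_cmult_right Bn_symmetric[OF v_ell2 \<delta>])
    also have "\<dots> = v x" using K_pos by (simp add: ip_commute[of _ ?\<delta>] ip_indicator Bnv)
    finally show ?thesis .
  qed
  have "(\<lambda>n. ip v (q n)) \<longlonglongrightarrow> ip v g"
    unfolding ip_def
  proof (rule infsum_dominated_convergence)
    show "(\<lambda>n. v y * q n y) \<longlonglongrightarrow> v y * g y" for y by (intro tendsto_intros g)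
    show "\<bar>v y * q n y\<bar> \<le> 1 / v x * (v y * v y)" for n y
      using mult_left_mono[OF q_le[of n y], of "v y"] v(1)[of y] q_nonneg[of n y]
      by (simp add: abs_mult less_imp_le)
    show "(\<lambda>y. 1 / v x * (v y * v y)) summable_on UNIV"
      by (intro summable_on_cmult_right ell2_mult_summable v_ell2)
  qed
  then have "ip v g = v x" unfolding v_q using LIMSEQ_const_iff by metis
  moreover have "ip v g = c"
  proof -
    have "g = (\<lambda>y. c * v y)" using g_eq by auto
    then show ?thesis by (simp only: ip_cmult_right v(3))
  qed
  ultimately have c: "c = v x" by simp
  have "(\<lambda>n. infsum (q n) UNIV) \<longlonglongrightarrow> infsum g UNIV"
  proof (rule infsum_dominated_convergence[OF g])
    show "\<bar>q n y\<bar> \<le> 1 / v x * v y" for n y using q_le[of n y] q_nonneg[of n y] by simp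
    show "(\<lambda>y. 1 / v x * v y) summable_on UNIV" by (rule summable_on_cmult_right[OF v(2)])
  qed
  moreover have "infsum (q n) UNIV = (B ^^ n) (\<lambda>_. 1) x / K ^ n" for n
  proof -
    have "?\<delta> summable_on UNIV"
      by (rule finite_nonzero_values_imp_summable_on) (auto simp: indicator_def)
    from Bn_symmetric_l1_bounded(2)[OF this, of "\<lambda>_. 1" 1 n]
    have "(B ^^ n) (\<lambda>_. 1) x = infsum ((B ^^ n) ?\<delta>) UNIV" by (simp add: ip_indicator) (simp add: ip_def)
    moreover have "q n = (\<lambda>y. 1 / K ^ n * (B ^^ n) ?\<delta> y)" by (simp add: q_def[abs_def])
    ultimately show ?thesis by (simp only: infsum_cmult_right') simp
  qed
  moreover have "infsum g UNIV = v x * infsum v UNIV"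
    unfolding g_eq c by (rule infsum_cmult_right')
  ultimately show ?thesis by simp
qed

text \<open>
  An Abelian theorem: the Poisson distribution of mean \<open>s\<close> puts vanishing mass on any
  fixed range \<open>{..<N}\<close> as \<open>s\<close> grows, and beyond \<open>N\<close> the sequence is close to its limit.
\<close>

lemma poisson_average:
  fixes u :: "nat \<Rightarrow> real"
  assumes u: "u \<longlonglongrightarrow> L"
  shows "((\<lambda>s. exp (- s) * (\<Sum>k. s ^ k / fact k * u k)) \<longlongrightarrow> L) at_top"
proof -
  have "Bseq (\<lambda>k. u k - L)"
    using tendsto_diff[OF u tendsto_const[of L]] by (intro convergent_imp_Bseq convergentI)
  then obtain M where M: "0 < M" "\<And>k. \<bar>u k - L\<bar> \<le> M" by (auto simp: Bseq_def)
  have exps: "(\<lambda>k. s ^ k / fact k) sums exp s" for s :: real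
    using exp_converges[of s] by (simp add: field_simps)
  have sm: "summable (\<lambda>k. s ^ k / fact k * w k)" if "0 \<le> s" "\<And>k. \<bar>w k\<bar> \<le> C" for s C :: real and w :: "nat \<Rightarrow> real"
  proof (rule summable_comparison_test'[of "\<lambda>k. s ^ k / fact k * C" 0])
    show "summable (\<lambda>k. s ^ k / fact k * C)" by (intro summable_mult2 sums_summable[OF exps])
    show "norm (s ^ k / fact k * w k) \<le> s ^ k / fact k * C" for k
      using that by (simp add: abs_mult mult_left_mono divide_right_mono)
  qed
  have diff: "exp (- s) * (\<Sum>k. s ^ k / fact k * u k) - L = exp (- s) * (\<Sum>k. s ^ k / fact k * (u k - L))"
    if "0 \<le> s" for s
  proof -
    have eq: "s ^ k / fact k * (u k - L) + s ^ k / fact k * L = s ^ k / fact k * u k" for k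
      by (simp only: distrib_left[symmetric]) simp
    have "(\<lambda>k. s ^ k / fact k * (u k - L) + s ^ k / fact k * L) sums
        ((\<Sum>k. s ^ k / fact k * (u k - L)) + exp s * L)"
      by (intro sums_add summable_sums sm[OF that, of _ M] M sums_mult2 exps)
    then have "(\<Sum>k. s ^ k / fact k * u k) = (\<Sum>k. s ^ k / fact k * (u k - L)) + exp s * L"
      unfolding eq by (simp only: sums_iff)
    then show ?thesis by (simp add: algebra_simps exp_minus_inverse mult.assoc[symmetric])
  qed
  have "((\<lambda>s. exp (- s) * (\<Sum>k. s ^ k / fact k * u k) - L) \<longlongrightarrow> 0) at_top"
  proof (rule tendstoI)
    fix \<epsilon> :: real assume "0 < \<epsilon>"
    then have "0 < \<epsilon> / 2" by simp
    then obtain N where N: "\<And>k. k \<ge> N \<Longrightarrow> \<bar>u k - L\<bar> < \<epsilon> / 2"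
      using u unfolding LIMSEQ_iff by (metis real_norm_def)
    have "((\<lambda>s. \<Sum>k<N. M / fact k * (s ^ k / exp s)) \<longlongrightarrow> (\<Sum>k<N. M / fact k * 0)) at_top"
      by (intro tendsto_intros tendsto_power_div_exp_0)
    then have "((\<lambda>s. \<Sum>k<N. M / fact k * (s ^ k / exp s)) \<longlongrightarrow> 0) at_top" by simp
    then have ev: "\<forall>\<^sub>F s in at_top. (\<Sum>k<N. M / fact k * (s ^ k / exp s)) < \<epsilon> / 2"
      using \<open>0 < \<epsilon> / 2\<close> by (rule order_tendstoD)
    show "\<forall>\<^sub>F s in at_top. dist (exp (- s) * (\<Sum>k. s ^ k / fact k * u k) - L) 0 < \<epsilon>"
      using ev eventually_ge_at_top[of 0]
    proof eventually_elim
      case (elim s)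
      let ?i = "\<lambda>k. if k < N then M else 0 :: real"
      have head: "(\<lambda>k. s ^ k / fact k * ?i k) sums (\<Sum>k<N. s ^ k / fact k * ?i k)"
        by (rule sums_finite) auto
      have "\<bar>\<Sum>k. s ^ k / fact k * (u k - L)\<bar> \<le> (\<Sum>k. s ^ k / fact k * (\<epsilon> / 2) + s ^ k / fact k * ?i k)"
      proof -
        have "norm (\<Sum>k. s ^ k / fact k * (u k - L)) \<le> (\<Sum>k. norm (s ^ k / fact k * (u k - L)))"
        proof (rule summable_norm)
          have "summable (\<lambda>k. s ^ k / fact k * \<bar>u k - L\<bar>)" by (rule sm[OF elim(2), of _ M]) (use M in auto)
          then show "summable (\<lambda>k. norm (s ^ k / fact k * (u k - L)))"
            using elim(2) by (simp add: abs_mult)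
        qed
        also have "\<dots> \<le> (\<Sum>k. s ^ k / fact k * (\<epsilon> / 2) + s ^ k / fact k * ?i k)"
        proof (rule suminf_le)
          show "norm (s ^ k / fact k * (u k - L)) \<le> s ^ k / fact k * (\<epsilon> / 2) + s ^ k / fact k * ?i k" for k
          proof -
            have "\<bar>u k - L\<bar> \<le> \<epsilon> / 2 + ?i k" using N[of k] M(2)[of k] \<open>0 < \<epsilon>\<close> by (cases "k < N") auto
            then have "s ^ k / fact k * \<bar>u k - L\<bar> \<le> s ^ k / fact k * (\<epsilon> / 2 + ?i k)"
              using elim(2) by (intro mult_left_mono) auto
            moreover have "norm (s ^ k / fact k * (u k - L)) = s ^ k / fact k * \<bar>u k - L\<bar>"
              using elim(2) by (simp add: abs_mult)
            ultimately show ?thesis by (simp only: distrib_left)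
          qed
          have "summable (\<lambda>k. s ^ k / fact k * \<bar>u k - L\<bar>)" by (rule sm[OF elim(2), of _ M]) (use M in auto)
          then show "summable (\<lambda>k. norm (s ^ k / fact k * (u k - L)))"
            using elim(2) by (simp add: abs_mult)
          show "summable (\<lambda>k. s ^ k / fact k * (\<epsilon> / 2) + s ^ k / fact k * ?i k)"
            by (intro summable_add sums_summable[OF head] summable_mult2 sums_summable[OF exps])
        qed
        finally show ?thesis by simp
      qed
      also have "\<dots> = exp s * (\<epsilon> / 2) + (\<Sum>k<N. s ^ k / fact k * ?i k)"
        by (rule sums_unique[symmetric, OF sums_add[OF sums_mult2[OF exps[of s]] head]])
      finally have "exp (- s) * \<bar>\<Sum>k. s ^ k / fact k * (u k - L)\<bar>
          \<le> exp (- s) * (exp s * (\<epsilon> / 2) + (\<Sum>k<N. s ^ k / fact k * ?i k))"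
        by (rule mult_left_mono) simp
      also have "\<dots> = \<epsilon> / 2 + (\<Sum>k<N. M / fact k * (s ^ k / exp s))"
        by (simp add: algebra_simps sum_distrib_left exp_minus field_simps)
      also have "\<dots> < \<epsilon>" using elim by simp
      finally show ?case unfolding diff[OF elim(2)] by (simp add: dist_real_def abs_mult)
    qed
  qed
  then show ?thesis by (simp add: LIM_zero_iff)
qed

section \<open>Sampling the random walks on a grid\<close>

text \<open>
  On a countable type the points without mass form a null set, so every law is a probability
  mass function.
\<close>

lemma (in prob_space) Abs_pmf_distr:
  fixes Z :: "'a \<Rightarrow> 'c :: countable"
  assumes Z: "Z \<in> measurable M (count_space UNIV)"
  shows "measure_pmf (Abs_pmf (distr M (count_space UNIV) Z)) = distr M (count_space UNIV) Z"
proof (rule Abs_pmf_inverse)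
  let ?D = "distr M (count_space UNIV) Z"
  interpret D: prob_space ?D by (rule prob_space_distr[OF Z])
  have "(\<Union>x\<in>{x. measure ?D {x} = 0}. {x}) \<in> null_sets ?D"
    by (rule null_sets_UN') (auto simp: null_sets_def D.emeasure_eq_measure)
  then have "AE x in ?D. x \<notin> (\<Union>x\<in>{x. measure ?D {x} = 0}. {x})" by (rule AE_not_in)
  then have "AE x in ?D. measure ?D {x} \<noteq> 0" by simp
  then show "?D \<in> {M. prob_space M \<and> sets M = UNIV \<and> (AE x in M. measure M {x} \<noteq> 0)}"
    using D.prob_space_axioms by simp
qed

lemma pmf_replicate_pmf:
  "pmf (replicate_pmf n p) xs = (if length xs = n then \<Prod>j<n. pmf p (xs ! j) else 0)"
proof (induction n arbitrary: xs)
  case 0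
  then show ?case by (simp add: pmf_return)
next
  case (Suc n)
  have rep: "replicate_pmf (Suc n) p = map_pmf (\<lambda>(x, xs). x # xs) (pair_pmf p (replicate_pmf n p))"
    by (simp add: pair_pmf_def map_bind_pmf)
  show ?case
  proof (cases xs)
    case Nil
    have "[] \<notin> set_pmf (replicate_pmf (Suc n) p)" by (auto simp: set_replicate_pmf)
    then have "pmf (replicate_pmf (Suc n) p) [] = 0" by (rule pmf_eq_0_set_pmf[THEN iffD2])
    then show ?thesis using Nil by (simp del: replicate_pmf.simps)
  next
    case (Cons y ys)
    have inj: "inj (\<lambda>(x :: 'a, xs). x # xs)" by (auto simp: inj_on_def)
    have "pmf (replicate_pmf (Suc n) p) xs = pmf p y * pmf (replicate_pmf n p) ys"
      using pmf_map_inj'[OF inj, of "pair_pmf p (replicate_pmf n p)" "(y, ys)"]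
      by (simp only: rep Cons pmf_pair prod.case)
    then show ?thesis by (simp only: Suc.IH Cons) (simp add: prod.lessThan_Suc_shift del: prod.lessThan_Suc)
  qed
qed

text \<open>
  The law of a list over a countable type is determined by its atoms; the event that they
  describe is a product event.
\<close>

lemma (in prob_space)
  fixes \<xi> :: "nat \<Rightarrow> 'a \<Rightarrow> 'c :: countable"
  assumes meas: "\<And>j. \<xi> j \<in> measurable M (count_space UNIV)"
  shows measurable_list: "(\<lambda>\<omega>. map (\<lambda>j. \<xi> j \<omega>) [0..<n]) \<in> measurable M (count_space UNIV)"
    and list_law: "(\<And>a. prob {\<omega>\<in>space M. \<forall>j<n. \<xi> j \<omega> = a j} = (\<Prod>j<n. pmf \<mu> (a j))) \<Longrightarrow>
      distr M (count_space UNIV) (\<lambda>\<omega>. map (\<lambda>j. \<xi> j \<omega>) [0..<n]) = measure_pmf (replicate_pmf n \<mu>)"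
proof -
  let ?L = "\<lambda>\<omega>. map (\<lambda>j. \<xi> j \<omega>) [0..<n]"
  have vim: "?L -` {xs} \<inter> space M =
      (if length xs = n then {\<omega>\<in>space M. \<forall>j<n. \<xi> j \<omega> = xs ! j} else {})" for xs
  proof -
    have "?L \<omega> = xs \<longleftrightarrow> length xs = n \<and> (\<forall>j<n. \<xi> j \<omega> = xs ! j)" for \<omega>
      unfolding list_eq_iff_nth_eq by fastforce
    then show ?thesis by (simp add: vimage_def set_eq_iff conj_commute)
  qed
  have ms: "{\<omega>\<in>space M. \<forall>j<n. \<xi> j \<omega> = a j} \<in> sets M" for a
  proof -
    have "{\<omega>\<in>space M. \<xi> j \<omega> = a j} \<in> sets M" for j
    proof -
      have "{\<omega>\<in>space M. \<xi> j \<omega> = a j} = \<xi> j -` {a j} \<inter> space M" by auto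
      then show ?thesis using measurable_sets[OF meas, of "{a j}" j] by simp
    qed
    then show ?thesis by (intro sets.sets_Collect_countable_All sets.sets_Collect_imp) auto
  qed
  show L: "?L \<in> measurable M (count_space UNIV)"
    by (subst measurable_count_space_eq2_countable) (simp_all add: vim ms)
  assume joint: "\<And>a. prob {\<omega>\<in>space M. \<forall>j<n. \<xi> j \<omega> = a j} = (\<Prod>j<n. pmf \<mu> (a j))"
  show "distr M (count_space UNIV) ?L = measure_pmf (replicate_pmf n \<mu>)"
  proof (rule measure_eqI_countable[of _ UNIV])
    show "emeasure (distr M (count_space UNIV) ?L) {xs} = emeasure (measure_pmf (replicate_pmf n \<mu>)) {xs}" for xs
      using L by (simp add: emeasure_distr vim emeasure_eq_measure joint emeasure_pmf_single pmf_replicate_pmf)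
  qed auto
qed

definition step_law :: "'a measure \<Rightarrow> (real \<Rightarrow> 'a \<Rightarrow> int ^ 'd) \<Rightarrow> real \<Rightarrow> (int ^ 'd) pmf" where
  "step_law M X h = Abs_pmf (distr M (count_space UNIV) (X h))"

context random_walk
begin

lemma step_law: "0 \<le> h \<Longrightarrow> measure_pmf (step_law M X h) = distr M (count_space UNIV) (X h)"
  unfolding step_law_def by (intro Abs_pmf_distr random_variable)

definition incr :: "real \<Rightarrow> nat \<Rightarrow> 'a \<Rightarrow> int ^ 'd" where
  "incr h j \<omega> = X (real (Suc j) * h) \<omega> - X (real j * h) \<omega>"

lemma incr_measurable: "0 \<le> h \<Longrightarrow> incr h j \<in> measurable M (count_space UNIV)"
proof -
  assume h: "0 \<le> h"
  have "(\<lambda>\<omega>. (X (real (Suc j) * h) \<omega>, X (real j * h) \<omega>)) \<in> measurable M (count_space UNIV \<Otimes>\<^sub>M count_space UNIV)"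
    using h by (intro measurable_Pair random_variable) auto
  then have "(\<lambda>\<omega>. (X (real (Suc j) * h) \<omega>, X (real j * h) \<omega>)) \<in> measurable M (count_space UNIV)"
    by (simp add: pair_measure_countable)
  then have "(\<lambda>\<omega>. case (X (real (Suc j) * h) \<omega>, X (real j * h) \<omega>) of (x, y) \<Rightarrow> x - y) \<in> measurable M (count_space UNIV)"
    by (rule measurable_compose) simp
  then show ?thesis by (simp add: incr_def[abs_def])
qed

lemma incr_single:
  assumes h: "0 \<le> h"
  shows "prob (incr h j -` {a} \<inter> space M) = pmf (step_law M X h) a"
proof -
  have "incr h j = (\<lambda>\<omega>. X (real j * h + h) \<omega> - X (real j * h) \<omega>)"
    by (simp add: incr_def[abs_def] algebra_simps)
  then have "distr M (count_space UNIV) (incr h j) = measure_pmf (step_law M X h)"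
    using h stationary_increments[of "real j * h" h] by (simp add: step_law)
  then have "measure (distr M (count_space UNIV) (incr h j)) {a} = pmf (step_law M X h) a"
    by (simp add: measure_pmf_single)
  then show ?thesis using incr_measurable[OF h] by (simp add: measure_distr)
qed

lemma incr_joint:
  assumes h: "0 \<le> h"
  shows "prob {\<omega>\<in>space M. \<forall>j<n. incr h j \<omega> = a j} = (\<Prod>j<n. pmf (step_law M X h) (a j))"
proof (cases "n = 0")
  case True
  then show ?thesis by (simp add: prob_space)
next
  case False
  have "indep_vars (\<lambda>_. count_space UNIV) (\<lambda>j. incr h j) {..<n}"
    using independent_increments[of "\<lambda>j. real j * h" n] h
    by (simp add: incr_def[abs_def] mono_def mult_right_mono)
  from indep_varsD_finite[OF this, of "\<lambda>j. {a j}"] False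
  have "prob (\<Inter>j\<in>{..<n}. incr h j -` {a j} \<inter> space M) = (\<Prod>j<n. pmf (step_law M X h) (a j))"
    by (simp add: incr_single[OF h] lessThan_empty_iff)
  moreover have "(\<Inter>j\<in>{..<n}. incr h j -` {a j} \<inter> space M) = {\<omega>\<in>space M. \<forall>j<n. incr h j \<omega> = a j}"
    using False by auto
  ultimately show ?thesis by simp
qed

lemma sum_incr:
  assumes "\<omega> \<in> space M"
  shows "(\<Sum>j<k. incr h j \<omega>) = X (real k * h) \<omega>"
  unfolding incr_def using start[OF assms] by (subst sum_lessThan_telescope) simp

lemma integral_incr_list:
  fixes f :: "(int ^ 'd) list \<Rightarrow> real"
  assumes "0 \<le> h"
  shows "(\<integral>\<omega>. f (map (\<lambda>j. incr h j \<omega>) [0..<n]) \<partial>M) = measure_pmf.expectation (replicate_pmf n (step_law M X h)) f"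
proof -
  note m = incr_measurable[OF assms]
  show ?thesis
    by (subst list_law[of "incr h", OF m incr_joint[OF assms], symmetric],
        subst integral_distr[OF measurable_list[of "incr h", OF m]]) simp_all
qed

text \<open>
  In the Feynman--Kac formula the catalyst runs backwards from time \<open>t\<close>. Its increments in this
  order have the same joint law, because a product of point masses is invariant under reversal.
\<close>

lemma integral_incr_list_reversed:
  fixes f :: "(int ^ 'd) list \<Rightarrow> real"
  assumes h: "0 \<le> h"
  shows "(\<integral>\<omega>. f (map (\<lambda>j. incr h (n - Suc j) \<omega>) [0..<n]) \<partial>M) = measure_pmf.expectation (replicate_pmf n (step_law M X h)) f"
proof -
  have "prob {\<omega>\<in>space M. \<forall>j<n. incr h (n - Suc j) \<omega> = a j} = (\<Prod>j<n. pmf (step_law M X h) (a j))" for a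
  proof -
    have "(\<forall>j<n. incr h (n - Suc j) \<omega> = a j) \<longleftrightarrow> (\<forall>j<n. incr h j \<omega> = a (n - Suc j))" for \<omega>
    proof (intro iffI allI impI)
      fix j assume "\<forall>j<n. incr h (n - Suc j) \<omega> = a j" "j < n"
      then show "incr h j \<omega> = a (n - Suc j)" by (drule_tac x = "n - Suc j" in spec) simp
    next
      fix j assume "\<forall>j<n. incr h j \<omega> = a (n - Suc j)" "j < n"
      then show "incr h (n - Suc j) \<omega> = a j" by (drule_tac x = "n - Suc j" in spec) simp
    qed
    then have "prob {\<omega>\<in>space M. \<forall>j<n. incr h (n - Suc j) \<omega> = a j} = (\<Prod>j<n. pmf (step_law M X h) (a (n - Suc j)))"
      using incr_joint[OF h, of n "\<lambda>j. a (n - Suc j)"] by simp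
    also have "\<dots> = (\<Prod>j<n. pmf (step_law M X h) (a j))"
      by (rule prod.nat_diff_reindex[of "\<lambda>j. pmf (step_law M X h) (a j)"])
    finally show ?thesis .
  qed
  note law = list_law[of "\<lambda>j. incr h (n - Suc j)", OF incr_measurable[OF h] this]
    and meas = measurable_list[of "\<lambda>j. incr h (n - Suc j)", OF incr_measurable[OF h]]
  show ?thesis by (subst law[symmetric], subst integral_distr[OF meas]) simp_all
qed

end

section \<open>Riemann sums along step paths\<close>

text \<open>
  Near any point of \<open>[0, t]\<close> the path is constant on either side, so jumps cannot accumulate there;
  a set without accumulation points in a compact interval is finite.
\<close>

lemma finite_jumps:
  fixes g :: "real \<Rightarrow> 'c"
  assumes right: "\<And>s. 0 \<le> s \<Longrightarrow> s < t \<Longrightarrow> \<exists>r. eventually (\<lambda>u. g u = r) (at_right s)"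
    and left: "\<And>s. 0 < s \<Longrightarrow> s \<le> t \<Longrightarrow> \<exists>r. eventually (\<lambda>u. g u = r) (at_left s)"
  shows "finite {s \<in> {0<..<t}. \<not> eventually (\<lambda>u. g u = g s) (at s)}" (is "finite ?D")
proof -
  have in_const: "u \<notin> ?D" if "\<And>w. a < w \<Longrightarrow> w < b \<Longrightarrow> g w = r" "a < u" "u < b" for a b u r
  proof -
    have "eventually (\<lambda>w. w \<in> {a<..<b}) (at u)"
      using that by (intro eventually_at_in_open') auto
    then have "eventually (\<lambda>w. g w = g u) (at u)"
      by eventually_elim (use that in auto)
    then show ?thesis by simp
  qed
  have "\<not> s islimpt ?D" if s: "s \<in> {0..t}" for s
  proof -
    have "eventually (\<lambda>u. u \<notin> ?D) (at_right s)"
    proof (cases "s < t")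
      case True
      then obtain r where "eventually (\<lambda>u. g u = r) (at_right s)" using right[of s] s by auto
      then obtain b where b: "b > s" "\<And>w. s < w \<Longrightarrow> w < b \<Longrightarrow> g w = r"
        unfolding eventually_at_right_field by blast
      show ?thesis unfolding eventually_at_right_field
        using in_const[of s b r] b by blast
    next
      case False
      then have "eventually (\<lambda>u. u > t) (at_right s)"
        using s by (auto simp: eventually_at_right_field intro!: exI[of _ "s + 1"])
      then show ?thesis by eventually_elim auto
    qed
    moreover have "eventually (\<lambda>u. u \<notin> ?D) (at_left s)"
    proof (cases "0 < s")
      case True
      then obtain r where "eventually (\<lambda>u. g u = r) (at_left s)" using left[of s] s by auto
      then obtain b where b: "b < s" "\<And>w. b < w \<Longrightarrow> w < s \<Longrightarrow> g w = r"
        unfolding eventually_at_left_field by blast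
      show ?thesis unfolding eventually_at_left_field
        using in_const[of b s r] b by blast
    next
      case False
      then have "eventually (\<lambda>u. u < 0) (at_left s)"
        using s by (auto simp: eventually_at_left_field intro!: exI[of _ "s - 1"])
      then show ?thesis by eventually_elim auto
    qed
    ultimately show ?thesis
      unfolding islimpt_iff_eventually by (simp add: eventually_at_split)
  qed
  then have "finite ({0..t} \<inter> ?D)"
    by (intro finite_not_islimpt_in_compact compact_Icc) auto
  moreover have "{0..t} \<inter> ?D = ?D" by auto
  ultimately show ?thesis by simp
qed

text \<open>
  Let \<open>G n\<close> be the step function that takes on each cell of the grid the value of \<open>g\<close> at its right end
  point. Away from the finitely many jumps of \<open>g\<close>, it equals \<open>g\<close> as soon as the cells are short
  enough, so dominated convergence applies. The same limit shows that \<open>g\<close> is measurable.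
\<close>

lemma riemann_sum_step_path:
  fixes g :: "real \<Rightarrow> real"
  assumes t: "0 < t" and bound: "\<And>s. \<bar>g s\<bar> \<le> C"
    and right: "\<And>s. 0 \<le> s \<Longrightarrow> s < t \<Longrightarrow> \<exists>r. eventually (\<lambda>u. g u = r) (at_right s)"
    and left: "\<And>s. 0 < s \<Longrightarrow> s \<le> t \<Longrightarrow> \<exists>r. eventually (\<lambda>u. g u = r) (at_left s)"
  shows "(\<lambda>n. t / real n * (\<Sum>k=1..n. g (real k * (t / real n)))) \<longlonglongrightarrow> (LINT s:{0..t}|lborel. g s)"
proof -
  define D where "D = insert 0 (insert t {s \<in> {0<..<t}. \<not> eventually (\<lambda>u. g u = g s) (at s)})"
  have D: "finite D" unfolding D_def using finite_jumps[OF right left] by simp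
  define I where "I n k = {real (k - 1) * (t / real n)<..real k * (t / real n)}" for n k
  define G where "G n s = (\<Sum>k=1..n. g (real k * (t / real n)) * indicator (I n k) s)" for n s
  let ?f = "\<lambda>s. indicator {0..t} s * g s"
  have G_meas: "G n \<in> borel_measurable lborel" for n
    unfolding G_def I_def by measurable
  have G_int: "integral\<^sup>L lborel (G n) = t / real n * (\<Sum>k=1..n. g (real k * (t / real n)))" for n
  proof -
    have m: "measure lborel (I n k) = t / real n" if "1 \<le> k" for k
    proof -
      have "real k * (t / real n) - real (k - 1) * (t / real n) = t / real n"
        using that by (simp only: left_diff_distrib[symmetric]) (simp add: of_nat_diff)
      moreover have "real (k - 1) * (t / real n) \<le> real k * (t / real n)"
        using t by (intro mult_right_mono) auto
      ultimately show ?thesis by (simp add: I_def)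
    qed
    have int: "integrable lborel (indicator (I n k) :: real \<Rightarrow> real)" for k
      unfolding I_def
      by (intro integrable_real_indicator emeasure_bounded_finite bounded_subset[OF bounded_closed_interval greaterThanAtMost_subseteq_atLeastAtMost_iff[THEN iffD2]]) auto
    have "integral\<^sup>L lborel (G n) = (\<Sum>k=1..n. integral\<^sup>L lborel (\<lambda>s. g (real k * (t / real n)) * indicator (I n k) s))"
      unfolding G_def by (intro Bochner_Integration.integral_sum integrable_mult_right int)
    also have "\<dots> = (\<Sum>k=1..n. g (real k * (t / real n)) * (t / real n))"
    proof (rule sum.cong[OF refl])
      fix k assume "k \<in> {1..n}"
      then have "measure lborel (I n k) = t / real n" by (intro m) simp
      moreover have "(\<integral>s. indicator (I n k) s \<partial>lborel) = measure lborel (I n k)" by simp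
      ultimately show "(\<integral>s. g (real k * (t / real n)) * indicator (I n k) s \<partial>lborel) = g (real k * (t / real n)) * (t / real n)"
        by (simp only: integral_mult_right_zero)
    qed
    also have "\<dots> = t / real n * (\<Sum>k=1..n. g (real k * (t / real n)))"
      by (simp only: sum_distrib_left mult.commute)
    finally show ?thesis .
  qed
  have cell: "\<exists>k\<in>{1..n}. s \<in> I n k \<and> G n s = g (real k * (t / real n))" if "0 < s" "s \<le> t" "0 < n" for s n
  proof -
    \<comment> \<open>the cells are closed on the right, so \<open>s\<close> lies in the one with this index\<close>
    define k where "k = nat \<lceil>s * real n / t\<rceil>"
    have pos: "0 < s * real n / t" using that t by simp
    then have "0 < \<lceil>s * real n / t\<rceil>" by simp
    then have k: "real k = of_int \<lceil>s * real n / t\<rceil>" "1 \<le> k" by (simp_all add: k_def Suc_leI)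
    have "s * real n / t \<le> real n" using that t by (simp add: field_simps)
    then have "\<lceil>s * real n / t\<rceil> \<le> int n" by (simp add: ceiling_le_iff)
    then have kn: "k \<le> n" by (simp only: k_def nat_le_iff)
    have ge: "s \<le> real k * (t / real n)"
      using le_of_int_ceiling[of "s * real n / t"] t that by (simp add: k(1)[symmetric] field_simps)
    have lt: "real (k - 1) * (t / real n) < s"
      using ceiling_correct[of "s * real n / t"] t that k(2)
      by (simp add: k(1)[symmetric] of_nat_diff field_simps)
    have mem: "s \<in> I n k" using ge lt by (simp add: I_def)
    have other: "s \<notin> I n j" if "j \<in> {1..n}" "j \<noteq> k" for j
    proof
      assume "s \<in> I n j"
      then have j: "real (j - 1) * (t / real n) < s" "s \<le> real j * (t / real n)" by (auto simp: I_def)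
      have tn: "0 < t / real n" using t \<open>0 < n\<close> by simp
      have "real (j - 1) * (t / real n) < real k * (t / real n)" using j(1) ge by simp
      then have 1: "j - 1 < k" using tn mult_less_cancel_right_pos[OF tn] by simp
      have "real (k - 1) * (t / real n) < real j * (t / real n)" using j(2) lt by simp
      then have 2: "k - 1 < j" using tn mult_less_cancel_right_pos[OF tn] by simp
      show False using 1 2 that k(2) by auto
    qed
    have "G n s = (\<Sum>j\<in>{1..n}. if j = k then g (real k * (t / real n)) else 0)"
      unfolding G_def by (rule sum.cong) (use mem other in auto)
    also have "\<dots> = g (real k * (t / real n))" using k kn by simp
    finally show ?thesis using mem k kn by auto
  qed
  have outside: "G n s = 0" if out: "\<not> (0 < s \<and> s \<le> t \<and> 0 < n)" for n s
    unfolding G_def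
  proof (rule sum.neutral, rule ballI)
    fix k assume k: "k \<in> {1..n}"
    have "s \<notin> I n k"
    proof
      assume "s \<in> I n k"
      then have *: "real (k - 1) * (t / real n) < s" "s \<le> real k * (t / real n)" by (auto simp: I_def)
      have "0 \<le> real (k - 1) * (t / real n)" using t by simp
      moreover have "real k * (t / real n) \<le> real n * (t / real n)"
        using k t by (intro mult_right_mono) auto
      moreover have "real n * (t / real n) = t" using k by auto
      ultimately show False using * out k by auto
    qed
    then show "g (real k * (t / real n)) * indicator (I n k) s = 0" by simp
  qed
  have lim: "(\<lambda>n. G n s) \<longlonglongrightarrow> ?f s" if "s \<notin> D" for s
  proof (cases "s \<in> {0..t}")
    case False
    then have "G n s = 0" for n by (intro outside) auto
    then show ?thesis using False by simp
  next
    case True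
    with that have s: "0 < s" "s < t" and ev: "eventually (\<lambda>u. g u = g s) (at s)"
      by (auto simp: D_def)
    have "eventually (\<lambda>u. g u = g s) (nhds s)"
      using ev unfolding eventually_at_filter by (rule eventually_mono) auto
    then obtain e where e: "e > 0" "\<And>u. dist u s < e \<Longrightarrow> g u = g s"
      unfolding eventually_nhds_metric by blast
    have "eventually (\<lambda>n. t / real n < e) sequentially"
      using e(1) tendsto_divide_0[OF tendsto_const filterlim_real_sequentially[THEN filterlim_at_top_imp_at_infinity], of t]
      by (intro order_tendstoD) auto
    then have "eventually (\<lambda>n. G n s = g s) sequentially"
      using eventually_gt_at_top[of 0]
    proof eventually_elim
      case (elim n)
      obtain k where k: "k \<in> {1..n}" "s \<in> I n k" "G n s = g (real k * (t / real n))"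
        using cell[of s n] s elim by auto
      have "real k * (t / real n) - s < t / real n" "s \<le> real k * (t / real n)"
        using k(1,2) by (auto simp: I_def of_nat_diff algebra_simps diff_divide_distrib)
      then have "dist (real k * (t / real n)) s < e" using elim by (simp add: dist_real_def)
      then show ?case using e(2) k(3) by simp
    qed
    then show ?thesis using True by (simp add: tendsto_eventually)
  qed
  have f_meas: "?f \<in> borel_measurable lborel"
  proof -
    have "(\<lambda>s. ?f s * indicator (- D) s) \<in> borel_measurable lborel"
    proof (rule borel_measurable_LIMSEQ_real)
      show "(\<lambda>n. G n s * indicator (- D) s) \<longlonglongrightarrow> ?f s * indicator (- D) s" for s
        using lim[of s] by (cases "s \<in> D") auto
      show "(\<lambda>s. G n s * indicator (- D) s) \<in> borel_measurable lborel" for n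
        using G_meas[of n] borel_open[OF open_Compl[OF finite_imp_closed[OF D]]]
        by (intro borel_measurable_times borel_measurable_indicator) auto
    qed
    then show ?thesis
      by (rule measurable_discrete_difference[where X = D]) (use D in \<open>auto intro: countable_finite\<close>)
  qed
  have C: "0 \<le> C" using bound[of 0] by linarith
  have "(\<lambda>n. integral\<^sup>L lborel (G n)) \<longlonglongrightarrow> integral\<^sup>L lborel ?f"
  proof (rule integral_dominated_convergence[OF f_meas G_meas])
    show "integrable lborel (\<lambda>s. C * indicator {0..t} s)"
      by (intro integrable_mult_right integrable_real_indicator emeasure_bounded_finite) auto
    have "AE s in lborel. s \<notin> D"
      using D by (intro AE_not_in finite_imp_null_set_lborel)
    then show "AE s in lborel. (\<lambda>n. G n s) \<longlonglongrightarrow> ?f s" by eventually_elim (rule lim)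
    show "AE s in lborel. norm (G n s) \<le> C * indicator {0..t} s" for n
    proof (rule AE_I2)
      fix s
      show "norm (G n s) \<le> C * indicator {0..t} s"
      proof (cases "0 < s \<and> s \<le> t \<and> 0 < n")
        case True
        then obtain k where "G n s = g (real k * (t / real n))" using cell[of s n] by auto
        then show ?thesis using True bound by simp
      next
        case False
        then have "G n s = 0" by (rule outside)
        then show ?thesis using C by simp
      qed
    qed
  qed
  then show ?thesis by (simp add: G_int set_lebesgue_integral_def)
qed

section \<open>The discretised Feynman--Kac formula\<close>

text \<open>
  The number of grid times at which a particle, in coordinates relative to the catalyst, is at the
  origin, with \<open>\<xi>s\<close> the increments of the particle and \<open>\<eta>s\<close> those of the reversed catalyst.
  Counting begins after the first step, in accordance with Riemann sums over right end points.
\<close>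

fun visits :: "int ^ 'd \<Rightarrow> (int ^ 'd) list \<Rightarrow> (int ^ 'd) list \<Rightarrow> nat" where
  "visits z (\<xi> # \<xi>s) (\<eta> # \<eta>s) = of_bool (z + \<xi> + \<eta> = 0) + visits (z + \<xi> + \<eta>) \<xi>s \<eta>s"
| "visits z _ _ = 0"

lemma visits_le: "visits z \<xi>s \<eta>s \<le> length \<eta>s"
  by (induction z \<xi>s \<eta>s rule: visits.induct) auto

lemma visits_map:
  "visits z (map \<xi> [0..<n]) (map \<eta> [0..<n]) = (\<Sum>k=1..n. of_bool (z + (\<Sum>j<k. \<xi> j + \<eta> j) = 0))"
proof (induction n arbitrary: z \<xi> \<eta>)
  case (Suc n)
  have upt: "map f [0..<Suc n] = f 0 # map (\<lambda>j. f (Suc j)) [0..<n]" for f :: "nat \<Rightarrow> int ^ 'a"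
    by (simp only: map_upt_Suc)
  have "visits z (map \<xi> [0..<Suc n]) (map \<eta> [0..<Suc n]) = of_bool (z + \<xi> 0 + \<eta> 0 = 0)
      + (\<Sum>k=1..n. of_bool (z + \<xi> 0 + \<eta> 0 + (\<Sum>j<k. \<xi> (Suc j) + \<eta> (Suc j)) = 0))"
    unfolding upt visits.simps Suc.IH ..
  also have "\<dots> = of_bool (z + (\<Sum>j<1. \<xi> j + \<eta> j) = 0)
      + (\<Sum>k=1..n. of_bool (z + (\<Sum>j<Suc k. \<xi> j + \<eta> j) = 0))"
    by (simp add: sum.lessThan_Suc_shift add.assoc del: sum.lessThan_Suc)
  also have "\<dots> = (\<Sum>k=1..Suc n. of_bool (z + (\<Sum>j<k. \<xi> j + \<eta> j) = 0))"
    by (subst (2) sum.atLeast_Suc_atMost) (simp_all only: sum.shift_bounds_cl_Suc_ivl One_nat_def Suc_le_mono le0)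
  finally show ?case .
qed simp

text \<open>
  The mixed moment with \<open>n\<close> grid times in place of the time integral. The particles are
  independent only given the catalyst, hence the product inside the outer expectation.
\<close>

definition moment_step :: "(int ^ 'd) pmf \<Rightarrow> (int ^ 'd) pmf \<Rightarrow> real \<Rightarrow> nat \<Rightarrow> int ^ 'd ^ 'p \<Rightarrow> real" where
  "moment_step \<mu> \<nu> c n x = measure_pmf.expectation (replicate_pmf n \<nu>) (\<lambda>\<eta>s.
     \<Prod>i\<in>UNIV. measure_pmf.expectation (replicate_pmf n \<mu>) (\<lambda>\<xi>s. exp (c * real (visits (x $ i) \<xi>s \<eta>s))))"

text \<open>
  The first \<open>k\<close> increments of the reversed catalyst add up to \<open>Y\<^sub>t - Y\<close> at time \<open>t - k t / n\<close>, so that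
  visits occur at the grid times \<open>s\<close> with \<open>Y\<^sub>t + x\<^sub>i + X\<^sub>s = Y\<close> at time \<open>t - s\<close>, and the exponents are
  Riemann sums of the exponents in the Feynman--Kac formula. They lie between 0 and \<open>\<gamma> t\<close>, so
  dominated convergence applies, first to the particles and then to the catalyst.
\<close>

lemma mixed_moment_limit:
  fixes X :: "real \<Rightarrow> 'a \<Rightarrow> int ^ 'd" and Y :: "real \<Rightarrow> 'b \<Rightarrow> int ^ 'd" and x :: "int ^ 'd ^ 'p"
  assumes X: "random_walk N \<kappa> X" and Y: "random_walk M \<rho> Y" and t: "0 < t" and \<gamma>: "0 \<le> \<gamma>"
  shows "(\<lambda>n. moment_step (step_law N X (t / real n)) (step_law M Y (t / real n)) (\<gamma> * (t / real n)) n x)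
    \<longlonglongrightarrow> mixed_moment N X M Y \<gamma> x t"
proof -
  interpret X: random_walk N \<kappa> X by (rule X)
  interpret Y: random_walk M \<rho> Y by (rule Y)
  define h where "h n = t / real n" for n
  have h: "0 \<le> h n" for n using t by (simp add: h_def)
  define \<xi>s where "\<xi>s n \<omega> = map (\<lambda>j. X.incr (h n) j \<omega>) [0..<n]" for n \<omega>
  define \<eta>s where "\<eta>s n \<omega> = map (\<lambda>j. Y.incr (h n) (n - Suc j) \<omega>) [0..<n]" for n \<omega>
  define R where "R i n \<omega>' \<omega> = \<gamma> * h n * real (visits (x $ i) (\<xi>s n \<omega>) (\<eta>s n \<omega>'))" for i n \<omega>' \<omega>
  define J where "J i \<omega>' \<omega> = \<gamma> * (LINT s:{0..t}|lborel. of_bool (Y t \<omega>' + x $ i + X s \<omega> = Y (t - s) \<omega>'))" for i \<omega>' \<omega>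
  have R_le: "0 \<le> R i n \<omega>' \<omega>" "R i n \<omega>' \<omega> \<le> \<gamma> * t" for i n \<omega>' \<omega>
  proof -
    have "h n * real (visits (x $ i) (\<xi>s n \<omega>) (\<eta>s n \<omega>')) \<le> h n * real n"
      using visits_le[of "x $ i" "\<xi>s n \<omega>" "\<eta>s n \<omega>'"] h by (intro mult_left_mono) (auto simp: \<eta>s_def)
    also have "\<dots> \<le> t" using t by (simp add: h_def)
    finally show "R i n \<omega>' \<omega> \<le> \<gamma> * t" unfolding R_def mult.assoc by (rule mult_left_mono) (rule \<gamma>)
    show "0 \<le> R i n \<omega>' \<omega>" using h \<gamma> by (simp add: R_def)
  qed
  \<comment> \<open>time reversal turns left limits of \<open>Y\<close> into right limits of the integrand, and conversely\<close>
  have R_J: "(\<lambda>n. R i n \<omega>' \<omega>) \<longlonglongrightarrow> J i \<omega>' \<omega>" if \<omega>: "\<omega> \<in> space N" "\<omega>' \<in> space M" for i \<omega> \<omega>'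
  proof -
    let ?g = "\<lambda>s. of_bool (Y t \<omega>' + x $ i + X s \<omega> = Y (t - s) \<omega>') :: real"
    have "R i n \<omega>' \<omega> = \<gamma> * (t / real n * (\<Sum>k=1..n. ?g (real k * (t / real n))))" for n
    proof -
      have "of_bool (x $ i + (\<Sum>j<k. X.incr (h n) j \<omega> + Y.incr (h n) (n - Suc j) \<omega>') = 0) = ?g (real k * h n)"
        if k: "k \<in> {1..n}" for k
      proof -
        have "(\<Sum>j<k. Y.incr (h n) (n - Suc j) \<omega>') = (\<Sum>j<k. Y (real (n - j) * h n) \<omega>' - Y (real (n - Suc j) * h n) \<omega>')"
          unfolding Y.incr_def using k by (intro sum.cong) (auto simp: Suc_diff_Suc)
        also have "\<dots> = Y (real n * h n) \<omega>' - Y (real (n - k) * h n) \<omega>'"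
          by (subst sum_lessThan_telescope') simp
        also have "real n * h n = t" using k by (simp add: h_def)
        also have "real (n - k) * h n = t - real k * h n"
          using k by (simp add: of_nat_diff left_diff_distrib) (simp add: h_def)
        finally show ?thesis
          using X.sum_incr[OF \<omega>(1), where k = k and h = "h n"]
          by (simp only: sum.distrib) (simp add: algebra_simps eq_diff_eq)
      qed
      then have "(\<Sum>k=1..n. of_bool (x $ i + (\<Sum>j<k. X.incr (h n) j \<omega> + Y.incr (h n) (n - Suc j) \<omega>') = 0))
          = (\<Sum>k=1..n. ?g (real k * h n))"
        by (intro sum.cong refl)
      then show ?thesis unfolding R_def \<xi>s_def \<eta>s_def visits_map of_nat_sum of_nat_of_bool
        by (simp add: h_def[of n, symmetric])
    qed
    moreover have "(\<lambda>n. t / real n * (\<Sum>k=1..n. ?g (real k * (t / real n)))) \<longlonglongrightarrow> (LINT s:{0..t}|lborel. ?g s)"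
    proof (rule riemann_sum_step_path[OF t, of _ 1])
      fix s assume s: "0 \<le> s" "s < t"
      obtain l where l: "eventually (\<lambda>u. Y u \<omega>' = l) (at_left (t - s))"
        using Y.left_limits[OF \<omega>(2), of "t - s"] s by auto
      then obtain b where b: "b < t - s" "\<And>u. b < u \<Longrightarrow> u < t - s \<Longrightarrow> Y u \<omega>' = l"
        unfolding eventually_at_left_field by blast
      have "eventually (\<lambda>u. Y (t - u) \<omega>' = l) (at_right s)"
        unfolding eventually_at_right_field using b by (intro exI[of _ "t - b"]) auto
      with X.right_continuous[OF \<omega>(1) s(1)]
      have "eventually (\<lambda>u. ?g u = of_bool (Y t \<omega>' + x $ i + X s \<omega> = l)) (at_right s)"
        by eventually_elim simp
      then show "\<exists>r. eventually (\<lambda>u. ?g u = r) (at_right s)" by blast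
    next
      fix s assume s: "0 < s" "s \<le> t"
      obtain l where l: "eventually (\<lambda>u. X u \<omega> = l) (at_left s)"
        using X.left_limits[OF \<omega>(1) s(1)] by auto
      obtain b where b: "t - s < b" "\<And>u. t - s < u \<Longrightarrow> u < b \<Longrightarrow> Y u \<omega>' = Y (t - s) \<omega>'"
        using Y.right_continuous[OF \<omega>(2), of "t - s"] s unfolding eventually_at_right_field by auto
      have "eventually (\<lambda>u. Y (t - u) \<omega>' = Y (t - s) \<omega>') (at_left s)"
        unfolding eventually_at_left_field using b by (intro exI[of _ "t - b"]) auto
      with l have "eventually (\<lambda>u. ?g u = of_bool (Y t \<omega>' + x $ i + l = Y (t - s) \<omega>')) (at_left s)"
        by eventually_elim simp
      then show "\<exists>r. eventually (\<lambda>u. ?g u = r) (at_left s)" by blast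
    qed simp
    ultimately show ?thesis unfolding J_def by (simp only:) (intro tendsto_intros)
  qed
  have \<xi>s_meas: "\<xi>s n \<in> measurable N (count_space UNIV)" for n
    unfolding \<xi>s_def[abs_def] by (rule X.measurable_list) (rule X.incr_measurable[OF h])
  have \<eta>s_meas: "\<eta>s n \<in> measurable M (count_space UNIV)" for n
    unfolding \<eta>s_def[abs_def] by (rule Y.measurable_list) (rule Y.incr_measurable[OF h])
  have R_meas: "(\<lambda>\<omega>. exp (R i n \<omega>' \<omega>)) \<in> borel_measurable N" for i n \<omega>'
    unfolding R_def by (rule measurable_compose[OF \<xi>s_meas]) simp
  have inner_eq: "(\<integral>\<omega>. exp (R i n \<omega>' \<omega>) \<partial>N) = measure_pmf.expectation (replicate_pmf n (step_law N X (h n)))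
      (\<lambda>\<xi>s. exp (\<gamma> * h n * real (visits (x $ i) \<xi>s (\<eta>s n \<omega>'))))" for i n \<omega>'
    unfolding R_def \<xi>s_def by (rule X.integral_incr_list[OF h])
  have inner_lim: "(\<lambda>n. \<integral>\<omega>. exp (R i n \<omega>' \<omega>) \<partial>N) \<longlonglongrightarrow> (\<integral>\<omega>. exp (J i \<omega>' \<omega>) \<partial>N)" if \<omega>': "\<omega>' \<in> space M" for i \<omega>'
  proof (rule integral_dominated_convergence[where w = "\<lambda>_. exp (\<gamma> * t)"])
    show meas: "(\<lambda>\<omega>. exp (R i n \<omega>' \<omega>)) \<in> borel_measurable N" for n by (rule R_meas)
    have lim: "(\<lambda>n. exp (R i n \<omega>' \<omega>)) \<longlonglongrightarrow> exp (J i \<omega>' \<omega>)" if "\<omega> \<in> space N" for \<omega>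
      by (intro tendsto_exp R_J that \<omega>')
    show "(\<lambda>\<omega>. exp (J i \<omega>' \<omega>)) \<in> borel_measurable N"
      by (rule borel_measurable_LIMSEQ_real[OF lim meas])
    show "AE \<omega> in N. (\<lambda>n. exp (R i n \<omega>' \<omega>)) \<longlonglongrightarrow> exp (J i \<omega>' \<omega>)" by (rule AE_I2) (rule lim)
  qed (use R_le in auto)
  have "(\<lambda>n. \<integral>\<omega>'. (\<Prod>i\<in>UNIV. \<integral>\<omega>. exp (R i n \<omega>' \<omega>) \<partial>N) \<partial>M) \<longlonglongrightarrow> (\<integral>\<omega>'. (\<Prod>i\<in>UNIV. \<integral>\<omega>. exp (J i \<omega>' \<omega>) \<partial>N) \<partial>M)"
  proof (rule integral_dominated_convergence[where w = "\<lambda>_. \<Prod>i\<in>(UNIV :: 'p set). exp (\<gamma> * t)"])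
    show meas: "(\<lambda>\<omega>'. \<Prod>i\<in>UNIV. \<integral>\<omega>. exp (R i n \<omega>' \<omega>) \<partial>N) \<in> borel_measurable M" for n
      unfolding inner_eq by (rule measurable_compose[OF \<eta>s_meas]) simp
    have lim: "(\<lambda>n. \<Prod>i\<in>UNIV. \<integral>\<omega>. exp (R i n \<omega>' \<omega>) \<partial>N) \<longlonglongrightarrow> (\<Prod>i\<in>UNIV. \<integral>\<omega>. exp (J i \<omega>' \<omega>) \<partial>N)"
      if "\<omega>' \<in> space M" for \<omega>'
      by (intro tendsto_prod inner_lim that)
    show "(\<lambda>\<omega>'. \<Prod>i\<in>UNIV. \<integral>\<omega>. exp (J i \<omega>' \<omega>) \<partial>N) \<in> borel_measurable M"
      by (rule borel_measurable_LIMSEQ_real[OF lim meas])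
    show "AE \<omega>' in M. (\<lambda>n. \<Prod>i\<in>UNIV. \<integral>\<omega>. exp (R i n \<omega>' \<omega>) \<partial>N) \<longlonglongrightarrow> (\<Prod>i\<in>UNIV. \<integral>\<omega>. exp (J i \<omega>' \<omega>) \<partial>N)"
      by (rule AE_I2) (rule lim)
    show "AE \<omega>' in M. norm (\<Prod>i\<in>UNIV. \<integral>\<omega>. exp (R i n \<omega>' \<omega>) \<partial>N) \<le> (\<Prod>i\<in>(UNIV :: 'p set). exp (\<gamma> * t))" for n
    proof (rule AE_I2)
      fix \<omega>'
      have "0 \<le> (\<integral>\<omega>. exp (R i n \<omega>' \<omega>) \<partial>N)" "(\<integral>\<omega>. exp (R i n \<omega>' \<omega>) \<partial>N) \<le> exp (\<gamma> * t)" for i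
        by (auto intro!: X.integral_le_const Bochner_Integration.integral_nonneg
            X.integrable_const_bound[of _ "exp (\<gamma> * t)"] R_meas simp: R_le)
      then show "norm (\<Prod>i\<in>UNIV. \<integral>\<omega>. exp (R i n \<omega>' \<omega>) \<partial>N) \<le> (\<Prod>i\<in>(UNIV :: 'p set). exp (\<gamma> * t))"
        unfolding prod_norm[symmetric] by (intro prod_mono) auto
    qed
  qed simp
  moreover have "(\<integral>\<omega>'. (\<Prod>i\<in>UNIV. \<integral>\<omega>. exp (R i n \<omega>' \<omega>) \<partial>N) \<partial>M)
      = moment_step (step_law N X (h n)) (step_law M Y (h n)) (\<gamma> * h n) n x" for n
    unfolding inner_eq moment_step_def \<eta>s_def by (rule Y.integral_incr_list_reversed[OF h])
  ultimately show ?thesis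
    by (simp add: mixed_moment_def shifted_solution_def pam_solution_def J_def h_def)
qed

section \<open>One-step transition operators\<close>

lemma expectation_pair_pmf:
  fixes f :: "'a \<times> 'b \<Rightarrow> real"
  assumes nonneg: "\<And>z. 0 \<le> f z" and bound: "\<And>x y. x \<in> set_pmf p \<Longrightarrow> y \<in> set_pmf q \<Longrightarrow> f (x, y) \<le> C"
  shows "measure_pmf.expectation (pair_pmf p q) f
    = measure_pmf.expectation p (\<lambda>x. measure_pmf.expectation q (\<lambda>y. f (x, y)))"
proof -
  have int_q: "integrable q (\<lambda>y. f (x, y))" if "x \<in> set_pmf p" for x
    by (rule measure_pmf.integrable_const_bound[of _ C]) (use bound that nonneg in \<open>auto simp: AE_measure_pmf_iff\<close>)
  have le: "measure_pmf.expectation q (\<lambda>y. f (x, y)) \<le> C" if "x \<in> set_pmf p" for x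
    by (rule measure_pmf.integral_le_const[OF int_q[OF that]]) (use bound that in \<open>auto simp: AE_measure_pmf_iff\<close>)
  have ge: "0 \<le> measure_pmf.expectation q (\<lambda>y. f (x, y))" for x
    by (intro Bochner_Integration.integral_nonneg nonneg)
  have int_p: "integrable p (\<lambda>x. measure_pmf.expectation q (\<lambda>y. f (x, y)))"
    by (rule measure_pmf.integrable_const_bound[of _ C]) (use le ge in \<open>auto simp: AE_measure_pmf_iff\<close>)
  have int_pq: "integrable (pair_pmf p q) f"
    by (rule measure_pmf.integrable_const_bound[of _ C]) (use bound nonneg in \<open>auto simp: AE_measure_pmf_iff\<close>)
  have "ennreal (measure_pmf.expectation (pair_pmf p q) f) = (\<integral>\<^sup>+z. ennreal (f z) \<partial>pair_pmf p q)"
    by (rule nn_integral_eq_integral[symmetric, OF int_pq]) (simp add: nonneg)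
  also have "\<dots> = (\<integral>\<^sup>+x. \<integral>\<^sup>+y. ennreal (f (x, y)) \<partial>q \<partial>p)" by (rule nn_integral_pair_pmf')
  also have "\<dots> = (\<integral>\<^sup>+x. ennreal (measure_pmf.expectation q (\<lambda>y. f (x, y))) \<partial>p)"
    by (rule nn_integral_cong_AE) (auto simp: AE_measure_pmf_iff nonneg intro!: nn_integral_eq_integral int_q)
  also have "\<dots> = ennreal (measure_pmf.expectation p (\<lambda>x. measure_pmf.expectation q (\<lambda>y. f (x, y))))"
    by (rule nn_integral_eq_integral[OF int_p]) (simp add: ge)
  finally show ?thesis
    by (subst (asm) ennreal_inj) (auto intro!: Bochner_Integration.integral_nonneg nonneg)
qed

lemma expectation_swap_pmf:
  fixes f :: "'a \<Rightarrow> 'b \<Rightarrow> real"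
  assumes nonneg: "\<And>x y. 0 \<le> f x y" and bound: "\<And>x y. x \<in> set_pmf p \<Longrightarrow> y \<in> set_pmf q \<Longrightarrow> f x y \<le> C"
  shows "measure_pmf.expectation p (\<lambda>x. measure_pmf.expectation q (\<lambda>y. f x y))
    = measure_pmf.expectation q (\<lambda>y. measure_pmf.expectation p (\<lambda>x. f x y))"
proof -
  have "measure_pmf.expectation p (\<lambda>x. measure_pmf.expectation q (\<lambda>y. f x y))
      = measure_pmf.expectation (pair_pmf p q) (\<lambda>(x, y). f x y)"
    by (subst expectation_pair_pmf[where C = C]) (use assms in auto)
  also have "\<dots> = measure_pmf.expectation (pair_pmf q p) (\<lambda>(y, x). f x y)"
    by (subst pair_commute_pmf) (simp add: case_prod_unfold)
  also have "\<dots> = measure_pmf.expectation q (\<lambda>y. measure_pmf.expectation p (\<lambda>x. f x y))"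
    by (subst expectation_pair_pmf[where C = C]) (use assms in auto)
  finally show ?thesis .
qed

lemma expectation_replicate_pmf_Suc:
  fixes f :: "'a list \<Rightarrow> real"
  assumes "\<And>xs. 0 \<le> f xs" "\<And>xs. xs \<in> set_pmf (replicate_pmf (Suc n) p) \<Longrightarrow> f xs \<le> C"
  shows "measure_pmf.expectation (replicate_pmf (Suc n) p) f
    = measure_pmf.expectation p (\<lambda>x. measure_pmf.expectation (replicate_pmf n p) (\<lambda>xs. f (x # xs)))"
proof -
  have rep: "replicate_pmf (Suc n) p = map_pmf (\<lambda>(x, xs). x # xs) (pair_pmf p (replicate_pmf n p))"
    by (simp add: pair_pmf_def map_bind_pmf)
  show ?thesis
    unfolding rep integral_map_pmf
    by (subst expectation_pair_pmf[where C = C]) (use assms in \<open>auto simp: rep\<close>)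
qed

lemma expectation_bounds:
  fixes f :: "'a \<Rightarrow> real"
  assumes "\<And>x. 0 \<le> f x" "\<And>x. x \<in> set_pmf p \<Longrightarrow> f x \<le> C"
  shows "0 \<le> measure_pmf.expectation p f" "measure_pmf.expectation p f \<le> C" "integrable (measure_pmf p) f"
proof -
  show int: "integrable (measure_pmf p) f"
    by (rule measure_pmf.integrable_const_bound[of _ C]) (use assms in \<open>auto simp: AE_measure_pmf_iff\<close>)
  show "0 \<le> measure_pmf.expectation p f" by (intro Bochner_Integration.integral_nonneg assms)
  show "measure_pmf.expectation p f \<le> C"
    by (rule measure_pmf.integral_le_const[OF int]) (use assms in \<open>auto simp: AE_measure_pmf_iff\<close>)
qed

definition potential :: "int ^ 'd ^ 'p \<Rightarrow> real" where
  "potential x = (\<Sum>i\<in>UNIV. of_bool (x $ i = 0))"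

text \<open>
  The increments of the \<open>p\<close> particles and, as second component, that of the reversed catalyst.
\<close>

definition joint_law :: "(int ^ 'd) pmf \<Rightarrow> (int ^ 'd) pmf \<Rightarrow> (('p::finite \<Rightarrow> int ^ 'd) \<times> (int ^ 'd)) pmf" where
  "joint_law \<mu> \<nu> = pair_pmf (Pi_pmf UNIV 0 (\<lambda>_. \<mu>)) \<nu>"

definition displace :: "int ^ 'd ^ 'p \<Rightarrow> ('p \<Rightarrow> int ^ 'd) \<times> (int ^ 'd) \<Rightarrow> int ^ 'd ^ 'p" where
  "displace x = (\<lambda>(b, \<eta>). \<chi> i. x $ i + b i + \<eta>)"

text \<open>
  The weight is taken at the point reached by the step, in accordance with \<^const>\<open>visits\<close>.
\<close>

definition step_op :: "(int ^ 'd) pmf \<Rightarrow> (int ^ 'd) pmf \<Rightarrow> real \<Rightarrow> (int ^ 'd ^ 'p \<Rightarrow> real) \<Rightarrow> int ^ 'd ^ 'p \<Rightarrow> real" where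
  "step_op \<mu> \<nu> c f x = measure_pmf.expectation (joint_law \<mu> \<nu>)
     (\<lambda>w. exp (c * potential (displace x w)) * f (displace x w))"

lemma potential_bounds: "0 \<le> potential x" "potential (x :: int ^ 'd ^ 'p) \<le> real CARD('p)"
proof -
  show "0 \<le> potential x" unfolding potential_def by (intro sum_nonneg) auto
  have "potential x \<le> (\<Sum>i\<in>(UNIV :: 'p set). 1)" unfolding potential_def by (intro sum_mono) auto
  then show "potential x \<le> real CARD('p)" by simp
qed

lemma moment_step_0: "moment_step \<mu> \<nu> c 0 x = 1"
  by (simp add: moment_step_def)

text \<open>
  The Markov property: condition on the first increments. The product of the expectations over
  the particles becomes one expectation over independent copies, after which the later
  increments of the catalyst can be integrated first.
\<close>

lemma moment_step_Suc:
  assumes c: "0 \<le> c"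
  shows "moment_step \<mu> \<nu> c (Suc n) (x :: int ^ 'd ^ 'p) = step_op \<mu> \<nu> c (moment_step \<mu> \<nu> c n) x"
proof -
  define I where "I n \<eta>s z = measure_pmf.expectation (replicate_pmf n \<mu>) (\<lambda>\<xi>s. exp (c * real (visits z \<xi>s \<eta>s)))"
    for n \<eta>s and z :: "int ^ 'd"
  have visits_le': "visits z \<xi>s \<eta>s \<le> length \<xi>s" for z :: "int ^ 'd" and \<xi>s \<eta>s
    by (induction z \<xi>s \<eta>s rule: visits.induct) auto
  have exp_le: "exp (c * real (visits z \<xi>s \<eta>s)) \<le> exp (c * real n)" if "\<xi>s \<in> set_pmf (replicate_pmf n \<mu>)"
    for n z \<xi>s \<eta>s
    using visits_le'[of z \<xi>s \<eta>s] that c by (auto simp: set_replicate_pmf intro: mult_left_mono)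
  have I: "0 \<le> I n \<eta>s z" "I n \<eta>s z \<le> exp (c * real n)" for n \<eta>s z
  proof -
    show "0 \<le> I n \<eta>s z"
      unfolding I_def by (rule expectation_bounds(1)[where C = "exp (c * real n)"]) (simp_all only: exp_ge_zero exp_le)
    show "I n \<eta>s z \<le> exp (c * real n)"
      unfolding I_def by (rule expectation_bounds(2)) (simp_all only: exp_ge_zero exp_le)
  qed
  let ?e = "\<lambda>z :: int ^ 'd. exp (c * of_bool (z = 0))"
  have e: "0 \<le> ?e z" "?e z \<le> exp c" for z using c by auto
  have I_Suc: "I (Suc n) (\<eta> # \<eta>s) z = measure_pmf.expectation \<mu> (\<lambda>\<xi>. ?e (z + \<xi> + \<eta>) * I n \<eta>s (z + \<xi> + \<eta>))"
    for n \<eta> \<eta>s z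
  proof -
    have "I (Suc n) (\<eta> # \<eta>s) z = measure_pmf.expectation \<mu> (\<lambda>\<xi>. measure_pmf.expectation (replicate_pmf n \<mu>)
        (\<lambda>\<xi>s. exp (c * real (visits z (\<xi> # \<xi>s) (\<eta> # \<eta>s)))))"
      unfolding I_def
      by (rule expectation_replicate_pmf_Suc[where C = "exp (c * real (Suc n))"]) (simp_all only: exp_ge_zero exp_le)
    also have "\<dots> = measure_pmf.expectation \<mu> (\<lambda>\<xi>. ?e (z + \<xi> + \<eta>) * I n \<eta>s (z + \<xi> + \<eta>))"
      by (simp add: I_def exp_add distrib_left)
    finally show ?thesis .
  qed
  define G where "G b \<eta> \<eta>s = (\<Prod>i\<in>UNIV. ?e (x $ i + b i + \<eta>) * I n \<eta>s (x $ i + b i + \<eta>))"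
    for b :: "'p \<Rightarrow> int ^ 'd" and \<eta> \<eta>s
  define C where "C = (\<Prod>i\<in>(UNIV :: 'p set). exp c * exp (c * real n))"
  have G: "0 \<le> G b \<eta> \<eta>s" "G b \<eta> \<eta>s \<le> C" for b \<eta> \<eta>s
    unfolding G_def C_def by (intro prod_nonneg prod_mono conjI ballI mult_mono mult_nonneg_nonneg e I; simp)+
  let ?Pi = "Pi_pmf (UNIV :: 'p set) 0 (\<lambda>_. \<mu>)" and ?rep = "replicate_pmf n \<nu>"
  have prod_I: "0 \<le> (\<Prod>i\<in>UNIV. I (Suc n) \<eta>s (x $ i))" "(\<Prod>i\<in>UNIV. I (Suc n) \<eta>s (x $ i)) \<le> (\<Prod>i\<in>(UNIV :: 'p set). exp (c * real (Suc n)))" for \<eta>s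
    by (intro prod_nonneg prod_mono conjI ballI I)+
  have "moment_step \<mu> \<nu> c (Suc n) x = measure_pmf.expectation \<nu> (\<lambda>\<eta>. measure_pmf.expectation ?rep (\<lambda>\<eta>s.
      \<Prod>i\<in>UNIV. I (Suc n) (\<eta> # \<eta>s) (x $ i)))"
    unfolding moment_step_def I_def[symmetric]
    by (rule expectation_replicate_pmf_Suc) (rule prod_I)+
  also have "\<dots> = measure_pmf.expectation \<nu> (\<lambda>\<eta>. measure_pmf.expectation ?rep (\<lambda>\<eta>s. measure_pmf.expectation ?Pi (\<lambda>b. G b \<eta> \<eta>s)))"
  proof -
    have "(\<Prod>i\<in>UNIV. I (Suc n) (\<eta> # \<eta>s) (x $ i)) = measure_pmf.expectation ?Pi (\<lambda>b. G b \<eta> \<eta>s)" for \<eta> \<eta>s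
      unfolding G_def I_Suc
      by (rule expectation_prod_Pi_pmf[symmetric, where f = "\<lambda>i \<xi>. ?e (x $ i + \<xi> + \<eta>) * I n \<eta>s (x $ i + \<xi> + \<eta>)"])
         (auto intro!: expectation_bounds(3)[where C = "exp c * exp (c * real n)"] mult_mono e I mult_nonneg_nonneg)
    then show ?thesis by simp
  qed
  also have "\<dots> = measure_pmf.expectation \<nu> (\<lambda>\<eta>. measure_pmf.expectation ?Pi (\<lambda>b. measure_pmf.expectation ?rep (\<lambda>\<eta>s. G b \<eta> \<eta>s)))"
    by (subst expectation_swap_pmf[where p = ?rep and C = C]) (use G in auto)
  also have "\<dots> = measure_pmf.expectation ?Pi (\<lambda>b. measure_pmf.expectation \<nu> (\<lambda>\<eta>. measure_pmf.expectation ?rep (\<lambda>\<eta>s. G b \<eta> \<eta>s)))"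
    by (rule expectation_swap_pmf[where C = C]) (auto intro!: expectation_bounds G)
  also have "\<dots> = measure_pmf.expectation (joint_law \<mu> \<nu>) (\<lambda>w. measure_pmf.expectation ?rep (\<lambda>\<eta>s. G (fst w) (snd w) \<eta>s))"
    unfolding joint_law_def
    by (subst expectation_pair_pmf[where C = C]) (auto intro!: expectation_bounds G)
  also have "\<dots> = step_op \<mu> \<nu> c (moment_step \<mu> \<nu> c n) x"
  proof -
    have "measure_pmf.expectation ?rep (\<lambda>\<eta>s. G (fst w) (snd w) \<eta>s)
        = exp (c * potential (displace x w)) * moment_step \<mu> \<nu> c n (displace x w)" for w
      by (cases w)
         (simp add: G_def moment_step_def I_def[symmetric] displace_def potential_def prod.distrib
            exp_sum[symmetric] sum_distrib_left)
    then show ?thesis by (simp add: step_op_def)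
  qed
  finally show ?thesis .
qed

lemma moment_step_eq_funpow:
  assumes "0 \<le> c"
  shows "(moment_step \<mu> \<nu> c n :: int ^ 'd ^ 'p \<Rightarrow> real) = (step_op \<mu> \<nu> c ^^ n) (\<lambda>_. 1)"
proof (induction n)
  case 0
  show ?case by (auto simp: moment_step_0)
next
  case (Suc n)
  have "(moment_step \<mu> \<nu> c (Suc n) :: int ^ 'd ^ 'p \<Rightarrow> real) = step_op \<mu> \<nu> c (moment_step \<mu> \<nu> c n)"
    by (rule ext) (rule moment_step_Suc[OF assms])
  then show ?case by (simp add: Suc)
qed

lemma step_op_bounded:
  fixes f :: "int ^ 'd ^ 'p \<Rightarrow> real"
  assumes f: "\<And>y. \<bar>f y\<bar> \<le> C" and c: "0 \<le> c"
  shows "integrable (joint_law \<mu> \<nu>) (\<lambda>w. exp (c * potential (displace x w)) * f (displace x w))"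
    and "\<bar>step_op \<mu> \<nu> c f x\<bar> \<le> exp (c * real CARD('p)) * C"
proof -
  have le: "\<bar>exp (c * potential y) * f y\<bar> \<le> exp (c * real CARD('p)) * C" for y
    using potential_bounds(2)[of y] f[of y] c
    by (auto simp: abs_mult intro!: mult_mono mult_left_mono order.trans[OF abs_ge_zero f])
  show int: "integrable (joint_law \<mu> \<nu>) (\<lambda>w. exp (c * potential (displace x w)) * f (displace x w))"
    by (rule measure_pmf.integrable_const_bound[of _ "exp (c * real CARD('p)) * C"]) (use le in auto)
  have "\<bar>step_op \<mu> \<nu> c f x\<bar> \<le> measure_pmf.expectation (joint_law \<mu> \<nu>) (\<lambda>w. \<bar>exp (c * potential (displace x w)) * f (displace x w)\<bar>)"
    unfolding step_op_def by (rule integral_abs_bound)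
  also have "\<dots> \<le> exp (c * real CARD('p)) * C"
    by (rule measure_pmf.integral_le_const) (use le int in auto)
  finally show "\<bar>step_op \<mu> \<nu> c f x\<bar> \<le> exp (c * real CARD('p)) * C" .
qed

lemma step_op_diff:
  fixes f :: "int ^ 'd ^ 'p \<Rightarrow> real"
  assumes "\<And>y. \<bar>f y\<bar> \<le> C" "\<And>y. \<bar>g y\<bar> \<le> C'" "0 \<le> c"
  shows "step_op \<mu> \<nu> c (\<lambda>y. f y - g y) x = step_op \<mu> \<nu> c f x - step_op \<mu> \<nu> c g x"
  unfolding step_op_def right_diff_distrib
  by (rule Bochner_Integration.integral_diff) (use step_op_bounded assms in blast)+

section \<open>First-order expansion of one step\<close>

lemma lnorm_minus: "lnorm (- x) = lnorm x"
proof -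
  have "(\<chi> i. real_of_int ((- x) $ i)) = - (\<chi> i. real_of_int (x $ i))" by (simp add: vec_eq_iff)
  then show ?thesis by (simp only: lnorm_def norm_minus_cancel)
qed

lemma lnorm_0: "lnorm 0 = 0"
proof -
  have "(\<chi> i. real_of_int ((0 :: int ^ 'a) $ i)) = 0" by (simp add: vec_eq_iff)
  then show ?thesis by (simp only: lnorm_def norm_zero)
qed

definition units :: "(int ^ 'd) set" where "units = {e. lnorm e = 1}"

lemma finite_units: "finite units" by (simp add: units_def finite_lnorm_eq_1)

lemma zero_notin_units: "0 \<notin> units" by (simp add: units_def lnorm_0)

lemma neighbours_0: "{y. lnorm (0 - y) = 1} = units"
  by (simp add: units_def lnorm_minus)

context random_walk
begin

text \<open>
  The generator at the indicator of \<open>e\<close>, evaluated at the origin, is the jump rate to \<open>e\<close>, or minus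
  the rate of leaving the origin if \<open>e = 0\<close>.
\<close>

lemma step_law_rate:
  fixes e :: "int ^ 'd"
  shows "((\<lambda>h. (pmf (step_law M X h) e - indicator {e} 0) / h) \<longlongrightarrow> \<kappa> * laplacian (indicator {e}) 0) (at_right 0)"
proof -
  have "bounded (range (indicator {e} :: int ^ 'd \<Rightarrow> real))"
    by (rule boundedI[of _ 1]) (auto simp: indicator_def)
  from tendsto_uniform_limitI[OF generator[OF this], of 0]
  have "((\<lambda>h. (expectation (\<lambda>\<omega>. indicator {e} (0 + X h \<omega>)) - indicator {e} 0) / h) \<longlongrightarrow> \<kappa> * laplacian (indicator {e}) 0) (at_right 0)"
    by simp
  moreover have "eventually (\<lambda>h. (expectation (\<lambda>\<omega>. indicator {e} (0 + X h \<omega>)) - indicator {e} 0) / h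
      = (pmf (step_law M X h) e - indicator {e} 0) / h) (at_right 0)"
    using eventually_at_right_less[of "0 :: real"]
  proof eventually_elim
    case (elim h)
    then have h: "0 \<le> h" by simp
    have "expectation (\<lambda>\<omega>. indicator {e} (X h \<omega>)) = measure (distr M (count_space UNIV) (X h)) {e}"
      by (subst integral_distr[OF random_variable[OF h], symmetric]) simp_all
    also have "\<dots> = pmf (step_law M X h) e" by (simp add: step_law[OF h, symmetric] measure_pmf_single)
    finally show ?case by simp
  qed
  ultimately show ?thesis by (rule Lim_transform_eventually)
qed

lemma step_law_stay:
  "((\<lambda>h. (pmf (step_law M X h) 0 - 1) / h) \<longlongrightarrow> - \<kappa> * real (card (units :: (int ^ 'd) set))) (at_right 0)"
proof -
  have "laplacian (indicator {0}) (0 :: int ^ 'd) = (\<Sum>y\<in>(units :: (int ^ 'd) set). - 1)"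
    unfolding laplacian_def neighbours_0 using zero_notin_units
    by (intro sum.cong) (auto simp: indicator_def)
  then show ?thesis using step_law_rate[of 0] by simp
qed

lemma step_law_unit:
  fixes e :: "int ^ 'd"
  assumes e: "e \<in> units"
  shows "((\<lambda>h. pmf (step_law M X h) e / h) \<longlongrightarrow> \<kappa>) (at_right 0)"
proof -
  have e0: "e \<noteq> 0" using e zero_notin_units by auto
  have "laplacian (indicator {e}) (0 :: int ^ 'd) = (\<Sum>y\<in>units. if y = e then 1 else 0)"
    unfolding laplacian_def neighbours_0 using e0
    by (intro sum.cong) (auto simp: indicator_def)
  also have "\<dots> = 1" using e by (simp add: finite_units)
  finally show ?thesis using step_law_rate[of e] e0 by simp
qed

end

definition diag :: "int ^ 'd \<Rightarrow> int ^ 'd ^ 'p" where "diag e = (\<chi> i. e)"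

definition jump_gen :: "real \<Rightarrow> real \<Rightarrow> (int ^ 'd ^ 'p \<Rightarrow> real) \<Rightarrow> int ^ 'd ^ 'p \<Rightarrow> real" where
  "jump_gen \<kappa> \<rho> f x = \<kappa> * (\<Sum>i\<in>UNIV. \<Sum>e\<in>units. f (x + axis i e) - f x) + \<rho> * (\<Sum>e\<in>units. f (x + diag e) - f x)"

text \<open>
  The product rule for right derivatives at 0 of functions with limit 1 there. It turns the
  rates at which single walkers leave their sites into the rate at which any of them does.
\<close>

lemma rate_mult:
  fixes f g :: "real \<Rightarrow> real"
  assumes f: "((\<lambda>h. (f h - 1) / h) \<longlongrightarrow> a) (at_right 0)" and g: "((\<lambda>h. (g h - 1) / h) \<longlongrightarrow> b) (at_right 0)"
  shows "((\<lambda>h. (f h * g h - 1) / h) \<longlongrightarrow> a + b) (at_right 0)"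
proof -
  have "((\<lambda>h. (f h - 1) / h + (g h - 1) / h + h * ((f h - 1) / h * ((g h - 1) / h))) \<longlongrightarrow> a + b + 0 * (a * b)) (at_right 0)"
    by (intro tendsto_intros f g)
  moreover have "eventually (\<lambda>h. (f h - 1) / h + (g h - 1) / h + h * ((f h - 1) / h * ((g h - 1) / h))
      = (f h * g h - 1) / h) (at_right 0)"
    using eventually_at_right_less[of "0 :: real"] by eventually_elim (simp add: field_simps)
  ultimately show ?thesis by (simp add: Lim_transform_eventually)
qed

lemma rate_power:
  fixes f :: "real \<Rightarrow> real"
  assumes f: "((\<lambda>h. (f h - 1) / h) \<longlongrightarrow> a) (at_right 0)"
  shows "((\<lambda>h. (f h ^ n - 1) / h) \<longlongrightarrow> real n * a) (at_right 0)"
proof (induction n)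
  case (Suc n)
  from rate_mult[OF f Suc] show ?case by (simp add: algebra_simps)
qed simp

lemma rate_imp_tendsto_1:
  fixes f :: "real \<Rightarrow> real"
  assumes f: "((\<lambda>h. (f h - 1) / h) \<longlongrightarrow> a) (at_right 0)"
  shows "(f \<longlongrightarrow> 1) (at_right 0)"
proof -
  have "((\<lambda>h. 1 + h * ((f h - 1) / h)) \<longlongrightarrow> 1 + 0 * a) (at_right 0)" by (intro tendsto_intros f)
  moreover have "eventually (\<lambda>h. 1 + h * ((f h - 1) / h) = f h) (at_right 0)"
    using eventually_at_right_less[of "0 :: real"] by eventually_elim simp
  ultimately show ?thesis by (simp add: Lim_transform_eventually)
qed

text \<open>
  Up to a probability \<open>o(h)\<close>, at most one of the \<open>p + 1\<close> independent walkers moves before time \<open>h\<close>, and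
  by one unit. The point masses of these finitely many displacements are known to
  first order and add up to \<open>1 - o(h)\<close>, which controls everything else. The error is uniform in \<open>x\<close> and \<open>g\<close>.
\<close>

lemma joint_law_first_order:
  fixes \<mu> \<nu> :: "real \<Rightarrow> (int ^ 'd) pmf" and \<kappa> \<rho> :: real
  assumes \<mu>0: "((\<lambda>h. (pmf (\<mu> h) 0 - 1) / h) \<longlongrightarrow> - \<kappa> * real (card (units :: (int ^ 'd) set))) (at_right 0)"
    and \<nu>0: "((\<lambda>h. (pmf (\<nu> h) 0 - 1) / h) \<longlongrightarrow> - \<rho> * real (card (units :: (int ^ 'd) set))) (at_right 0)"
    and \<mu>1: "\<And>e. e \<in> units \<Longrightarrow> ((\<lambda>h. pmf (\<mu> h) e / h) \<longlongrightarrow> \<kappa>) (at_right 0)"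
    and \<nu>1: "\<And>e. e \<in> units \<Longrightarrow> ((\<lambda>h. pmf (\<nu> h) e / h) \<longlongrightarrow> \<rho>) (at_right 0)"
  shows "\<exists>\<epsilon>. (\<epsilon> \<longlongrightarrow> 0) (at_right 0) \<and> (\<forall>h>0. \<forall>g C. \<forall>x :: int ^ 'd ^ 'p. (\<forall>y. \<bar>g y\<bar> \<le> C) \<longrightarrow>
     \<bar>measure_pmf.expectation (joint_law (\<mu> h) (\<nu> h)) (\<lambda>w. g (displace x w)) - g x - h * jump_gen \<kappa> \<rho> g x\<bar> \<le> h * \<epsilon> h * C)"
proof -
  let ?p = "CARD('p)" and ?m = "card (units :: (int ^ 'd) set)"
  let ?z = "(\<lambda>_. 0, 0) :: ('p \<Rightarrow> int ^ 'd) \<times> (int ^ 'd)"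
  let ?A = "\<lambda>(i, e). ((\<lambda>_. 0)(i := e), 0) :: ('p \<Rightarrow> int ^ 'd) \<times> (int ^ 'd)"
  let ?D = "\<lambda>e. (\<lambda>_. 0, e) :: ('p \<Rightarrow> int ^ 'd) \<times> (int ^ 'd)"
  define J where "J = (UNIV :: 'p set) \<times> (units :: (int ^ 'd) set)"
  define P0 where "P0 h = pmf (\<mu> h) 0 ^ ?p * pmf (\<nu> h) 0" for h
  define PA where "PA e h = pmf (\<mu> h) e * pmf (\<mu> h) 0 ^ (?p - 1) * pmf (\<nu> h) 0" for e h
  define PD where "PD e h = pmf (\<mu> h) 0 ^ ?p * pmf (\<nu> h) e" for e h
  have pz: "pmf (joint_law (\<mu> h) (\<nu> h)) ?z = P0 h" for h
    by (simp add: joint_law_def pmf_pair pmf_Pi' P0_def)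
  have pA: "pmf (joint_law (\<mu> h) (\<nu> h)) (?A j) = PA (snd j) h" for h j
  proof (cases j)
    case (Pair i e)
    have "(\<Prod>k\<in>UNIV. pmf (\<mu> h) (((\<lambda>_. 0)(i := e)) k)) = pmf (\<mu> h) e * (\<Prod>k\<in>UNIV - {i}. pmf (\<mu> h) 0)"
      by (subst prod.remove[of _ i]) auto
    moreover have "pmf (Pi_pmf UNIV 0 (\<lambda>_. \<mu> h)) ((\<lambda>_. 0)(i := e)) = (\<Prod>k\<in>UNIV. pmf (\<mu> h) (((\<lambda>_. 0)(i := e)) k))"
      by (rule pmf_Pi') auto
    ultimately show ?thesis using Pair by (simp add: joint_law_def pmf_pair PA_def del: fun_upd_apply)
  qed
  have pD: "pmf (joint_law (\<mu> h) (\<nu> h)) (?D e) = PD e h" for h e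
    by (simp add: joint_law_def pmf_pair pmf_Pi' PD_def)
  have J: "finite J" "card J = ?p * ?m" using finite_units by (auto simp: J_def card_cartesian_product)
  have injA: "inj_on ?A J"
  proof (rule inj_onI)
    fix j k assume jk: "j \<in> J" "k \<in> J" "?A j = ?A k"
    obtain i e i' e' where [simp]: "j = (i, e)" "k = (i', e')" by (cases j, cases k)
    have "((\<lambda>_. 0)(i := e)) = ((\<lambda>_. 0)(i' := e'))" using jk(3) by simp
    from fun_cong[OF this, of i] fun_cong[OF this, of i'] show "j = k"
      using jk(1,2) zero_notin_units by (auto simp: J_def split: if_splits)
  qed
  have injD: "inj_on ?D units" by (auto simp: inj_on_def)
  define S where "S = insert ?z (?A ` J \<union> ?D ` units)"
  have S_sum: "(\<Sum>s\<in>S. F s) = F ?z + ((\<Sum>j\<in>J. F (?A j)) + (\<Sum>e\<in>units. F (?D e)))" for F :: "_ \<Rightarrow> real"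
  proof -
    have A0: "(\<lambda>_. 0)(i := e) \<noteq> (\<lambda>_. 0)" if "e \<in> units" for i :: 'p and e :: "int ^ 'd"
      using that zero_notin_units by (metis fun_upd_same)
    have "?z \<notin> ?A ` J \<union> ?D ` units" using A0 zero_notin_units by (auto simp: J_def) (metis A0)+
    moreover have "?A ` J \<inter> ?D ` units = {}" using A0 zero_notin_units by (auto simp: J_def)
    ultimately have nz: "?z \<notin> ?A ` J \<union> ?D ` units" and disj: "?A ` J \<inter> ?D ` units = {}" by blast+
    have "sum F S = F ?z + sum F (?A ` J \<union> ?D ` units)"
      unfolding S_def by (rule sum.insert[OF _ nz]) (simp add: J(1) finite_units)
    also have "sum F (?A ` J \<union> ?D ` units) = sum F (?A ` J) + sum F (?D ` units)"
      by (rule sum.union_disjoint[OF _ _ disj]) (simp_all add: J(1) finite_units)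
    finally have "sum F S = F ?z + (sum F (?A ` J) + sum F (?D ` units))" .
    then show ?thesis by (simp only: sum.reindex[OF injA] sum.reindex[OF injD] o_def)
  qed
  have S: "finite S" by (simp add: S_def J(1) finite_units)
  have lim0: "((\<lambda>h. (P0 h - 1) / h) \<longlongrightarrow> real ?p * (- \<kappa> * real ?m) + - \<rho> * real ?m) (at_right 0)"
    unfolding P0_def by (intro rate_mult rate_power \<mu>0 \<nu>0)
  have \<mu>_1: "((\<lambda>h. pmf (\<mu> h) 0) \<longlongrightarrow> 1) (at_right 0)" and \<nu>_1: "((\<lambda>h. pmf (\<nu> h) 0) \<longlongrightarrow> 1) (at_right 0)"
    using rate_imp_tendsto_1[OF \<mu>0] rate_imp_tendsto_1[OF \<nu>0] by auto
  have limA: "((\<lambda>h. PA e h / h) \<longlongrightarrow> \<kappa>) (at_right 0)" if "e \<in> units" for e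
  proof -
    have "((\<lambda>h. pmf (\<mu> h) e / h * pmf (\<mu> h) 0 ^ (?p - 1) * pmf (\<nu> h) 0) \<longlongrightarrow> \<kappa> * 1 ^ (?p - 1) * 1) (at_right 0)"
      by (intro tendsto_intros \<mu>1 \<mu>_1 \<nu>_1 that)
    then show ?thesis by (simp add: PA_def)
  qed
  have limD: "((\<lambda>h. PD e h / h) \<longlongrightarrow> \<rho>) (at_right 0)" if "e \<in> units" for e
  proof -
    have "((\<lambda>h. pmf (\<mu> h) 0 ^ ?p * (pmf (\<nu> h) e / h)) \<longlongrightarrow> 1 ^ ?p * \<rho>) (at_right 0)"
      by (intro tendsto_intros \<nu>1 \<mu>_1 that)
    then show ?thesis by (simp add: PD_def)
  qed
  \<comment> \<open>errors of the difference quotients, for no move, a particle move and a catalyst move\<close>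
  define r0 where "r0 h = (P0 h - 1) / h + \<kappa> * real (card J) + \<rho> * real ?m" for h
  define rA where "rA j h = PA (snd j) h / h - \<kappa>" for j :: "'p \<times> (int ^ 'd)" and h
  define rD where "rD e h = PD e h / h - \<rho>" for e h
  \<comment> \<open>the probability of all other displacements, divided by \<open>h\<close>: total mass 1 makes it minus the sum of the errors\<close>
  define rest where "rest h = - (r0 h + ((\<Sum>j\<in>J. rA j h) + (\<Sum>e\<in>units. rD e h)))" for h
  define \<epsilon> where "\<epsilon> h = \<bar>r0 h\<bar> + ((\<Sum>j\<in>J. \<bar>rA j h\<bar>) + (\<Sum>e\<in>units. \<bar>rD e h\<bar>)) + \<bar>rest h\<bar>" for h
  have r0: "(r0 \<longlongrightarrow> 0) (at_right 0)"
  proof -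
    have "((\<lambda>h. (P0 h - 1) / h + \<kappa> * real (card J) + \<rho> * real ?m) \<longlongrightarrow>
        real ?p * (- \<kappa> * real ?m) + - \<rho> * real ?m + \<kappa> * real (card J) + \<rho> * real ?m) (at_right 0)"
      by (intro tendsto_intros lim0)
    then show ?thesis by (simp add: r0_def[abs_def] J(2) algebra_simps)
  qed
  have rA: "(rA j \<longlongrightarrow> 0) (at_right 0)" if "j \<in> J" for j
    using tendsto_diff[OF limA[of "snd j"] tendsto_const[of \<kappa>]] that by (auto simp: rA_def[abs_def] J_def)
  have rD: "(rD e \<longlongrightarrow> 0) (at_right 0)" if "e \<in> units" for e
    using tendsto_diff[OF limD[of e] tendsto_const[of \<rho>]] that by (auto simp: rD_def[abs_def])
  have \<epsilon>: "(\<epsilon> \<longlongrightarrow> 0) (at_right 0)"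
  proof -
    have "((\<lambda>h. \<bar>r0 h\<bar> + ((\<Sum>j\<in>J. \<bar>rA j h\<bar>) + (\<Sum>e\<in>units. \<bar>rD e h\<bar>)) + \<bar>- (r0 h + ((\<Sum>j\<in>J. rA j h) + (\<Sum>e\<in>units. rD e h)))\<bar>)
        \<longlongrightarrow> \<bar>0\<bar> + ((\<Sum>j\<in>J. \<bar>0\<bar>) + (\<Sum>e\<in>(units :: (int ^ 'd) set). \<bar>0\<bar>)) + \<bar>- (0 + ((\<Sum>j\<in>J. 0) + (\<Sum>e\<in>(units :: (int ^ 'd) set). 0)))\<bar>) (at_right 0)"
      by (intro tendsto_intros r0 rA rD)
    then show ?thesis by (simp add: \<epsilon>_def[abs_def] rest_def)
  qed
  have est: "\<bar>measure_pmf.expectation (joint_law (\<mu> h) (\<nu> h)) (\<lambda>w. g (displace x w)) - g x - h * jump_gen \<kappa> \<rho> g x\<bar> \<le> h * \<epsilon> h * C"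
    if h: "0 < h" and g: "\<And>y. \<bar>g y\<bar> \<le> C" for h g C and x :: "int ^ 'd ^ 'p"
  proof -
    let ?L = "joint_law (\<mu> h) (\<nu> h)" and ?G = "\<lambda>w. g (displace x w)"
    have C: "0 \<le> C" using g[of 0] by linarith
    have Gz: "?G ?z = g x" by (simp add: displace_def)
    have GA: "?G (?A j) = g (x + axis (fst j) (snd j))" for j
      by (cases j) (auto simp: displace_def axis_def vec_eq_iff intro!: arg_cong[of _ _ g])
    have GD: "?G (?D e) = g (x + diag e)" for e
      by (auto simp: displace_def diag_def vec_eq_iff intro!: arg_cong[of _ _ g])
    have x_diag_0: "x + diag 0 = x" and PD_0: "PD 0 h = P0 h"
      by (simp_all add: diag_def vec_eq_iff PD_def P0_def)
    have int: "integrable ?L (\<lambda>w. F w * ?G w)" if "\<And>w. \<bar>F w\<bar> \<le> 1" for F :: "_ \<Rightarrow> real"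
    proof (rule measure_pmf.integrable_const_bound[of _ C])
      have "\<bar>F w\<bar> * \<bar>?G w\<bar> \<le> 1 * C" for w by (intro mult_mono that g) auto
      then show "AE w in ?L. norm (F w * ?G w) \<le> C" by (simp add: abs_mult)
    qed simp
    have int1: "integrable ?L (\<lambda>w. indicator S w * ?G w)" and int2: "integrable ?L (\<lambda>w. indicator (- S) w * ?G w)"
      by (rule int, simp add: indicator_def)+
    have "measure_pmf.expectation ?L ?G = measure_pmf.expectation ?L (\<lambda>w. indicator S w * ?G w + indicator (- S) w * ?G w)"
      by (intro Bochner_Integration.integral_cong refl) (auto simp: indicator_def)
    also have "\<dots> = measure_pmf.expectation ?L (\<lambda>w. indicator S w * ?G w) + measure_pmf.expectation ?L (\<lambda>w. indicator (- S) w * ?G w)"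
      by (rule Bochner_Integration.integral_add[OF int1 int2])
    also have "measure_pmf.expectation ?L (\<lambda>w. indicator S w * ?G w) = (\<Sum>s\<in>S. indicator S s * ?G s * pmf ?L s)"
      by (rule integral_measure_pmf_real[OF S]) (auto simp: indicator_def split: if_splits)
    also have "\<dots> = (\<Sum>s\<in>S. ?G s * pmf ?L s)" by (intro sum.cong) auto
    also have "\<dots> = g x * P0 h + ((\<Sum>j\<in>J. g (x + axis (fst j) (snd j)) * PA (snd j) h) + (\<Sum>e\<in>units. g (x + diag e) * PD e h))"
      by (simp only: S_sum Gz GA GD pz pA pD x_diag_0 PD_0)
    finally have E: "measure_pmf.expectation ?L ?G = g x * P0 h + ((\<Sum>j\<in>J. g (x + axis (fst j) (snd j)) * PA (snd j) h)
        + (\<Sum>e\<in>units. g (x + diag e) * PD e h)) + measure_pmf.expectation ?L (\<lambda>w. indicator (- S) w * ?G w)" .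
    have gen: "h * jump_gen \<kappa> \<rho> g x = (\<Sum>j\<in>J. g (x + axis (fst j) (snd j)) * (h * \<kappa>)) + (\<Sum>e\<in>units. g (x + diag e) * (h * \<rho>))
        - h * (\<kappa> * real (card J) + \<rho> * real ?m) * g x"
    proof -
      have s1: "(\<Sum>i\<in>UNIV. \<Sum>e\<in>units. g (x + axis i e) - g x) = (\<Sum>j\<in>J. g (x + axis (fst j) (snd j)) - g x)"
        unfolding J_def by (simp only: sum.cartesian_product case_prod_unfold)
      show ?thesis
        unfolding jump_gen_def s1
        by (simp only: sum_subtractf sum_constant sum_distrib_right[symmetric]) (simp add: algebra_simps)
    qed
    have P: "P0 h = 1 + h * (r0 h - \<kappa> * real (card J) - \<rho> * real ?m)" "PA (snd j) h = h * \<kappa> + h * rA j h" "PD e h = h * \<rho> + h * rD e h" for j e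
      using h by (simp_all add: r0_def rA_def rD_def field_simps)
    have mass: "measure_pmf.expectation ?L (indicator (- S)) = h * rest h"
    proof -
      have "measure ?L S = P0 h + ((\<Sum>j\<in>J. PA (snd j) h) + (\<Sum>e\<in>units. PD e h))"
        by (simp only: measure_measure_pmf_finite[OF S] S_sum pz pA pD PD_0)
      also have "\<dots> = 1 - h * rest h"
        by (simp add: P rest_def sum.distrib sum_distrib_left algebra_simps)
      finally have "measure ?L S = 1 - h * rest h" .
      moreover have "measure_pmf.expectation ?L (indicator (- S)) = measure ?L (- S)" by simp
      moreover have "measure ?L (- S) = 1 - measure ?L S"
        using measure_pmf.prob_compl[of S ?L] by (simp add: Compl_eq_Diff_UNIV)
      ultimately show ?thesis by simp
    qed
    have tail: "\<bar>measure_pmf.expectation ?L (\<lambda>w. indicator (- S) w * ?G w)\<bar> \<le> h * rest h * C"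
    proof -
      have "\<bar>measure_pmf.expectation ?L (\<lambda>w. indicator (- S) w * ?G w)\<bar> \<le> measure_pmf.expectation ?L (\<lambda>w. \<bar>indicator (- S) w * ?G w\<bar>)"
        by (rule integral_abs_bound)
      also have "\<dots> \<le> measure_pmf.expectation ?L (\<lambda>w. indicator (- S) w * C)"
      proof (rule integral_mono)
        show "integrable ?L (\<lambda>w. \<bar>indicator (- S) w * ?G w\<bar>)" by (rule integrable_abs[OF int2])
        show "integrable ?L (\<lambda>w. indicator (- S) w * C)"
          by (rule measure_pmf.integrable_const_bound[of _ C]) (use C in \<open>auto simp: indicator_def\<close>)
        show "\<bar>indicator (- S) w * ?G w\<bar> \<le> indicator (- S) w * C" for w
          using g by (auto simp: indicator_def)
      qed
      also have "\<dots> = h * rest h * C" by (simp only: integral_mult_left_zero mass)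
      finally show ?thesis .
    qed
    let ?err = "g x * r0 h + ((\<Sum>j\<in>J. g (x + axis (fst j) (snd j)) * rA j h) + (\<Sum>e\<in>units. g (x + diag e) * rD e h))"
    have "measure_pmf.expectation ?L ?G - g x - h * jump_gen \<kappa> \<rho> g x
        = h * ?err + measure_pmf.expectation ?L (\<lambda>w. indicator (- S) w * ?G w)"
      unfolding E gen P by (simp add: sum.distrib sum_distrib_left algebra_simps)
    also have "\<bar>\<dots>\<bar> \<le> h * \<bar>?err\<bar> + h * rest h * C"
      using tail h by (intro order.trans[OF abs_triangle_ineq add_mono]) (auto simp: abs_mult)
    also have "\<bar>?err\<bar> \<le> C * (\<bar>r0 h\<bar> + ((\<Sum>j\<in>J. \<bar>rA j h\<bar>) + (\<Sum>e\<in>units. \<bar>rD e h\<bar>)))"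
      unfolding distrib_left sum_distrib_left
      by (intro order.trans[OF abs_triangle_ineq add_mono] order.trans[OF sum_abs sum_mono])
         (auto simp: abs_mult intro!: mult_right_mono g)
    also have "h * (C * (\<bar>r0 h\<bar> + ((\<Sum>j\<in>J. \<bar>rA j h\<bar>) + (\<Sum>e\<in>units. \<bar>rD e h\<bar>)))) + h * rest h * C \<le> h * \<epsilon> h * C"
      using h C by (simp add: \<epsilon>_def algebra_simps mult_left_mono)
    finally show ?thesis using h by (simp add: mult_left_mono)
  qed
  show ?thesis using \<epsilon> est by blast
qed

lemma jump_gen_bounded:
  fixes f :: "int ^ 'd ^ 'p \<Rightarrow> real"
  assumes f: "\<And>y. \<bar>f y\<bar> \<le> C" and "0 \<le> \<kappa>" "0 \<le> \<rho>"
  shows "\<bar>jump_gen \<kappa> \<rho> f x\<bar> \<le> 2 * real (card (units :: (int ^ 'd) set)) * (\<kappa> * real CARD('p) + \<rho>) * C"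
proof -
  have d: "\<bar>f y - f z\<bar> \<le> 2 * C" for y z using f[of y] f[of z] by linarith
  have "\<bar>\<Sum>i\<in>UNIV. \<Sum>e\<in>units. f (x + axis i e) - f x\<bar> \<le> (\<Sum>i\<in>(UNIV :: 'p set). \<Sum>e\<in>(units :: (int ^ 'd) set). 2 * C)"
    by (intro order.trans[OF sum_abs sum_mono] d)
  moreover have "\<bar>\<Sum>e\<in>units. f (x + diag e) - f x\<bar> \<le> (\<Sum>e\<in>(units :: (int ^ 'd) set). 2 * C)"
    by (intro order.trans[OF sum_abs sum_mono] d)
  ultimately have "\<bar>jump_gen \<kappa> \<rho> f x\<bar> \<le> \<kappa> * (\<Sum>i\<in>(UNIV :: 'p set). \<Sum>e\<in>(units :: (int ^ 'd) set). 2 * C)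
      + \<rho> * (\<Sum>e\<in>(units :: (int ^ 'd) set). 2 * C)"
    unfolding jump_gen_def using assms(2,3)
    by (intro order.trans[OF abs_triangle_ineq add_mono]) (auto simp: abs_mult intro: mult_left_mono)
  then show ?thesis by (simp add: algebra_simps)
qed

lemma jump_gen_diff: "jump_gen \<kappa> \<rho> (\<lambda>y. f y - g y) x = jump_gen \<kappa> \<rho> f x - jump_gen \<kappa> \<rho> g x"
proof -
  have e: "f a - g a - (f x - g x) = (f a - f x) - (g a - g x)" for a by simp
  show ?thesis unfolding jump_gen_def e sum_subtractf right_diff_distrib by simp
qed

text \<open>
  The jumps act on \<open>e\<^sup>\<gamma>\<^sup>h\<^sup>V f = f + \<gamma> h V f + O(h\<^sup>2)\<close> instead of \<open>f\<close>. In the term of first order this changes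
  the result only by \<open>O(h\<^sup>2)\<close>, since the jump generator is bounded.
\<close>

lemma step_op_first_order:
  fixes \<mu> \<nu> :: "real \<Rightarrow> (int ^ 'd) pmf" and \<kappa> \<rho> :: real
  assumes "((\<lambda>h. (pmf (\<mu> h) 0 - 1) / h) \<longlongrightarrow> - \<kappa> * real (card (units :: (int ^ 'd) set))) (at_right 0)"
    and "((\<lambda>h. (pmf (\<nu> h) 0 - 1) / h) \<longlongrightarrow> - \<rho> * real (card (units :: (int ^ 'd) set))) (at_right 0)"
    and "\<And>e. e \<in> units \<Longrightarrow> ((\<lambda>h. pmf (\<mu> h) e / h) \<longlongrightarrow> \<kappa>) (at_right 0)"
    and "\<And>e. e \<in> units \<Longrightarrow> ((\<lambda>h. pmf (\<nu> h) e / h) \<longlongrightarrow> \<rho>) (at_right 0)"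
    and \<kappa>: "0 \<le> \<kappa>" and \<rho>: "0 \<le> \<rho>" and \<gamma>: "0 \<le> \<gamma>"
  shows "\<exists>\<epsilon>. (\<epsilon> \<longlongrightarrow> 0) (at_right 0) \<and> (\<forall>\<^sub>F h in at_right 0. \<forall>f C. \<forall>x :: int ^ 'd ^ 'p. (\<forall>y. \<bar>f y\<bar> \<le> C) \<longrightarrow>
     \<bar>step_op (\<mu> h) (\<nu> h) (\<gamma> * h) f x - f x - h * (jump_gen \<kappa> \<rho> f x + \<gamma> * potential x * f x)\<bar> \<le> h * \<epsilon> h * C)"
proof -
  let ?p = "real CARD('p)"
  obtain \<epsilon>0 where lim: "(\<epsilon>0 \<longlongrightarrow> 0) (at_right 0)"
    and est: "\<And>h g C x. 0 < h \<Longrightarrow> (\<And>y :: int ^ 'd ^ 'p. \<bar>g y\<bar> \<le> C) \<Longrightarrow>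
      \<bar>measure_pmf.expectation (joint_law (\<mu> h) (\<nu> h)) (\<lambda>w. g (displace x w)) - g x - h * jump_gen \<kappa> \<rho> g x\<bar> \<le> h * \<epsilon>0 h * C"
    using joint_law_first_order[where 'p = 'p, OF assms(1-4)] by blast
  define \<Lambda> where "\<Lambda> = 2 * real (card (units :: (int ^ 'd) set)) * (\<kappa> * ?p + \<rho>)"
  define \<epsilon> where "\<epsilon> h = 3 * \<epsilon>0 h + h * (\<gamma> * ?p)\<^sup>2 + \<Lambda> * (2 * (\<gamma> * h * ?p))" for h
  have "((\<lambda>h. 3 * \<epsilon>0 h + h * (\<gamma> * ?p)\<^sup>2 + \<Lambda> * (2 * (\<gamma> * h * ?p))) \<longlongrightarrow> 3 * 0 + 0 * (\<gamma> * ?p)\<^sup>2 + \<Lambda> * (2 * (\<gamma> * 0 * ?p))) (at_right 0)"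
    by (intro tendsto_intros lim)
  then have \<epsilon>: "(\<epsilon> \<longlongrightarrow> 0) (at_right 0)" by (simp add: \<epsilon>_def[abs_def])
  have "((\<lambda>h. \<gamma> * h * ?p) \<longlongrightarrow> \<gamma> * 0 * ?p) (at_right 0)" by (intro tendsto_intros)
  then have "\<forall>\<^sub>F h in at_right 0. \<gamma> * h * ?p < 1" by (intro order_tendstoD) auto
  then have "\<forall>\<^sub>F h in at_right 0. \<forall>f C. \<forall>x :: int ^ 'd ^ 'p. (\<forall>y. \<bar>f y\<bar> \<le> C) \<longrightarrow>
     \<bar>step_op (\<mu> h) (\<nu> h) (\<gamma> * h) f x - f x - h * (jump_gen \<kappa> \<rho> f x + \<gamma> * potential x * f x)\<bar> \<le> h * \<epsilon> h * C"
    using eventually_at_right_less[of "0 :: real"]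
  proof eventually_elim
    case (elim h)
    show ?case
    proof (intro allI impI)
      fix f :: "int ^ 'd ^ 'p \<Rightarrow> real" and C :: real and x :: "int ^ 'd ^ 'p"
      assume f: "\<forall>y. \<bar>f y\<bar> \<le> C"
      then have C: "0 \<le> C" using abs_ge_zero order.trans by blast
      \<comment> \<open>an upper bound of \<open>\<gamma> h V\<close>, at most 1 so that \<open>e\<^sup>u \<le> 1 + u + w\<^sup>2\<close> for \<open>0 \<le> u \<le> w\<close>\<close>
      define w where "w = \<gamma> * h * ?p"
      have w: "0 \<le> w" "w \<le> 1" using elim \<gamma> by (auto simp: w_def)
      define u where "u y = \<gamma> * h * potential y" for y :: "int ^ 'd ^ 'p"
      have u: "0 \<le> u y" "u y \<le> w" for y
        unfolding u_def w_def using potential_bounds[of y] \<gamma> elim by (auto intro: mult_left_mono)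
      have exp_u: "1 + u y \<le> exp (u y)" "exp (u y) \<le> 1 + u y + w\<^sup>2" for y
      proof -
        have "(u y)\<^sup>2 \<le> w\<^sup>2" using u[of y] by (intro power_mono) auto
        then show "1 + u y \<le> exp (u y)" "exp (u y) \<le> 1 + u y + w\<^sup>2"
          using exp_ge_add_one_self[of "u y"] exp_bound[of "u y"] u[of y] w by linarith+
      qed
      have w2: "w\<^sup>2 \<le> w" using w by (simp add: power2_eq_square mult_left_le)
      define g where "g y = exp (u y) * f y" for y
      have g_bound: "\<bar>g y\<bar> \<le> 3 * C" for y
        unfolding g_def abs_mult using exp_u[of y] u[of y] w w2 f by (intro mult_mono) auto
      have gf: "\<bar>g y - f y\<bar> \<le> 2 * w * C" for y
      proof -
        have "g y - f y = (exp (u y) - 1) * f y" by (simp add: g_def algebra_simps)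
        then have "\<bar>g y - f y\<bar> = (exp (u y) - 1) * \<bar>f y\<bar>"
          using exp_u(1)[of y] u(1)[of y] by (simp add: abs_mult)
        also have "\<dots> \<le> (2 * w) * C"
          using exp_u[of y] u[of y] w w2 f by (intro mult_mono) auto
        finally show ?thesis .
      qed
      have e1: "\<bar>step_op (\<mu> h) (\<nu> h) (\<gamma> * h) f x - g x - h * jump_gen \<kappa> \<rho> g x\<bar> \<le> h * \<epsilon>0 h * (3 * C)"
        using est[of h g "3 * C" x, OF elim(2) g_bound] by (simp add: step_op_def g_def u_def)
      have e2: "\<bar>g x - f x - h * (\<gamma> * potential x * f x)\<bar> \<le> w\<^sup>2 * C"
      proof -
        have "g x - f x - h * (\<gamma> * potential x * f x) = (exp (u x) - 1 - u x) * f x"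
          by (simp add: g_def u_def algebra_simps)
        moreover have "\<bar>exp (u x) - 1 - u x\<bar> \<le> w\<^sup>2" using exp_u[of x] by linarith
        ultimately show ?thesis
          using f by (auto simp: abs_mult intro!: mult_mono)
      qed
      have e3: "\<bar>h * jump_gen \<kappa> \<rho> g x - h * jump_gen \<kappa> \<rho> f x\<bar> \<le> h * (\<Lambda> * (2 * w * C))"
      proof -
        have "\<bar>jump_gen \<kappa> \<rho> (\<lambda>y. g y - f y) x\<bar> \<le> \<Lambda> * (2 * w * C)"
          unfolding \<Lambda>_def by (rule jump_gen_bounded[OF gf \<kappa> \<rho>])
        then have "h * \<bar>jump_gen \<kappa> \<rho> g x - jump_gen \<kappa> \<rho> f x\<bar> \<le> h * (\<Lambda> * (2 * w * C))"
          unfolding jump_gen_diff using elim(2) by (intro mult_left_mono) auto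
        then show ?thesis using elim(2) by (simp add: abs_mult right_diff_distrib[symmetric])
      qed
      have "h * \<epsilon>0 h * (3 * C) + w\<^sup>2 * C + h * (\<Lambda> * (2 * w * C)) = h * \<epsilon> h * C"
        by (simp add: \<epsilon>_def w_def algebra_simps power2_eq_square)
      with e1 e2 e3 show "\<bar>step_op (\<mu> h) (\<nu> h) (\<gamma> * h) f x - f x - h * (jump_gen \<kappa> \<rho> f x + \<gamma> * potential x * f x)\<bar> \<le> h * \<epsilon> h * C"
        unfolding distrib_left by linarith
    qed
  qed
  with \<epsilon> show ?thesis by blast
qed

section \<open>Product formula\<close>

text \<open>
  The Poisson limit theorem when \<open>c = 1\<close>.
\<close>

lemma binomial_poisson_limit:
  fixes c t :: real
  shows "(\<lambda>n. real (n choose k) * (1 - t / real n * c) ^ (n - k) * (t / real n) ^ k) \<longlonglongrightarrow> exp (- (c * t)) * t ^ k / fact k"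
proof -
  have one: "(\<lambda>n. 1 - t / real n * c) \<longlonglongrightarrow> 1"
  proof -
    have "(\<lambda>n. 1 - t / real n * c) \<longlonglongrightarrow> 1 - 0 * c" by (intro tendsto_intros lim_const_over_n)
    then show ?thesis by simp
  qed
  have ch: "(\<lambda>n. \<Prod>i=0..<k. (real n - real i) / real n) \<longlonglongrightarrow> (\<Prod>i=0..<k. 1)"
  proof (rule tendsto_prod)
    fix i
    have "(\<lambda>n. 1 - real i / real n) \<longlonglongrightarrow> 1"
      using tendsto_diff[OF tendsto_const lim_const_over_n[of "real i"], of 1] by simp
    moreover have "eventually (\<lambda>n. 1 - real i / real n = (real n - real i) / real n) sequentially"
      using eventually_gt_at_top[of 0] by eventually_elim (simp add: diff_divide_distrib)
    ultimately show "(\<lambda>n. (real n - real i) / real n) \<longlonglongrightarrow> 1" by (rule Lim_transform_eventually)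
  qed
  have "(\<lambda>n. (\<Prod>i=0..<k. (real n - real i) / real n) / fact k * ((1 + (- (c * t)) / real n) ^ n / (1 - t / real n * c) ^ k) * t ^ k)
      \<longlonglongrightarrow> (\<Prod>i=0..<k. 1) / fact k * (exp (- (c * t)) / 1 ^ k) * t ^ k"
    by (intro tendsto_intros ch one tendsto_exp_limit_sequentially) auto
  moreover have "eventually (\<lambda>n. (\<Prod>i=0..<k. (real n - real i) / real n) / fact k * ((1 + (- (c * t)) / real n) ^ n / (1 - t / real n * c) ^ k) * t ^ k
      = real (n choose k) * (1 - t / real n * c) ^ (n - k) * (t / real n) ^ k) sequentially"
    using eventually_ge_at_top[of k] order_tendstoD(1)[OF one zero_less_one] eventually_gt_at_top[of 0]
  proof eventually_elim
    case (elim n)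
    have b: "real (n choose k) = (\<Prod>i=0..<k. real n - real i) / fact k"
      by (simp add: binomial_gbinomial gbinomial_prod_rev)
    have "(1 - t / real n * c) ^ n = (1 - t / real n * c) ^ (n - k) * (1 - t / real n * c) ^ k"
      using elim(1) by (simp flip: power_add)
    then show ?case
      using elim by (simp add: b prod_dividef power_divide mult.commute[of c t])
  qed
  ultimately have "(\<lambda>n. real (n choose k) * (1 - t / real n * c) ^ (n - k) * (t / real n) ^ k)
      \<longlonglongrightarrow> (\<Prod>i=0..<k. 1) / fact k * (exp (- (c * t)) / 1 ^ k) * t ^ k" by (rule Lim_transform_eventually)
  then show ?thesis by simp
qed

context hopping
begin

text \<open>
  The binomial theorem for the commuting operators \<open>\<alpha>\<close> and \<open>h B\<close>.
\<close>

lemma euler_expansion: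
  "((\<lambda>f x. \<alpha> * f x + h * B f x) ^^ n) g x = (\<Sum>k\<le>n. real (n choose k) * \<alpha> ^ (n - k) * h ^ k * (B ^^ k) g x)"
proof (induction n arbitrary: x)
  case (Suc n)
  let ?b = "\<lambda>k. (B ^^ k) g x"
  let ?P = "\<lambda>n k. real (n choose k) * \<alpha> ^ (n - k) * h ^ k"
  have P: "?P (Suc n) (Suc k) = \<alpha> * ?P n (Suc k) + h * ?P n k" for k
  proof (cases "k < n")
    case True
    then have "\<alpha> ^ (n - k) = \<alpha> * \<alpha> ^ (n - Suc k)" by (metis Suc_diff_Suc power_Suc)
    then show ?thesis by (simp add: algebra_simps)
  next
    case False
    then show ?thesis by (cases "k = n") (auto simp: binomial_eq_0)
  qed
  have "((\<lambda>f x. \<alpha> * f x + h * B f x) ^^ Suc n) g x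
      = \<alpha> * (\<Sum>k\<le>n. ?P n k * ?b k) + h * B (\<lambda>x. \<Sum>k\<le>n. ?P n k * (B ^^ k) g x) x"
  proof -
    have "((\<lambda>f x. \<alpha> * f x + h * B f x) ^^ n) g = (\<lambda>x. \<Sum>k\<le>n. ?P n k * (B ^^ k) g x)" by (rule ext) (rule Suc)
    then show ?thesis by simp
  qed
  also have "B (\<lambda>x. \<Sum>k\<le>n. ?P n k * (B ^^ k) g x) x = (\<Sum>k\<le>n. ?P n k * ?b (Suc k))"
    by (simp add: hop_sum hop_cmult)
  also have "\<alpha> * (\<Sum>k\<le>n. ?P n k * ?b k) = (\<Sum>k\<le>Suc n. \<alpha> * ?P n k * ?b k)"
    by (simp add: sum_distrib_left mult.assoc binomial_eq_0)
  also have "\<dots> = \<alpha> * ?P n 0 * ?b 0 + (\<Sum>k\<le>n. \<alpha> * ?P n (Suc k) * ?b (Suc k))"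
    by (rule sum.atMost_Suc_shift)
  also have "\<dots> + h * (\<Sum>k\<le>n. ?P n k * ?b (Suc k)) = ?P (Suc n) 0 * ?b 0 + (\<Sum>k\<le>n. ?P (Suc n) (Suc k) * ?b (Suc k))"
    unfolding P by (simp add: sum_distrib_left sum.distrib distrib_right mult.assoc)
  also have "\<dots> = (\<Sum>k\<le>Suc n. ?P (Suc n) k * ?b k)" by (rule sum.atMost_Suc_shift[symmetric])
  finally show ?case .
qed simp

lemma b_nonneg: "0 \<le> b"
  by (rule order.trans[OF \<beta>_nonneg \<beta>_le])

text \<open>
  The series on the right is \<open>e\<^sup>t\<^sup>(\<^sup>B\<^sup>-\<^sup>c\<^sup>) 1\<close>. The limit is taken term by term in the binomial expansion; the terms
  are dominated by \<open>(t M)\<^sup>k / k!\<close> as \<open>M\<close> bounds \<open>B\<close> in the supremum norm.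
\<close>

lemma euler_limit:
  assumes t: "0 < t" and c: "0 \<le> c"
  shows "(\<lambda>n. ((\<lambda>f x. (1 - t / real n * c) * f x + t / real n * B f x) ^^ n) (\<lambda>_. 1) x)
    \<longlonglongrightarrow> exp (- (c * t)) * (\<Sum>k. t ^ k / fact k * (B ^^ k) (\<lambda>_. 1) x)"
proof -
  define M where "M = sum a E + b"
  have M: "0 \<le> M" using b_nonneg sum_nonneg[of E a] a_nonneg by (auto simp: M_def)
  define u where "u k n = real (n choose k) * (1 - t / real n * c) ^ (n - k) * (t / real n) ^ k * (B ^^ k) (\<lambda>_. 1) x" for k n
  have Bk: "\<bar>(B ^^ k) (\<lambda>_. 1) x\<bar> \<le> M ^ k" for k
    using Bn_bounded[of "\<lambda>_. 1" 1 k x] by (simp add: M_def)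
  have lim: "(\<lambda>n. u k n) \<longlonglongrightarrow> exp (- (c * t)) * t ^ k / fact k * (B ^^ k) (\<lambda>_. 1) x" for k
    unfolding u_def by (intro tendsto_mult binomial_poisson_limit tendsto_const)
  have one: "(\<lambda>n. 1 - t / real n * c) \<longlonglongrightarrow> 1"
  proof -
    have "(\<lambda>n. 1 - t / real n * c) \<longlonglongrightarrow> 1 - 0 * c" by (intro tendsto_intros lim_const_over_n)
    then show ?thesis by simp
  qed
  have "\<forall>\<^sub>F n in sequentially. \<forall>k. \<bar>u k n\<bar> \<le> (t * M) ^ k / fact k"
    using order_tendstoD(1)[OF one zero_less_one] eventually_gt_at_top[of 0]
  proof eventually_elim
    case (elim n)
    show ?case
    proof
      fix k
      have "real (n choose k) * (t / real n) ^ k \<le> t ^ k / fact k"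
      proof -
        have "real (n choose k) * fact k \<le> real n ^ k"
          using binomial_fact_pow[of n k] by (metis of_nat_fact of_nat_le_iff of_nat_mult of_nat_power)
        then have "real (n choose k) \<le> real n ^ k / fact k" by (simp add: field_simps)
        then have "real (n choose k) * (t / real n) ^ k \<le> real n ^ k / fact k * (t / real n) ^ k"
          using t by (intro mult_right_mono) auto
        also have "\<dots> = t ^ k / fact k" using elim by (simp add: power_divide)
        finally show ?thesis .
      qed
      moreover have "(1 - t / real n * c) ^ (n - k) \<le> 1"
        using elim t c by (intro power_le_one) auto
      ultimately have "real (n choose k) * (t / real n) ^ k * (1 - t / real n * c) ^ (n - k) * \<bar>(B ^^ k) (\<lambda>_. 1) x\<bar>
          \<le> t ^ k / fact k * 1 * M ^ k"
        using t elim Bk[of k] by (intro mult_mono) (auto intro!: mult_nonneg_nonneg)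
      moreover have "\<bar>u k n\<bar> = real (n choose k) * (t / real n) ^ k * (1 - t / real n * c) ^ (n - k) * \<bar>(B ^^ k) (\<lambda>_. 1) x\<bar>"
        using elim t by (simp add: u_def abs_mult power_abs mult_ac)
      ultimately show "\<bar>u k n\<bar> \<le> (t * M) ^ k / fact k" by (simp add: power_mult_distrib)
    qed
  qed
  then have bound: "\<forall>\<^sub>F (k, n) in at_top \<times>\<^sub>F sequentially. norm (u k n) \<le> (t * M) ^ k / fact k"
    using eventually_prodI[of "\<lambda>_. True" at_top "\<lambda>n. \<forall>k. \<bar>u k n\<bar> \<le> (t * M) ^ k / fact k" sequentially]
    by (auto elim!: eventually_mono)
  have "summable (\<lambda>k. (t * M) ^ k / fact k)"
    using summable_exp[of "t * M"] by (simp add: field_simps)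
  from tannerys_theorem[OF lim bound this]
  have "(\<lambda>n. \<Sum>k. u k n) \<longlonglongrightarrow> (\<Sum>k. exp (- (c * t)) * t ^ k / fact k * (B ^^ k) (\<lambda>_. 1) x)" by simp
  also have "(\<Sum>k. exp (- (c * t)) * t ^ k / fact k * (B ^^ k) (\<lambda>_. 1) x)
      = exp (- (c * t)) * (\<Sum>k. t ^ k / fact k * (B ^^ k) (\<lambda>_. 1) x)"
  proof (subst suminf_mult[symmetric])
    show "summable (\<lambda>k. t ^ k / fact k * (B ^^ k) (\<lambda>_. 1) x)"
    proof (rule summable_comparison_test'[OF \<open>summable (\<lambda>k. (t * M) ^ k / fact k)\<close>, of 0])
      show "norm (t ^ k / fact k * (B ^^ k) (\<lambda>_. 1) x) \<le> (t * M) ^ k / fact k" for k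
        using mult_left_mono[OF Bk[of k], of "t ^ k / fact k"] t by (simp add: abs_mult power_mult_distrib)
    qed
  qed (simp add: mult.assoc)
  finally have "(\<lambda>n. \<Sum>k. u k n) \<longlonglongrightarrow> exp (- (c * t)) * (\<Sum>k. t ^ k / fact k * (B ^^ k) (\<lambda>_. 1) x)" .
  moreover have "(\<Sum>k. u k n) = ((\<lambda>f x. (1 - t / real n * c) * f x + t / real n * B f x) ^^ n) (\<lambda>_. 1) x" for n
    unfolding euler_expansion u_def[symmetric] by (rule suminf_finite) (auto simp: u_def binomial_eq_0)
  ultimately show ?thesis by simp
qed

text \<open>
  After \<open>n\<close> steps, \<open>Q\<close> differs from the Euler scheme \<open>1 + h (B - c)\<close> by \<open>n\<close> local errors of size \<open>o(h)\<close>,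
  each amplified by at most \<open>e\<^sup>L\<^sup>t\<close>: consistency and stability imply convergence.
\<close>

lemma product_formula:
  fixes Q :: "real \<Rightarrow> ('x \<Rightarrow> real) \<Rightarrow> 'x \<Rightarrow> real"
  assumes stable: "\<And>h f C x. 0 < h \<Longrightarrow> (\<And>y. \<bar>f y\<bar> \<le> C) \<Longrightarrow> \<bar>Q h f x\<bar> \<le> exp (w * h) * C"
    and diff: "\<And>h f g C C' x. 0 < h \<Longrightarrow> (\<And>y. \<bar>f y\<bar> \<le> C) \<Longrightarrow> (\<And>y. \<bar>g y\<bar> \<le> C') \<Longrightarrow>
      Q h (\<lambda>y. f y - g y) x = Q h f x - Q h g x"
    and \<epsilon>: "(\<epsilon> \<longlongrightarrow> 0) (at_right 0)"
    and consistent: "\<forall>\<^sub>F h in at_right 0. \<forall>f C x. (\<forall>y. \<bar>f y\<bar> \<le> C) \<longrightarrow>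
      \<bar>Q h f x - f x - h * (B f x - c * f x)\<bar> \<le> h * \<epsilon> h * C"
    and t: "0 < t" and c: "0 \<le> c"
  shows "(\<lambda>n. (Q (t / real n) ^^ n) (\<lambda>_. 1) x) \<longlonglongrightarrow> exp (- (c * t)) * (\<Sum>k. t ^ k / fact k * (B ^^ k) (\<lambda>_. 1) x)"
proof -
  define T where "T h f x = (1 - h * c) * f x + h * B f x" for h f x
  \<comment> \<open>a growth rate of both schemes\<close>
  define L where "L = max w (sum a E + b + c)"
  have T_eq: "T h f x = f x + h * (B f x - c * f x)" for h f x by (simp add: T_def algebra_simps)
  have T_bound: "\<bar>T h f x\<bar> \<le> exp (L * h) * C" if h: "0 < h" and f: "\<And>y. \<bar>f y\<bar> \<le> C" for h f C x
  proof -
    have C: "0 \<le> C" using f[of x] by linarith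
    have "\<bar>B f x - c * f x\<bar> \<le> (sum a E + b) * C + c * C"
      using B_bounded[of f C x] f c by (intro order.trans[OF abs_triangle_ineq4 add_mono]) (auto simp: abs_mult intro: mult_left_mono)
    also have "\<dots> \<le> L * C" using C by (simp add: L_def mult_right_mono flip: distrib_right)
    finally have "h * \<bar>B f x - c * f x\<bar> \<le> h * (L * C)" using h by (intro mult_left_mono) auto
    then have "\<bar>T h f x\<bar> \<le> C + h * (L * C)"
      unfolding T_eq using f[of x] h by (intro order.trans[OF abs_triangle_ineq add_mono]) (auto simp: abs_mult)
    also have "\<dots> = (1 + L * h) * C" by (simp add: algebra_simps)
    also have "\<dots> \<le> exp (L * h) * C" using C by (intro mult_right_mono) auto
    finally show ?thesis .
  qed
  have Q_bound: "\<bar>Q h f x\<bar> \<le> exp (L * h) * C" if h: "0 < h" and f: "\<And>y. \<bar>f y\<bar> \<le> C" for h f C x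
  proof -
    have C: "0 \<le> C" using f[of x] by linarith
    have "exp (w * h) * C \<le> exp (L * h) * C" using C h by (intro mult_right_mono) (auto simp: L_def)
    then show ?thesis using stable[of h f C x, OF h f] by linarith
  qed
  have pow: "\<bar>(T h ^^ n) (\<lambda>_. 1) x\<bar> \<le> exp (L * h) ^ n" "\<bar>(Q h ^^ n) (\<lambda>_. 1) x\<bar> \<le> exp (L * h) ^ n" if h: "0 < h" for h n x
    by (induction n arbitrary: x) (simp_all add: T_bound[OF h] Q_bound[OF h])
  have close: "\<bar>(Q h ^^ n) (\<lambda>_. 1) x - (T h ^^ n) (\<lambda>_. 1) x\<bar> \<le> real n * (h * \<bar>\<epsilon> h\<bar>) * exp (L * h) ^ n"
    if h: "0 < h" and cons: "\<forall>f C x. (\<forall>y. \<bar>f y\<bar> \<le> C) \<longrightarrow> \<bar>Q h f x - f x - h * (B f x - c * f x)\<bar> \<le> h * \<epsilon> h * C" for h n x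
  proof (induction n arbitrary: x)
    case (Suc n)
    let ?q = "(Q h ^^ n) (\<lambda>_. 1)" and ?T = "(T h ^^ n) (\<lambda>_. 1)" and ?e = "exp (L * h)"
    have L: "1 \<le> ?e" using h b_nonneg sum_nonneg[of E a] a_nonneg c by (auto simp: L_def le_max_iff_disj)
    have "Q h ?q x - T h ?T x = Q h (\<lambda>y. ?q y - ?T y) x + (Q h ?T x - T h ?T x)"
      by (subst diff[OF h pow(2)[OF h] pow(1)[OF h]]) simp
    moreover have "\<bar>Q h (\<lambda>y. ?q y - ?T y) x\<bar> \<le> ?e * (real n * (h * \<bar>\<epsilon> h\<bar>) * ?e ^ n)"
      by (rule Q_bound[OF h Suc])
    moreover have "\<bar>Q h ?T x - T h ?T x\<bar> \<le> ?e * (h * \<bar>\<epsilon> h\<bar> * ?e ^ n)"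
    proof -
      have "\<bar>Q h ?T x - T h ?T x\<bar> \<le> h * \<epsilon> h * ?e ^ n"
        using cons[rule_format, of ?T "?e ^ n" x] pow(1)[OF h] by (simp add: T_eq algebra_simps)
      also have "\<dots> \<le> h * \<bar>\<epsilon> h\<bar> * ?e ^ n" using h by (intro mult_right_mono mult_left_mono) auto
      also have "\<dots> \<le> ?e * (h * \<bar>\<epsilon> h\<bar> * ?e ^ n)"
        using mult_right_mono[OF L, of "h * \<bar>\<epsilon> h\<bar> * ?e ^ n"] h by simp
      finally show ?thesis .
    qed
    ultimately have "\<bar>Q h ?q x - T h ?T x\<bar> \<le> ?e * (real n * (h * \<bar>\<epsilon> h\<bar>) * ?e ^ n) + ?e * (h * \<bar>\<epsilon> h\<bar> * ?e ^ n)" by linarith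
    then show ?case by (simp add: algebra_simps)
  qed simp
  have pos: "\<forall>\<^sub>F n in sequentially. 0 < t / real n"
    using eventually_gt_at_top[of 0] by eventually_elim (use t in simp)
  have small: "filterlim (\<lambda>n. t / real n) (at_right 0) sequentially"
  proof -
    have "\<forall>\<^sub>F n in sequentially. t / real n \<in> {0<..} \<and> t / real n \<noteq> 0"
      using pos by (rule eventually_mono) (use t in \<open>auto simp: zero_less_divide_iff\<close>)
    then show ?thesis unfolding filterlim_at using lim_const_over_n[of t] by blast
  qed
  have "(\<lambda>n. (Q (t / real n) ^^ n) (\<lambda>_. 1) x - (T (t / real n) ^^ n) (\<lambda>_. 1) x) \<longlonglongrightarrow> 0"
  proof (rule Lim_null_comparison)
    have "eventually (\<lambda>n. \<forall>f C x. (\<forall>y. \<bar>f y\<bar> \<le> C) \<longrightarrow>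
      \<bar>Q (t / real n) f x - f x - t / real n * (B f x - c * f x)\<bar> \<le> t / real n * \<epsilon> (t / real n) * C) sequentially"
      using eventually_compose_filterlim[OF consistent small] .
    then show "\<forall>\<^sub>F n in sequentially. norm ((Q (t / real n) ^^ n) (\<lambda>_. 1) x - (T (t / real n) ^^ n) (\<lambda>_. 1) x)
        \<le> t * \<bar>\<epsilon> (t / real n)\<bar> * exp (L * t)"
      using eventually_gt_at_top[of 0]
    proof eventually_elim
      case (elim n)
      have h: "0 < t / real n" using t elim by simp
      have "exp (L * (t / real n)) ^ n = exp (L * t)" using elim by (simp flip: exp_of_nat_mult)
      then show ?case using close[OF h elim(1), of n x] elim by simp
    qed
    have "(\<lambda>n. t * \<bar>\<epsilon> (t / real n)\<bar> * exp (L * t)) \<longlonglongrightarrow> t * \<bar>0\<bar> * exp (L * t)"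
      by (intro tendsto_intros filterlim_compose[OF \<epsilon> small])
    then show "(\<lambda>n. t * \<bar>\<epsilon> (t / real n)\<bar> * exp (L * t)) \<longlonglongrightarrow> 0" by simp
  qed
  from tendsto_add[OF this euler_limit[OF t c, of x]] show ?thesis
    by (simp add: T_def[abs_def])
qed

end

section \<open>The lattice\<close>

definition sqnorm :: "int ^ 'd \<Rightarrow> int" where "sqnorm y = (\<Sum>j\<in>UNIV. (y $ j)\<^sup>2)"

lemma lnorm_eq_sqrt: "lnorm y = sqrt (real_of_int (sqnorm y))"
  by (simp add: lnorm_def norm_vec_def L2_set_def sqnorm_def)

lemma lnorm_p_eq_sqrt: "lnorm_p x = sqrt (real_of_int (\<Sum>i\<in>UNIV. sqnorm (x $ i)))"
  by (simp add: lnorm_p_def norm_vec_def L2_set_def sqnorm_def sum_nonneg)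

lemma sqnorm_nonneg: "0 \<le> sqnorm y"
  by (simp add: sqnorm_def sum_nonneg)

lemma sqnorm_eq_0: "sqnorm y = 0 \<longleftrightarrow> y = 0"
  by (simp add: sqnorm_def sum_nonneg_eq_0_iff vec_eq_iff)

lemma units_iff: "e \<in> units \<longleftrightarrow> sqnorm e = 1"
  by (simp add: units_def lnorm_eq_sqrt)

lemma sum_eq_1_int:
  fixes f :: "'i \<Rightarrow> int"
  assumes "finite I" "\<And>i. i \<in> I \<Longrightarrow> 0 \<le> f i" "(\<Sum>i\<in>I. f i) = 1"
  obtains i where "i \<in> I" "f i = 1" "\<And>k. k \<in> I \<Longrightarrow> k \<noteq> i \<Longrightarrow> f k = 0"
proof -
  obtain i where i: "i \<in> I" "f i \<noteq> 0"
    using assms(3) by (metis sum.neutral zero_neq_one)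
  have split: "f i + (\<Sum>k\<in>I - {i}. f k) = 1" using assms i by (simp add: sum.remove)
  have rest: "0 \<le> (\<Sum>k\<in>I - {i}. f k)" by (intro sum_nonneg) (use assms in auto)
  have "0 < f i" using i assms(2)[of i] by simp
  with split rest have 1: "f i = 1" "(\<Sum>k\<in>I - {i}. f k) = 0" by linarith+
  then have "\<forall>k\<in>I - {i}. f k = 0"
    using assms by (subst (asm) sum_nonneg_eq_0_iff) auto
  with i 1 that show ?thesis by auto
qed

text \<open>
  The squared norm is a sum of nonnegative integers, one for each particle. If it is 1, exactly
  one particle moves, and by a unit vector.
\<close>

lemma lnorm_p_units:
  "{e :: int ^ 'd ^ 'p. lnorm_p e = 1} = (\<lambda>(i, u). axis i u) ` (UNIV \<times> units)"
proof (intro equalityI subsetI)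
  fix e :: "int ^ 'd ^ 'p"
  assume "e \<in> {e. lnorm_p e = 1}"
  then have "(\<Sum>i\<in>UNIV. sqnorm (e $ i)) = 1"
    unfolding mem_Collect_eq lnorm_p_eq_sqrt real_sqrt_eq_1_iff of_int_eq_1_iff .
  then obtain i where i: "sqnorm (e $ i) = 1" "\<And>k. k \<noteq> i \<Longrightarrow> sqnorm (e $ k) = 0"
    by (rule sum_eq_1_int[rotated 2]) (auto simp: sqnorm_nonneg)
  have "e = axis i (e $ i)" using i(2) by (auto simp: vec_eq_iff axis_def sqnorm_eq_0)
  then show "e \<in> (\<lambda>(i, u). axis i u) ` (UNIV \<times> units)"
    using i(1) by (intro image_eqI[where x = "(i, e $ i)"]) (auto simp: units_iff)
next
  fix e :: "int ^ 'd ^ 'p"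
  assume "e \<in> (\<lambda>(i, u). axis i u) ` (UNIV \<times> units)"
  then obtain i u where e: "e = axis i u" "sqnorm u = 1" by (auto simp: units_iff)
  have "(\<Sum>k\<in>UNIV. sqnorm (e $ k)) = (\<Sum>k\<in>UNIV. if k = i then 1 else 0)"
    by (rule sum.cong) (auto simp: e axis_def sqnorm_eq_0)
  then have "(\<Sum>k\<in>UNIV. sqnorm (e $ k)) = 1" by simp
  then show "e \<in> {e. lnorm_p e = 1}"
    unfolding mem_Collect_eq lnorm_p_eq_sqrt real_sqrt_eq_1_iff of_int_eq_1_iff .
qed

lemma axis_inj: "inj_on (\<lambda>(i :: 'p :: finite, u). axis i u) (UNIV \<times> (units :: (int ^ 'd) set))"
proof (rule inj_onI, clarify)
  fix i k :: 'p and u w :: "int ^ 'd"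
  assume "u \<in> units" "w \<in> units" and eq: "axis i u = axis k w"
  then have "u \<noteq> 0" using zero_notin_units by auto
  have "axis i u $ i = axis k w $ i" by (simp only: eq)
  with \<open>u \<noteq> 0\<close> have "i = k" by (auto simp: axis_def split: if_splits)
  with \<open>axis i u $ i = axis k w $ i\<close> show "i = k \<and> u = w" by (simp add: axis_def)
qed

lemma sum_lnorm_p_units: "(\<Sum>e | lnorm_p e = 1. F e) = (\<Sum>i\<in>UNIV. \<Sum>u\<in>units. F (axis i u))"
  unfolding lnorm_p_units
  by (subst sum.reindex[OF axis_inj]) (simp add: sum.cartesian_product case_prod_unfold o_def)

lemma card_units_le: "card (units :: (int ^ 'd) set) \<le> 2 * CARD('d)"
proof -
  have "(units :: (int ^ 'd) set) \<subseteq> (\<lambda>(j, s). axis j s) ` (UNIV \<times> {1, -1})"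
  proof
    fix e :: "int ^ 'd"
    assume "e \<in> units"
    then have "(\<Sum>j\<in>UNIV. (e $ j)\<^sup>2) = 1" by (simp add: units_iff sqnorm_def)
    then obtain j where j: "(e $ j)\<^sup>2 = 1" "\<And>k. k \<noteq> j \<Longrightarrow> (e $ k)\<^sup>2 = 0"
      by (rule sum_eq_1_int[rotated 2]) auto
    have "e = axis j (e $ j)" using j(2) by (auto simp: vec_eq_iff axis_def)
    then show "e \<in> (\<lambda>(j, s). axis j s) ` (UNIV \<times> {1, -1})"
      using j(1) by (intro image_eqI[where x = "(j, e $ j)"]) (auto simp: power2_eq_1_iff)
  qed
  then have "card (units :: (int ^ 'd) set) \<le> card ((\<lambda>(j, s). axis j s :: int ^ 'd) ` (UNIV \<times> {1, -1}))"
    by (intro card_mono) auto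
  also have "\<dots> \<le> card ((UNIV :: 'd set) \<times> {1, -1 :: int})" by (rule card_image_le) simp
  also have "\<dots> = 2 * CARD('d)" by (simp add: card_cartesian_product)
  finally show ?thesis .
qed

lemma hamilton_eq: "hamilton \<kappa> \<rho> \<gamma> f x = jump_gen \<kappa> \<rho> f x + \<gamma> * (potential x * f x)"
proof -
  have "(\<chi> i. x $ i + e) = x + diag e" for e by (simp add: vec_eq_iff diag_def)
  then show ?thesis
    by (simp add: hamilton_def op_A_def op_V_def jump_gen_def potential_def sum_lnorm_p_units units_def[symmetric]
        sum_distrib_right)
qed

lemma uminus_units: "u \<in> units \<Longrightarrow> - u \<in> units"
  by (simp add: units_def lnorm_minus)

lemma units_nonempty: "axis j 1 \<in> units" "axis j (- 1) \<in> units"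
proof -
  have "sqnorm (axis j s) = s\<^sup>2" for s
  proof -
    have "sqnorm (axis j s) = (\<Sum>k\<in>UNIV. if k = j then s\<^sup>2 else 0)"
      unfolding sqnorm_def by (rule sum.cong) (auto simp: axis_def)
    then show ?thesis by simp
  qed
  then show "axis j 1 \<in> units" "axis j (- 1) \<in> units" by (simp_all add: units_iff)
qed

text \<open>
  Any difference of two points is a sum of multiples of the standard basis vectors, which can be
  added one after the other.
\<close>

lemma lattice_connected:
  fixes S :: "(int ^ 'd ^ 'p) set"
  assumes ne: "S \<noteq> {}" and step: "\<And>x i u. x \<in> S \<Longrightarrow> u \<in> units \<Longrightarrow> x + axis i u \<in> S"
  shows "S = UNIV"
proof -
  have line: "x + axis i (axis j k) \<in> S" if x: "x \<in> S" for x i j and k :: int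
  proof -
    have add: "axis i (axis j (k + l)) = axis i (axis j k) + axis i (axis j l)" for k l :: int
      by (auto simp: vec_eq_iff axis_def)
    show ?thesis
    proof (induction k rule: int_induct[where k = 0])
      case base
      have z: "axis i (axis j 0) = (0 :: int ^ 'd ^ 'p)" by (auto simp: vec_eq_iff axis_def)
      show ?case unfolding z using x by simp
    next
      case (step1 k)
      then show ?case using step[OF step1(2) units_nonempty(1)[of j], of i] by (simp add: add add.assoc)
    next
      case (step2 k)
      then show ?case
        using step[OF step2(2) units_nonempty(2)[of j], of i] add[of k "- 1"] by (simp add: add.assoc)
    qed
  qed
  obtain x\<^sub>0 where x0: "x\<^sub>0 \<in> S" using ne by auto
  have "y \<in> S" for y
  proof -
    let ?z = "y - x\<^sub>0"
    have "x\<^sub>0 + (\<Sum>(i, j)\<in>A. axis i (axis j (?z $ i $ j))) \<in> S" if "finite A" for A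
      using that
    proof induction
      case (insert a A)
      obtain i j where a: "a = (i, j)" by (cases a)
      show ?case using line[OF insert.IH, of i j "?z $ i $ j"] insert.hyps by (simp add: a add_ac)
    qed (use x0 in simp)
    from this[of UNIV] have "x\<^sub>0 + (\<Sum>(i, j)\<in>UNIV. axis i (axis j (?z $ i $ j))) \<in> S" by simp
    moreover have "(\<Sum>(i, j)\<in>UNIV. axis i (axis j (?z $ i $ j))) = ?z"
    proof -
      have "(\<Sum>(i, j)\<in>UNIV. axis i (axis j (?z $ i $ j))) $ k $ l = ?z $ k $ l" for k l
      proof -
        have "(\<Sum>(i, j)\<in>UNIV. axis i (axis j (?z $ i $ j))) $ k $ l
            = (\<Sum>p\<in>UNIV. if p = (k, l) then ?z $ k $ l else 0)"
          unfolding sum_component by (rule sum.cong) (auto simp: axis_def split: if_splits)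
        then show ?thesis by simp
      qed
      then show ?thesis by (simp only: vec_eq_iff) blast
    qed
    ultimately show ?thesis by simp
  qed
  then show ?thesis by auto
qed

definition steps :: "(int ^ 'd ^ 'p) set" where
  "steps = (\<lambda>(i, u). axis i u) ` (UNIV \<times> units) \<union> diag ` units"

text \<open>
  If \<open>p = 1\<close>, the diagonal steps are steps of the single particle. The two sets of steps then
  coincide, and the rates add up.
\<close>

definition rate :: "real \<Rightarrow> real \<Rightarrow> int ^ 'd ^ 'p \<Rightarrow> real" where
  "rate \<kappa> \<rho> e = \<kappa> * of_bool (e \<in> (\<lambda>(i, u). axis i u) ` (UNIV \<times> units)) + \<rho> * of_bool (e \<in> diag ` units)"

lemma diag_inj: "inj (diag :: int ^ 'd \<Rightarrow> int ^ 'd ^ 'p)"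
  by (rule injI) (simp add: diag_def vec_eq_iff)

lemma finite_steps: "finite steps"
  by (simp add: steps_def finite_units)

lemma sum_steps:
  "(\<Sum>e\<in>steps. rate \<kappa> \<rho> e * F e) = \<kappa> * (\<Sum>i\<in>UNIV. \<Sum>u\<in>units. F (axis i u)) + \<rho> * (\<Sum>u\<in>units. F (diag u))"
proof -
  let ?A = "(\<lambda>(i, u). axis i u) ` (UNIV \<times> units) :: (int ^ 'a ^ 'b) set" and ?D = "diag ` units :: (int ^ 'a ^ 'b) set"
  have "(\<Sum>e\<in>steps. rate \<kappa> \<rho> e * F e) = \<kappa> * (\<Sum>e\<in>steps. if e \<in> ?A then F e else 0) + \<rho> * (\<Sum>e\<in>steps. if e \<in> ?D then F e else 0)"
    unfolding sum_distrib_left sum.distrib[symmetric] by (rule sum.cong) (auto simp: rate_def distrib_right)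
  also have "(\<Sum>e\<in>steps. if e \<in> ?A then F e else 0) = sum F ?A"
    unfolding sum.inter_restrict[OF finite_steps, symmetric] by (rule sum.cong) (auto simp: steps_def)
  also have "(\<Sum>e\<in>steps. if e \<in> ?D then F e else 0) = sum F ?D"
    unfolding sum.inter_restrict[OF finite_steps, symmetric] by (rule sum.cong) (auto simp: steps_def)
  also have "sum F ?A = (\<Sum>i\<in>UNIV. \<Sum>u\<in>units. F (axis i u))"
    by (subst sum.reindex[OF axis_inj]) (simp add: sum.cartesian_product case_prod_unfold o_def)
  also have "sum F ?D = (\<Sum>u\<in>units. F (diag u))"
    by (subst sum.reindex) (auto intro: inj_on_subset[OF diag_inj])
  finally show ?thesis .
qed

text \<open>
  The total jump rate, which is the diagonal entry of \<^const>\<open>op_A\<close> with its sign reversed. The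
  dimensions exist only as types, so they are passed as type arguments.
\<close>

definition exit_rate :: "real \<Rightarrow> real \<Rightarrow> 'p :: finite itself \<Rightarrow> 'd :: finite itself \<Rightarrow> real" where
  "exit_rate \<kappa> \<rho> _ _ = real (card (units :: (int ^ 'd) set)) * (\<kappa> * real CARD('p) + \<rho>)"

lemma hamilton_hop:
  fixes f :: "int ^ 'd ^ 'p \<Rightarrow> real"
  shows "hamilton \<kappa> \<rho> \<gamma> f = (\<lambda>x. hop steps (rate \<kappa> \<rho>)
    (\<lambda>x. c - exit_rate \<kappa> \<rho> TYPE('p) TYPE('d) + \<gamma> * potential x) f x - c * f x)"
proof
  fix x
  have "jump_gen \<kappa> \<rho> f x = \<kappa> * (\<Sum>i\<in>UNIV. \<Sum>u\<in>units. f (x + axis i u)) + \<rho> * (\<Sum>u\<in>units. f (x + diag u))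
      - exit_rate \<kappa> \<rho> TYPE('p) TYPE('d) * f x"
    by (simp add: jump_gen_def exit_rate_def sum_subtractf algebra_simps)
  then show "hamilton \<kappa> \<rho> \<gamma> f x = hop steps (rate \<kappa> \<rho>)
    (\<lambda>x. c - exit_rate \<kappa> \<rho> TYPE('p) TYPE('d) + \<gamma> * potential x) f x - c * f x"
    unfolding hamilton_eq hop_def sum_steps[of \<kappa> \<rho> "\<lambda>e. f (x + e)"] by (simp add: algebra_simps)
qed

lemma sum_rate: "sum (rate \<kappa> \<rho> :: int ^ 'd ^ 'p \<Rightarrow> real) steps = exit_rate \<kappa> \<rho> TYPE('p) TYPE('d)"
  using sum_steps[of \<kappa> \<rho> "\<lambda>_ :: int ^ 'd ^ 'p. 1"] by (simp add: exit_rate_def algebra_simps)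

lemma axis_uminus: "axis i (- u) = - axis i (u :: 'a :: group_add)"
  by (auto simp: vec_eq_iff axis_def)

lemma diag_uminus: "diag (- u) = - diag u"
  by (auto simp: vec_eq_iff diag_def)

lemma closed_uminus_iff:
  fixes A :: "'a :: group_add set"
  shows "(\<And>e. e \<in> A \<Longrightarrow> - e \<in> A) \<Longrightarrow> - e \<in> A \<longleftrightarrow> e \<in> A"
  by (metis minus_minus)

lemma neg_axis_units: "- e \<in> (\<lambda>(i, u). axis i u) ` (UNIV \<times> units) \<longleftrightarrow> e \<in> (\<lambda>(i, u). axis i u) ` (UNIV \<times> units)"
proof -
  have "- e \<in> (\<lambda>(i, u). axis i u) ` (UNIV \<times> units)" if "e \<in> (\<lambda>(i, u). axis i u) ` (UNIV \<times> units)" for e :: "int ^ 'a ^ 'b"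
    using that by (force simp: axis_uminus[symmetric] intro: uminus_units)
  then show ?thesis by (rule closed_uminus_iff)
qed

lemma neg_diag_units: "- e \<in> diag ` units \<longleftrightarrow> e \<in> diag ` units"
proof -
  have "- e \<in> diag ` units" if "e \<in> diag ` units" for e :: "int ^ 'a ^ 'b"
    using that by (force simp: diag_uminus[symmetric] intro: uminus_units)
  then show ?thesis by (rule closed_uminus_iff)
qed

text \<open>
  The diagonal is at least \<open>c\<close> minus the exit rate, and the hopping rates add up to the exit rate: hence
  the factor 2.
\<close>

lemma hamilton_positive_hopping:
  assumes "0 < \<kappa>" "0 < \<rho>" "0 \<le> \<gamma>" and c: "2 * exit_rate \<kappa> \<rho> TYPE('p) TYPE('d) < c"
  shows "positive_hopping (steps :: (int ^ 'd ^ 'p) set) (rate \<kappa> \<rho>)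
    (\<lambda>x. c - exit_rate \<kappa> \<rho> TYPE('p) TYPE('d) + \<gamma> * potential x) (c + \<gamma> * real CARD('p))"
proof -
  have pot: "0 \<le> \<gamma> * potential x" "\<gamma> * potential x \<le> \<gamma> * real CARD('p)" for x :: "int ^ 'd ^ 'p"
    using potential_bounds[of x] assms(3) by (auto intro: mult_left_mono)
  have ex: "0 \<le> exit_rate \<kappa> \<rho> TYPE('p) TYPE('d)" using assms by (simp add: exit_rate_def)
  show ?thesis
  proof
    show "finite (steps :: (int ^ 'd ^ 'p) set)" by (rule finite_steps)
    show "- e \<in> steps" if "e \<in> steps" for e :: "int ^ 'd ^ 'p"
      using that by (auto simp: steps_def neg_axis_units neg_diag_units simp del: image_iff)
    show "rate \<kappa> \<rho> (- e) = rate \<kappa> \<rho> e" for e :: "int ^ 'd ^ 'p"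
      by (simp add: rate_def neg_axis_units neg_diag_units)
    show "0 < rate \<kappa> \<rho> e" if "e \<in> steps" for e :: "int ^ 'd ^ 'p"
      using that assms by (auto simp: rate_def steps_def add_pos_nonneg add_nonneg_pos simp del: image_iff)
    show "0 \<le> c - exit_rate \<kappa> \<rho> TYPE('p) TYPE('d) + \<gamma> * potential x" for x :: "int ^ 'd ^ 'p"
      using pot[of x] c ex by linarith
    show "c - exit_rate \<kappa> \<rho> TYPE('p) TYPE('d) + \<gamma> * potential x \<le> c + \<gamma> * real CARD('p)" for x :: "int ^ 'd ^ 'p"
      using pot[of x] ex by linarith
    show "sum (rate \<kappa> \<rho>) (steps :: (int ^ 'd ^ 'p) set) < c - exit_rate \<kappa> \<rho> TYPE('p) TYPE('d) + \<gamma> * potential x" for x :: "int ^ 'd ^ 'p"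
      using pot[of x] c by (simp add: sum_rate)
  qed
qed

text \<open>
  Gives lower bounds of the top of the spectrum from test functions.
\<close>

lemma rayleigh_hamilton:
  fixes f :: "int ^ 'd ^ 'p \<Rightarrow> real"
  assumes "0 < \<kappa>" "0 < \<rho>" "0 \<le> \<gamma>" and f: "f \<in> ell2"
  shows "ip f (hamilton \<kappa> \<rho> \<gamma> f) \<le> Sup (l2_spectrum (hamilton \<kappa> \<rho> \<gamma> :: (int ^ 'd ^ 'p \<Rightarrow> real) \<Rightarrow> _)) * ip f f"
proof -
  define c where "c = 2 * exit_rate \<kappa> \<rho> TYPE('p) TYPE('d) + 1"
  define \<beta> where "\<beta> = (\<lambda>x :: int ^ 'd ^ 'p. c - exit_rate \<kappa> \<rho> TYPE('p) TYPE('d) + \<gamma> * potential x)"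
  interpret H: positive_hopping "steps :: (int ^ 'd ^ 'p) set" "rate \<kappa> \<rho>" \<beta> "c + \<gamma> * real CARD('p)"
    unfolding \<beta>_def by (rule hamilton_positive_hopping) (use assms in \<open>auto simp: c_def\<close>)
  have ham: "hamilton \<kappa> \<rho> \<gamma> = (\<lambda>(f :: int ^ 'd ^ 'p \<Rightarrow> real) x. H.B f x - c * f x)"
    by (rule ext) (simp only: hamilton_hop[of _ _ _ _ c] \<beta>_def)
  show ?thesis
    using H.rayleigh_le[OF f]
    by (simp add: ham H.Sup_spectrum ip_diff_right[OF f H.B_ell2[OF f] ell2_cmult[OF f]] ip_cmult_right left_diff_distrib)
qed

section \<open>Moment asymptotics from a supersolution\<close>

text \<open>
  The moment on a grid with \<open>n\<close> cells is the \<open>n\<close>-th power of a one-step operator applied to 1. This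
  one-step operator satisfies the hypotheses of the product formula, whose limit is \<open>e\<^sup>t\<^sup>H 1\<close> written as
  a power series in \<open>H + c\<close>.
\<close>

lemma moment_formula:
  fixes X :: "real \<Rightarrow> 'a \<Rightarrow> int ^ 'd" and Y :: "real \<Rightarrow> 'b \<Rightarrow> int ^ 'd" and x :: "int ^ 'd ^ 'p"
  assumes "0 < \<kappa>" "0 < \<rho>" "0 \<le> \<gamma>" and X: "random_walk N \<kappa> X" and Y: "random_walk M \<rho> Y" and t: "0 < t"
    and c: "2 * exit_rate \<kappa> \<rho> TYPE('p) TYPE('d) < c"
  shows "mixed_moment N X M Y \<gamma> x t = exp (- (c * t)) * (\<Sum>k. t ^ k / fact k *
    ((hop steps (rate \<kappa> \<rho>) (\<lambda>x. c - exit_rate \<kappa> \<rho> TYPE('p) TYPE('d) + \<gamma> * potential x)) ^^ k) (\<lambda>_. 1) x)"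
proof -
  define \<beta> where "\<beta> = (\<lambda>x :: int ^ 'd ^ 'p. c - exit_rate \<kappa> \<rho> TYPE('p) TYPE('d) + \<gamma> * potential x)"
  interpret H: positive_hopping "steps :: (int ^ 'd ^ 'p) set" "rate \<kappa> \<rho>" \<beta> "c + \<gamma> * real CARD('p)"
    unfolding \<beta>_def by (rule hamilton_positive_hopping) (use assms in auto)
  define Q where "Q h = (step_op (step_law N X h) (step_law M Y h) (\<gamma> * h) :: (int ^ 'd ^ 'p \<Rightarrow> real) \<Rightarrow> _)" for h
  have c0: "0 \<le> c" using c assms(1,2) by (auto simp: exit_rate_def intro: order.trans[OF _ less_imp_le[OF c]])
  obtain \<epsilon> where \<epsilon>: "(\<epsilon> \<longlongrightarrow> 0) (at_right 0)" and cons: "\<forall>\<^sub>F h in at_right 0. \<forall>f C. \<forall>x :: int ^ 'd ^ 'p. (\<forall>y. \<bar>f y\<bar> \<le> C) \<longrightarrow>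
     \<bar>Q h f x - f x - h * (jump_gen \<kappa> \<rho> f x + \<gamma> * potential x * f x)\<bar> \<le> h * \<epsilon> h * C"
    using step_op_first_order[where 'p = 'p, OF random_walk.step_law_stay[OF X] random_walk.step_law_stay[OF Y]
        random_walk.step_law_unit[OF X] random_walk.step_law_unit[OF Y]] assms(1-3)
    unfolding Q_def by (auto simp: less_imp_le)
  have gen: "jump_gen \<kappa> \<rho> f x + \<gamma> * potential x * f x = H.B f x - c * f x" for f x
    using hamilton_hop[of \<kappa> \<rho> \<gamma> f c] by (simp add: hamilton_eq fun_eq_iff \<beta>_def mult.assoc)
  have "(\<lambda>n. (Q (t / real n) ^^ n) (\<lambda>_. 1) x) \<longlonglongrightarrow> exp (- (c * t)) * (\<Sum>k. t ^ k / fact k * (H.B ^^ k) (\<lambda>_. 1) x)"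
  proof (rule H.product_formula[where w = "\<gamma> * real CARD('p)", OF _ _ \<epsilon> _ t c0])
    show "\<bar>Q h f x\<bar> \<le> exp (\<gamma> * real CARD('p) * h) * C" if "0 < h" "\<And>y. \<bar>f y\<bar> \<le> C" for h f C x
      using step_op_bounded(2)[of f C "\<gamma> * h" "step_law N X h" "step_law M Y h" x] that assms(3)
      by (simp add: Q_def mult_ac)
    show "Q h (\<lambda>y. f y - g y) x = Q h f x - Q h g x"
      if "0 < h" "\<And>y. \<bar>f y\<bar> \<le> C" "\<And>y. \<bar>g y\<bar> \<le> C'" for h f g C C' x
      unfolding Q_def by (rule step_op_diff) (use that assms(3) in auto)
    show "\<forall>\<^sub>F h in at_right 0. \<forall>f C x. (\<forall>y. \<bar>f y\<bar> \<le> C) \<longrightarrow> \<bar>Q h f x - f x - h * (H.B f x - c * f x)\<bar> \<le> h * \<epsilon> h * C"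
      using cons unfolding gen .
  qed
  moreover have "(\<lambda>n. (Q (t / real n) ^^ n) (\<lambda>_. 1) x) \<longlonglongrightarrow> mixed_moment N X M Y \<gamma> x t"
    using mixed_moment_limit[OF X Y t assms(3), of x] t assms(3)
    by (simp add: Q_def moment_step_eq_funpow)
  ultimately show ?thesis unfolding \<beta>_def by (rule LIMSEQ_unique[symmetric])
qed

text \<open>
  The supersolution provides the ground state. By \<open>moment_formula\<close>, the moment divided by \<open>e\<^sup>\<lambda>\<^sup>t\<close> is a
  Poisson average of the normalised powers of \<open>H + c\<close> applied to 1, and these converge.
\<close>

lemma moment_asymptotics:
  fixes X :: "real \<Rightarrow> 'a \<Rightarrow> int ^ 'd" and Y :: "real \<Rightarrow> 'b \<Rightarrow> int ^ 'd" and h W :: "int ^ 'd ^ 'p \<Rightarrow> real"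
  assumes "0 < \<kappa>" "0 < \<rho>" "0 < \<gamma>" and X: "random_walk N \<kappa> X" and Y: "random_walk M \<rho> Y"
    and lam: "lam = Sup (l2_spectrum (hamilton \<kappa> \<rho> \<gamma> :: (int ^ 'd ^ 'p \<Rightarrow> real) \<Rightarrow> _))"
    and F: "finite F" and W: "\<And>x. 0 \<le> W x" "\<And>x. x \<notin> F \<Longrightarrow> W x = 0" "\<And>x. W x \<le> w"
    and h: "\<And>x. 1 \<le> h x" "\<And>x. h x \<le> C"
    and super: "\<And>x. hamilton \<kappa> \<rho> \<gamma> h x - W x * h x \<le> s * h x" and "s < lam"
  shows "\<exists>v :: int ^ 'd ^ 'p \<Rightarrow> real.
      (\<forall>x. v x > 0) \<and> v summable_on UNIV \<and> v \<in> ell2 \<and>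
      hamilton \<kappa> \<rho> \<gamma> v = (\<lambda>x. lam * v x) \<and> l2_norm v = 1 \<and>
      (\<forall>x. asymp_equiv (mixed_moment N X M Y \<gamma> x) at_top
             (\<lambda>t. exp (lam * t) * v x * l1_norm v))"
proof -
  define \<sigma> where "\<sigma> = exit_rate \<kappa> \<rho> TYPE('p) TYPE('d)"
  \<comment> \<open>\<open>c > 2 \<sigma>\<close> gives diagonal dominance, and \<open>c \<ge> \<sigma> + w\<close> keeps the diagonal nonnegative after
    the removal of \<open>W\<close>\<close>
  define c where "c = 2 * \<sigma> + w + 1"
  have \<sigma>: "0 \<le> \<sigma>" using assms(1,2) by (simp add: \<sigma>_def exit_rate_def)
  have w: "0 \<le> w" using W(1)[of 0] W(3)[of 0] by linarith
  have c: "2 * \<sigma> < c" "\<sigma> + w \<le> c" using \<sigma> w by (simp_all add: c_def)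
  define \<beta> where "\<beta> = (\<lambda>x :: int ^ 'd ^ 'p. c - \<sigma> + \<gamma> * potential x)"
  interpret H: positive_hopping "steps :: (int ^ 'd ^ 'p) set" "rate \<kappa> \<rho>" \<beta> "c + \<gamma> * real CARD('p)"
    unfolding \<beta>_def \<sigma>_def by (rule hamilton_positive_hopping) (use assms c \<sigma>_def in auto)
  have ham: "hamilton \<kappa> \<rho> \<gamma> = (\<lambda>(f :: int ^ 'd ^ 'p \<Rightarrow> real) x. H.B f x - c * f x)"
    by (rule ext) (simp only: hamilton_hop[of _ _ _ _ c] \<beta>_def \<sigma>_def)
  have K: "H.K = lam + c" unfolding lam ham H.Sup_spectrum by simp
  have connected: "S = UNIV" if "S \<noteq> {}" "\<And>x e. x \<in> S \<Longrightarrow> e \<in> steps \<Longrightarrow> x + e \<in> S" for S :: "(int ^ 'd ^ 'p) set"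
    by (rule lattice_connected[OF that(1)]) (use that(2) in \<open>auto simp: steps_def\<close>)
  have "\<exists>v. (\<forall>x. 0 < v x) \<and> v summable_on UNIV \<and> ip v v = 1 \<and> H.B v = (\<lambda>x. H.K * v x)"
  proof (rule H.ground_state[OF connected F W(1,2) _ h, where s = "s + c"])
    show "W x \<le> \<beta> x" for x
    proof -
      have "0 \<le> \<gamma> * potential x" using potential_bounds(1)[of x] assms(3) by simp
      then show ?thesis using W(3)[of x] c(2) by (simp add: \<beta>_def)
    qed
    show "H.B h x - W x * h x \<le> (s + c) * h x" for x
      using super[of x] by (simp add: ham algebra_simps)
    show "s + c < H.K" using \<open>s < lam\<close> K by simp
  qed
  then obtain v where v: "\<And>x. 0 < v x" "v summable_on UNIV" "ip v v = 1" "H.B v = (\<lambda>x. H.K * v x)"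
    by blast
  have mass: "l1_norm v = infsum v UNIV" using v(1) by (simp add: l1_norm_def abs_of_pos)
  have mass_pos: "0 < infsum v UNIV"
    by (rule less_le_trans[OF v(1)[of 0] summable_bounded[OF v(2) less_imp_le[OF v(1)], of 0]])
  have "asymp_equiv (mixed_moment N X M Y \<gamma> x) at_top (\<lambda>t. exp (lam * t) * v x * l1_norm v)" for x
  proof (rule asymp_equivI')
    define u where "u n = (H.B ^^ n) (\<lambda>_. 1) x / H.K ^ n" for n
    define L where "L = v x * infsum v UNIV"
    have L: "L \<noteq> 0" using v(1)[of x] mass_pos by (simp add: L_def)
    have "u \<longlonglongrightarrow> L" unfolding u_def L_def by (rule H.power_convergence[OF connected v])
    then have "((\<lambda>s. exp (- s) * (\<Sum>k. s ^ k / fact k * u k)) \<longlongrightarrow> L) at_top" by (rule poisson_average)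
    moreover have "filterlim (\<lambda>t. H.K * t) at_top at_top"
      by (rule filterlim_tendsto_pos_mult_at_top[OF tendsto_const H.K_pos filterlim_ident])
    ultimately have "((\<lambda>t. exp (- (H.K * t)) * (\<Sum>k. (H.K * t) ^ k / fact k * u k)) \<longlongrightarrow> L) at_top"
      by (rule filterlim_compose)
    then have "((\<lambda>t. exp (- (H.K * t)) * (\<Sum>k. (H.K * t) ^ k / fact k * u k) / L) \<longlongrightarrow> L / L) at_top"
      by (intro tendsto_divide tendsto_const L)
    moreover have "eventually (\<lambda>t. exp (- (H.K * t)) * (\<Sum>k. (H.K * t) ^ k / fact k * u k) / L =
        mixed_moment N X M Y \<gamma> x t / (exp (lam * t) * v x * l1_norm v)) at_top"
      using eventually_gt_at_top[of 0]
    proof eventually_elim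
      case (elim t)
      have "mixed_moment N X M Y \<gamma> x t = exp (- (c * t)) * (\<Sum>k. t ^ k / fact k * (H.B ^^ k) (\<lambda>_. 1) x)"
        unfolding \<beta>_def \<sigma>_def
        by (rule moment_formula[OF _ _ _ X Y elim]) (use assms(1-3) c(1) \<sigma>_def in auto)
      also have "(\<lambda>k. t ^ k / fact k * (H.B ^^ k) (\<lambda>_. 1) x) = (\<lambda>k. (H.K * t) ^ k / fact k * u k)"
        using H.K_pos by (simp add: u_def power_mult_distrib)
      also have "exp (- (c * t)) = exp (lam * t) * exp (- (H.K * t))"
        by (simp add: K exp_add[symmetric] algebra_simps)
      finally have "mixed_moment N X M Y \<gamma> x t = exp (lam * t) * (exp (- (H.K * t)) * (\<Sum>k. (H.K * t) ^ k / fact k * u k))"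
        by (simp only: mult.assoc)
      then show ?case by (simp add: L_def mass)
    qed
    ultimately show "((\<lambda>t. mixed_moment N X M Y \<gamma> x t / (exp (lam * t) * v x * l1_norm v)) \<longlongrightarrow> 1) at_top"
      using L by (auto dest: Lim_transform_eventually)
  qed
  moreover have "v \<in> ell2" by (rule summable_imp_ell2) (use v in \<open>auto simp: less_imp_le\<close>)
  moreover have "hamilton \<kappa> \<rho> \<gamma> v = (\<lambda>x. lam * v x)"
    using v(4) by (simp add: ham K algebra_simps)
  moreover have "l2_norm v = 1" using v(3) by (simp add: l2_norm_eq)
  ultimately show ?thesis using v(1,2) by blast
qed

section \<open>Supersolutions\<close>

text \<open>
  Away from the origin not all particles meet the catalyst, so the potential is
  at most \<open>(p - 1) \<gamma>\<close>: the constants are a supersolution.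
\<close>

lemma constant_supersolution:
  fixes x :: "int ^ 'd ^ 'p"
  assumes "0 \<le> \<gamma>"
  shows "hamilton \<kappa> \<rho> \<gamma> (\<lambda>_. 1) x - \<gamma> * indicator {0} x * 1 \<le> \<gamma> * (real CARD('p) - 1) * 1"
proof -
  have "potential x \<le> real CARD('p) - 1 + indicator {0} x"
  proof (cases "x = 0")
    case True
    then show ?thesis using potential_bounds(2)[of x] by simp
  next
    case False
    then obtain i where i: "x $ i \<noteq> 0" by (auto simp: vec_eq_iff)
    have "potential x = (\<Sum>k\<in>UNIV - {i}. of_bool (x $ k = 0))"
      unfolding potential_def using i by (subst sum.remove[of _ i]) auto
    also have "\<dots> \<le> (\<Sum>k\<in>UNIV - {i}. 1)" by (intro sum_mono) auto
    finally show ?thesis using False by (simp add: of_nat_diff Suc_le_eq)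
  qed
  then have "\<gamma> * potential x \<le> \<gamma> * (real CARD('p) - 1 + indicator {0} x)"
    using assms by (rule mult_left_mono)
  then show ?thesis by (simp add: hamilton_eq jump_gen_def algebra_simps)
qed

text \<open>
  The test function is the indicator of the origin, whose Rayleigh quotient is the diagonal entry.
\<close>

lemma lam_ge_diagonal:
  assumes "0 < \<kappa>" "0 < \<rho>" "0 \<le> \<gamma>"
  shows "\<gamma> * real CARD('p) - exit_rate \<kappa> \<rho> TYPE('p) TYPE('d)
    \<le> Sup (l2_spectrum (hamilton \<kappa> \<rho> \<gamma> :: (int ^ 'd ^ 'p \<Rightarrow> real) \<Rightarrow> _))"
proof -
  let ?f = "indicator {0} :: int ^ 'd ^ 'p \<Rightarrow> real"
  have nz: "axis i u \<noteq> (0 :: int ^ 'd ^ 'p)" "diag u \<noteq> (0 :: int ^ 'd ^ 'p)" if "u \<in> units" for i :: 'p and u :: "int ^ 'd"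
  proof -
    have "u \<noteq> 0" using that zero_notin_units by metis
    then show "axis i u \<noteq> (0 :: int ^ 'd ^ 'p)" "diag u \<noteq> (0 :: int ^ 'd ^ 'p)"
      by (simp_all add: axis_eq_0_iff diag_def) (simp add: vec_eq_iff)
  qed
  have "(\<Sum>i\<in>(UNIV :: 'p set). \<Sum>e\<in>units. ?f (0 + axis i e) - ?f 0) = (\<Sum>i\<in>(UNIV :: 'p set). \<Sum>e\<in>(units :: (int ^ 'd) set). - 1)"
    by (intro sum.cong refl) (use nz in auto)
  moreover have "(\<Sum>e\<in>units. ?f (0 + diag e) - ?f 0) = (\<Sum>e\<in>(units :: (int ^ 'd) set). - 1)"
    by (intro sum.cong refl) (use nz in auto)
  ultimately have "jump_gen \<kappa> \<rho> ?f 0 = - exit_rate \<kappa> \<rho> TYPE('p) TYPE('d)"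
    unfolding jump_gen_def by (simp only:) (simp add: exit_rate_def algebra_simps)
  then have "ip ?f (hamilton \<kappa> \<rho> \<gamma> ?f) = \<gamma> * real CARD('p) - exit_rate \<kappa> \<rho> TYPE('p) TYPE('d)"
    by (simp add: ip_indicator hamilton_eq potential_def)
  moreover have "ip ?f ?f = 1" by (simp add: ip_indicator)
  ultimately show ?thesis using rayleigh_hamilton[where f = ?f, OF assms indicator_ell2] by simp
qed

section \<open>Two particles\<close>

lemma has_sum_diff_real:
  fixes f g :: "'a \<Rightarrow> real"
  shows "(f has_sum s) A \<Longrightarrow> (g has_sum t) A \<Longrightarrow> ((\<lambda>x. f x - g x) has_sum (s - t)) A"
  using has_sum_add[of f A s "\<lambda>x. - g x" "- t"] by (simp add: has_sum_uminus)

lemma has_sum_finite_sum: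
  fixes f :: "'i \<Rightarrow> 'a \<Rightarrow> real"
  shows "(\<And>i. i \<in> I \<Longrightarrow> (f i has_sum s i) A) \<Longrightarrow> ((\<lambda>x. \<Sum>i\<in>I. f i x) has_sum (\<Sum>i\<in>I. s i)) A"
  by (induction I rule: infinite_finite_induct) (auto intro: has_sum_add)

lemma has_sum_product:
  fixes f :: "'a \<Rightarrow> real" and g :: "'b \<Rightarrow> real"
  assumes f: "f summable_on UNIV" and g: "g summable_on UNIV"
  shows "((\<lambda>(x, y). f x * g y) has_sum infsum f UNIV * infsum g UNIV) UNIV"
proof -
  have "(\<lambda>x. norm (infsum (\<lambda>y. norm (f x * g y)) UNIV)) summable_on UNIV"
  proof -
    have "(\<lambda>x. \<bar>f x\<bar> * infsum (\<lambda>y. \<bar>g y\<bar>) UNIV) summable_on UNIV"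
      by (intro summable_on_cmult_left summable_on_abs f)
    then have "(\<lambda>x. \<bar>\<bar>f x\<bar> * infsum (\<lambda>y. \<bar>g y\<bar>) UNIV\<bar>) summable_on UNIV" by (rule summable_on_abs)
    then show ?thesis by (simp add: abs_mult infsum_cmult_right')
  qed
  moreover have "(\<lambda>y. norm (f x * g y)) summable_on UNIV" for x
    using summable_on_abs[OF summable_on_cmult_right[OF g, of "f x"]] by simp
  ultimately have "(\<lambda>p. norm (case p of (x, y) \<Rightarrow> f x * g y)) summable_on UNIV \<times> UNIV"
    by (subst Infinite_Sum.abs_summable_on_Sigma_iff) auto
  then have "(\<lambda>(x, y). f x * g y) summable_on UNIV \<times> UNIV" by (rule abs_summable_summable)
  then have "((\<lambda>(x, y). f x * g y) has_sum infsum f UNIV * infsum g UNIV) (UNIV \<times> UNIV)"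
    by (rule has_sum_SigmaI[rotated 2, where g = "\<lambda>x. f x * infsum g UNIV"])
       (auto intro!: has_sum_cmult_right has_sum_cmult_left has_sum_infsum f g)
  then show ?thesis by simp
qed

context
  fixes i j :: "'p :: finite"
  assumes ij: "i \<noteq> j" "UNIV = {i, j}"
begin

lemma has_sum_two_particles:
  fixes f g :: "int ^ 'd \<Rightarrow> real"
  assumes f: "f summable_on UNIV" and g: "g summable_on UNIV"
  shows "((\<lambda>x :: int ^ 'd ^ 'p. f (x $ i) * g (x $ j)) has_sum infsum f UNIV * infsum g UNIV) UNIV"
proof -
  have bij: "bij_betw (\<lambda>x :: int ^ 'd ^ 'p. (x $ i, x $ j)) UNIV UNIV"
  proof (rule bij_betwI[where g = "\<lambda>(y, z). \<chi> k. if k = i then y else z"])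
    show "(case (x $ i, x $ j) of (y, z) \<Rightarrow> \<chi> k. if k = i then y else z) = x" for x :: "int ^ 'd ^ 'p"
      using ij(2) by (auto simp: vec_eq_iff)
  qed (use ij(1) in auto)
  have "((\<lambda>p. (\<lambda>(x, y). f x * g y) p) has_sum infsum f UNIV * infsum g UNIV) UNIV"
    using has_sum_product[OF f g] by simp
  then show ?thesis
    using has_sum_reindex_bij_betw[OF bij, of "\<lambda>(x, y). f x * g y"] by simp
qed

lemma sum_two: "(\<Sum>k\<in>UNIV. F k) = F i + (F j :: real)"
  by (subst ij(2)) (use ij(1) in simp)

text \<open>
  Relative to the catalyst, a single particle jumps at rate \<open>\<kappa> + \<rho>\<close>: its own jumps and those of the
  catalyst.
\<close>

lemma jump_gen_one_particle:
  fixes G :: "int ^ 'd \<Rightarrow> real" and x :: "int ^ 'd ^ 'p"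
  assumes k: "k = i \<or> k = j"
  shows "jump_gen \<kappa> \<rho> (\<lambda>x. G (x $ k)) x = (\<kappa> + \<rho>) * (\<Sum>u\<in>units. G (x $ k + u) - G (x $ k))"
proof -
  have "(\<Sum>l\<in>UNIV. \<Sum>u\<in>units. G ((x + axis l u) $ k) - G (x $ k)) = (\<Sum>u\<in>units. G (x $ k + u) - G (x $ k))"
    unfolding sum_two using k ij(1) by (auto simp: axis_def)
  then show ?thesis by (simp add: jump_gen_def diag_def distrib_right)
qed

lemma potential_two: "potential (x :: int ^ 'd ^ 'p) = of_bool (x $ i = 0) + of_bool (x $ j = 0)"
  unfolding potential_def sum_two ..

text \<open>
  The Rayleigh quotient of \<open>G \<otimes> G\<close> is at least twice the one of \<open>G\<close>: the two particles
  share the jumps of the catalyst, and \<open>c\<^sup>2 - n\<^sup>2 \<ge> 2 n (c - n)\<close> for the correlations \<open>c\<close> of \<open>G\<close>.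
\<close>

lemma tensor_rayleigh:
  fixes G :: "int ^ 'd \<Rightarrow> real"
  assumes pos: "0 < \<kappa>" "0 < \<rho>" "0 < \<gamma>" and G: "G \<in> ell2"
  defines "n \<equiv> ip G G"
  shows "2 * n * ((\<kappa> + \<rho>) * (\<Sum>u\<in>units. ip G (\<lambda>x. G (x + u)) - n) + \<gamma> * (G 0)\<^sup>2)
    \<le> Sup (l2_spectrum (hamilton \<kappa> \<rho> \<gamma> :: (int ^ 'd ^ 'p \<Rightarrow> real) \<Rightarrow> _)) * n\<^sup>2"
proof -
  let ?f = "\<lambda>x :: int ^ 'd ^ 'p. G (x $ i) * G (x $ j)"
  define c where "c u = ip G (\<lambda>x. G (x + u))" for u
  have sG: "(\<lambda>x. G x * G (x + u)) summable_on UNIV" for u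
    by (intro ell2_mult_summable ell2_shift G)
  have s0: "(\<lambda>x. G x * G x) summable_on UNIV" using sG[of 0] by simp
  have \<delta>: "(\<lambda>x. of_bool (x = 0) * (G x * G x)) summable_on UNIV"
    by (rule finite_nonzero_values_imp_summable_on) (auto intro: finite_subset[of _ "{0}"])
  have \<delta>_sum: "infsum (\<lambda>x. of_bool (x = 0) * (G x * G x)) UNIV = (G 0)\<^sup>2"
  proof -
    have "infsum (\<lambda>x. of_bool (x = 0) * (G x * G x)) UNIV = infsum (\<lambda>x. of_bool (x = 0) * (G x * G x)) {0}"
      by (rule infsum_cong_neutral) auto
    then show ?thesis by (simp add: power2_eq_square)
  qed
  note P = has_sum_two_particles
  have ff: "((\<lambda>x. ?f x * ?f x) has_sum n * n) UNIV"
    using P[OF s0 s0] by (simp add: n_def ip_def mult_ac)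
  have f_ell2: "?f \<in> ell2"
    unfolding ell2_def using has_sum_imp_summable[OF ff] by (simp add: power2_eq_square)
  have "((\<lambda>x. \<kappa> * ((\<Sum>u\<in>units. (G (x $ i) * G (x $ i + u)) * (G (x $ j) * G (x $ j)) - ?f x * ?f x)
        + (\<Sum>u\<in>units. (G (x $ i) * G (x $ i)) * (G (x $ j) * G (x $ j + u)) - ?f x * ?f x))
      + \<rho> * (\<Sum>u\<in>units. (G (x $ i) * G (x $ i + u)) * (G (x $ j) * G (x $ j + u)) - ?f x * ?f x)
      + \<gamma> * ((of_bool (x $ i = 0) * (G (x $ i) * G (x $ i))) * (G (x $ j) * G (x $ j))
        + (G (x $ i) * G (x $ i)) * (of_bool (x $ j = 0) * (G (x $ j) * G (x $ j)))))
     has_sum (\<kappa> * ((\<Sum>u\<in>units. c u * n - n * n) + (\<Sum>u\<in>units. n * c u - n * n))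
      + \<rho> * (\<Sum>u\<in>units. c u * c u - n * n) + \<gamma> * ((G 0)\<^sup>2 * n + n * (G 0)\<^sup>2))) UNIV"
    unfolding n_def c_def ip_def \<delta>_sum[symmetric]
    by (intro has_sum_add has_sum_cmult_right has_sum_diff_real has_sum_finite_sum P sG s0 \<delta> ff[unfolded n_def ip_def])
  moreover have "\<kappa> * ((\<Sum>u\<in>units. (G (x $ i) * G (x $ i + u)) * (G (x $ j) * G (x $ j)) - ?f x * ?f x)
        + (\<Sum>u\<in>units. (G (x $ i) * G (x $ i)) * (G (x $ j) * G (x $ j + u)) - ?f x * ?f x))
      + \<rho> * (\<Sum>u\<in>units. (G (x $ i) * G (x $ i + u)) * (G (x $ j) * G (x $ j + u)) - ?f x * ?f x)
      + \<gamma> * ((of_bool (x $ i = 0) * (G (x $ i) * G (x $ i))) * (G (x $ j) * G (x $ j))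
        + (G (x $ i) * G (x $ i)) * (of_bool (x $ j = 0) * (G (x $ j) * G (x $ j)))) = ?f x * hamilton \<kappa> \<rho> \<gamma> ?f x"
    (is "?lhs x = _") for x
  proof -
    have "(\<Sum>l\<in>UNIV. \<Sum>u\<in>units. ?f (x + axis l u) - ?f x)
       = (\<Sum>u\<in>units. G (x $ i + u) * G (x $ j) - ?f x) + (\<Sum>u\<in>units. G (x $ i) * G (x $ j + u) - ?f x)"
      unfolding sum_two using ij(1) by (auto simp: axis_def)
    moreover have "(\<Sum>u\<in>units. ?f (x + diag u) - ?f x) = (\<Sum>u\<in>units. G (x $ i + u) * G (x $ j + u) - ?f x)"
      by (simp add: diag_def)
    ultimately have J: "jump_gen \<kappa> \<rho> ?f x = \<kappa> * ((\<Sum>u\<in>units. G (x $ i + u) * G (x $ j) - ?f x) + (\<Sum>u\<in>units. G (x $ i) * G (x $ j + u) - ?f x))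
        + \<rho> * (\<Sum>u\<in>units. G (x $ i + u) * G (x $ j + u) - ?f x)"
      unfolding jump_gen_def by (simp only:)
    have S: "(\<Sum>u\<in>units. (G (x $ i) * G (x $ i + u)) * (G (x $ j) * G (x $ j)) - ?f x * ?f x) = ?f x * (\<Sum>u\<in>units. G (x $ i + u) * G (x $ j) - ?f x)"
      "(\<Sum>u\<in>units. (G (x $ i) * G (x $ i)) * (G (x $ j) * G (x $ j + u)) - ?f x * ?f x) = ?f x * (\<Sum>u\<in>units. G (x $ i) * G (x $ j + u) - ?f x)"
      "(\<Sum>u\<in>units. (G (x $ i) * G (x $ i + u)) * (G (x $ j) * G (x $ j + u)) - ?f x * ?f x) = ?f x * (\<Sum>u\<in>units. G (x $ i + u) * G (x $ j + u) - ?f x)"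
      unfolding sum_distrib_left by (auto intro!: sum.cong simp: algebra_simps)
    show ?thesis unfolding S hamilton_eq J potential_two by (simp add: algebra_simps)
  qed
  ultimately have "((\<lambda>x. ?f x * hamilton \<kappa> \<rho> \<gamma> ?f x) has_sum (\<kappa> * ((\<Sum>u\<in>units. c u * n - n * n) + (\<Sum>u\<in>units. n * c u - n * n))
      + \<rho> * (\<Sum>u\<in>units. c u * c u - n * n) + \<gamma> * ((G 0)\<^sup>2 * n + n * (G 0)\<^sup>2))) UNIV"
    by simp
  then have e: "ip ?f (hamilton \<kappa> \<rho> \<gamma> ?f) = \<kappa> * ((\<Sum>u\<in>units. c u * n - n * n) + (\<Sum>u\<in>units. n * c u - n * n))
      + \<rho> * (\<Sum>u\<in>units. c u * c u - n * n) + \<gamma> * ((G 0)\<^sup>2 * n + n * (G 0)\<^sup>2)"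
    unfolding ip_def by (rule infsumI)
  have "(\<Sum>u\<in>units. 2 * n * (c u - n)) \<le> (\<Sum>u\<in>units. c u * c u - n * n)"
  proof (rule sum_mono)
    show "2 * n * (c u - n) \<le> c u * c u - n * n" for u
      using zero_le_power2[of "c u - n"] by (simp add: power2_eq_square algebra_simps)
  qed
  then have "\<rho> * (2 * n * (\<Sum>u\<in>units. c u - n)) \<le> \<rho> * (\<Sum>u\<in>units. c u * c u - n * n)"
    unfolding sum_distrib_left[symmetric] using pos by (intro mult_left_mono) auto
  moreover have "(\<Sum>u\<in>units. c u * n - n * n) = n * (\<Sum>u\<in>units. c u - n)" "(\<Sum>u\<in>units. n * c u - n * n) = n * (\<Sum>u\<in>units. c u - n)"
    by (simp_all add: sum_distrib_left algebra_simps)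
  ultimately have "2 * n * ((\<kappa> + \<rho>) * (\<Sum>u\<in>units. c u - n) + \<gamma> * (G 0)\<^sup>2) \<le> ip ?f (hamilton \<kappa> \<rho> \<gamma> ?f)"
    unfolding e by (simp add: algebra_simps)
  also have "\<dots> \<le> Sup (l2_spectrum (hamilton \<kappa> \<rho> \<gamma> :: (int ^ 'd ^ 'p \<Rightarrow> real) \<Rightarrow> _)) * ip ?f ?f"
    by (rule rayleigh_hamilton) (use pos f_ell2 in auto)
  also have "ip ?f ?f = n\<^sup>2" unfolding ip_def using infsumI[OF ff] by (simp add: power2_eq_square)
  finally show ?thesis unfolding c_def .
qed

end

text \<open>
  The equation says \<open>(S - r \<Delta>) G = \<delta>\<^sub>0\<close>. Without its diagonal part, \<open>r \<Delta>\<close> takes the constant 1 to the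
  number of neighbours times \<open>r\<close>; so 1 is a supersolution strictly below the required
  level, and the Neumann series provides \<open>G\<close>.
\<close>

lemma green_function:
  assumes "0 < S" and r: "0 < r"
  shows "\<exists>G :: int ^ 'd \<Rightarrow> real. (\<forall>x. 0 \<le> G x) \<and> G summable_on UNIV \<and> 0 < G 0 \<and>
    (\<forall>x. S * G x - r * (\<Sum>u\<in>units. G (x + u) - G x) = indicator {0} x)"
proof -
  let ?m = "real (card (units :: (int ^ 'd) set))"
  interpret U: hopping "units :: (int ^ 'd) set" "\<lambda>_. r" "\<lambda>_. 0" 0
    by unfold_locales (use r in \<open>auto simp: finite_units uminus_units\<close>)
  have ind: "(indicator {0} :: int ^ 'd \<Rightarrow> real) summable_on UNIV"
    by (rule finite_nonzero_values_imp_summable_on) (auto simp: indicator_def)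
  obtain G where G: "\<And>x. 0 \<le> G x" "G summable_on UNIV" "\<And>x. (S + r * ?m) * G x - U.B G x = indicator {0} x"
    using U.summable_resolvent[of "\<lambda>_. 1" 1 "r * ?m" "S + r * ?m" "indicator {0}", OF _ _ _ _ _ ind] assms(1)
    by (auto simp: hop_def mult.commute)
  have "(S + r * ?m) * G 0 = 1 + U.B G 0" using G(3)[of 0] by simp
  moreover have "0 \<le> U.B G 0" by (rule U.B_nonneg[OF G(1)])
  ultimately have "G 0 \<noteq> 0" by auto
  then have "0 < G 0" using G(1)[of 0] by simp
  moreover have "S * G x - r * (\<Sum>u\<in>units. G (x + u) - G x) = indicator {0} x" for x
    using G(3)[of x] by (simp add: hop_def sum_subtractf sum_distrib_left[symmetric] algebra_simps)
  ultimately show ?thesis using G(1,2) by blast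
qed

text \<open>
  Chebyshev's inequality.
\<close>

lemma finite_level_set:
  fixes G :: "'a \<Rightarrow> real"
  assumes G: "G summable_on UNIV" "\<And>x. 0 \<le> G x" and "0 < \<theta>"
  shows "finite {x. \<theta> < G x}"
proof (rule ccontr)
  assume inf: "infinite {x. \<theta> < G x}"
  obtain n :: nat where n: "infsum G UNIV < real n * \<theta>"
    using reals_Archimedean3[OF \<open>0 < \<theta>\<close>] by blast
  obtain A where A: "A \<subseteq> {x. \<theta> < G x}" "finite A" "card A = n"
    using infinite_arbitrarily_large[OF inf] by blast
  have "real n * \<theta> = (\<Sum>x\<in>A. \<theta>)" using A by simp
  also have "\<dots> \<le> (\<Sum>x\<in>A. G x)" using A by (intro sum_mono) auto
  also have "\<dots> \<le> infsum G UNIV" by (rule finite_sum_le_infsum) (use G A in auto)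
  finally show False using n by simp
qed

text \<open>
  With \<open>G\<close> the one-particle Green function at level \<open>\<lambda>\<close> and \<open>h(x) = 1 + c (G(x\<^sub>i) + G(x\<^sub>j))\<close>, the jump part
  of \<open>H h\<close> is \<open>\<lambda> (h - 1)\<close> minus \<open>c\<close> for each particle at the origin. The potential contributes
  \<open>\<gamma> (1 + c G(0))\<close> for each of them, which is exactly \<open>c\<close> for \<open>c = \<gamma> / (1 - \<gamma> G(0))\<close>, and an error
  \<open>\<gamma> c G\<close> of the position of the other one. So \<open>H h = \<lambda> h - \<lambda> + R\<close>, where \<open>R\<close> is small except at
  finitely many points, and \<open>W\<close> compensates it there.
\<close>

lemma two_particle_supersolution:
  assumes pos: "0 < \<kappa>" "0 < \<rho>" "0 < \<gamma>" and p: "CARD('p) = 2"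
    and lam: "lam = Sup (l2_spectrum (hamilton \<kappa> \<rho> \<gamma> :: (int ^ 'd ^ 'p \<Rightarrow> real) \<Rightarrow> _))" and lam_pos: "0 < lam"
  shows "\<exists>(h :: int ^ 'd ^ 'p \<Rightarrow> real) W F C w s. finite F \<and> (\<forall>x. 0 \<le> W x \<and> W x \<le> w) \<and> (\<forall>x. x \<notin> F \<longrightarrow> W x = 0) \<and>
    (\<forall>x. 1 \<le> h x \<and> h x \<le> C) \<and> (\<forall>x. hamilton \<kappa> \<rho> \<gamma> h x - W x * h x \<le> s * h x) \<and> s < lam"
proof -
  obtain i j :: 'p where ij: "i \<noteq> j" "UNIV = {i, j}"
    using p by (auto simp: card_2_iff)
  obtain G :: "int ^ 'd \<Rightarrow> real" where G: "\<And>x. 0 \<le> G x" "G summable_on UNIV" "0 < G 0"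
      "\<And>x. lam * G x - (\<kappa> + \<rho>) * (\<Sum>u\<in>units. G (x + u) - G x) = indicator {0} x"
    using green_function[of lam "\<kappa> + \<rho>"] lam_pos pos by auto
  have G_ell2: "G \<in> ell2" by (rule summable_imp_ell2[OF G(2,1)])
  define n where "n = ip G G"
  have n: "0 < n"
    using ip_eq_0_iff[OF G_ell2] ip_nonneg[of G] G(3) by (auto simp: n_def less_le)
  \<comment> \<open>pair the equation of \<open>G\<close> with \<open>G\<close>\<close>
  have "(\<kappa> + \<rho>) * (\<Sum>u\<in>units. ip G (\<lambda>x. G (x + u)) - n) = lam * n - G 0"
  proof -
    let ?\<Delta> = "\<lambda>x. \<Sum>u\<in>units. G (x + u) - G x"
    have "ip G ?\<Delta> = (\<Sum>u\<in>units. ip G (\<lambda>x. G (x + u) - G x))"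
      unfolding ip_def sum_distrib_left
      by (rule infsum_sum) (intro ell2_mult_summable ell2_diff ell2_shift G_ell2)
    also have "\<dots> = (\<Sum>u\<in>units. ip G (\<lambda>x. G (x + u)) - n)"
      unfolding n_def by (intro sum.cong refl ip_diff_right ell2_shift G_ell2)
    finally have "(\<kappa> + \<rho>) * (\<Sum>u\<in>units. ip G (\<lambda>x. G (x + u)) - n) = ip G (\<lambda>x. (\<kappa> + \<rho>) * ?\<Delta> x)"
      by (simp add: ip_cmult_right)
    also have "(\<lambda>x. (\<kappa> + \<rho>) * ?\<Delta> x) = (\<lambda>x. lam * G x - indicator {0} x)"
      using G(4) by (auto simp: algebra_simps)
    also have "ip G \<dots> = lam * n - ip G (indicator {0})"
      unfolding n_def by (simp add: ip_diff_right G_ell2 ell2_cmult indicator_ell2 ip_cmult_right)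
    also have "ip G (indicator {0}) = G 0" by (simp add: ip_commute[of G] ip_indicator)
    finally show ?thesis .
  qed
  \<comment> \<open>\<open>\<gamma> G(0) \<ge> 1\<close> would make the Rayleigh quotient of \<open>G\<close> at least \<open>\<lambda>\<close>, and that of \<open>G \<otimes> G\<close> at least \<open>2 \<lambda>\<close>\<close>
  then have "2 * n * (lam * n - G 0 + \<gamma> * (G 0)\<^sup>2) \<le> lam * n\<^sup>2"
    using tensor_rayleigh[OF ij pos G_ell2, folded n_def lam] by simp
  then have "n * (2 * (lam * n - G 0 + \<gamma> * (G 0)\<^sup>2)) \<le> n * (lam * n)"
    by (simp add: power2_eq_square algebra_simps)
  then have "2 * (lam * n - G 0 + \<gamma> * (G 0)\<^sup>2) \<le> lam * n" using n by simp
  moreover have "0 < lam * n" using n lam_pos by simp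
  ultimately have "G 0 * (\<gamma> * G 0) < G 0 * 1" by (simp add: power2_eq_square algebra_simps)
  then have g1: "\<gamma> * G 0 < 1" using G(3) by simp
  define c where "c = \<gamma> / (1 - \<gamma> * G 0)"
  have c: "0 < c" "c * (1 - \<gamma> * G 0) = \<gamma>" using g1 pos by (simp_all add: c_def)
  define m where "m = infsum G UNIV"
  have Gm: "G x \<le> m" for x unfolding m_def by (rule summable_bounded[OF G(2,1)])
  have m: "0 \<le> m" using Gm[of 0] G(1)[of 0] by linarith
  define h where "h x = 1 + c * (G (x $ i) + G (x $ j))" for x :: "int ^ 'd ^ 'p"
  define C where "C = 1 + c * (m + m)"
  have h: "1 \<le> h x" "h x \<le> C" for x
  proof -
    have "0 \<le> G (x $ i) + G (x $ j)" "G (x $ i) + G (x $ j) \<le> m + m"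
      by (intro add_nonneg_nonneg add_mono Gm G(1))+
    then show "1 \<le> h x" "h x \<le> C"
      using c(1) unfolding h_def C_def by (simp_all add: mult_left_mono)
  qed
  define R where "R x = \<gamma> * c * (of_bool (x $ i = 0) * G (x $ j) + of_bool (x $ j = 0) * G (x $ i))" for x :: "int ^ 'd ^ 'p"
  have R: "0 \<le> R x" "R x \<le> \<gamma> * c * (m + m)" for x
  proof -
    have b: "0 \<le> of_bool P * G y" "of_bool P * G y \<le> m" for P y
      using G(1)[of y] Gm[of y] m by (cases P; simp)+
    have gc: "0 \<le> \<gamma> * c" using c(1) pos by simp
    show "0 \<le> R x" unfolding R_def by (intro mult_nonneg_nonneg[OF gc] add_nonneg_nonneg b)
    show "R x \<le> \<gamma> * c * (m + m)" unfolding R_def by (intro mult_left_mono[OF _ gc] add_mono b)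
  qed
  have Hh: "hamilton \<kappa> \<rho> \<gamma> h x = lam * h x - lam + R x" for x
  proof -
    have jump: "jump_gen \<kappa> \<rho> (\<lambda>x :: int ^ 'd ^ 'p. G (x $ k)) x = lam * G (x $ k) - of_bool (x $ k = 0)" if "k = i \<or> k = j" for k
      using jump_gen_one_particle[OF ij that, of \<kappa> \<rho> G x] G(4)[of "x $ k"] by (simp add: indicator_def)
    have "jump_gen \<kappa> \<rho> h x = c * (jump_gen \<kappa> \<rho> (\<lambda>x. G (x $ i)) x + jump_gen \<kappa> \<rho> (\<lambda>x. G (x $ j)) x)"
      by (simp add: jump_gen_def h_def sum_subtractf sum.distrib sum_distrib_left algebra_simps)
    also have "\<dots> = lam * (h x - 1) - c * (of_bool (x $ i = 0) + of_bool (x $ j = 0))"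
      unfolding jump[OF disjI1[OF refl]] jump[OF disjI2[OF refl]] h_def by (simp only: ring_distribs) simp
    finally have 1: "jump_gen \<kappa> \<rho> h x = lam * (h x - 1) - c * (of_bool (x $ i = 0) + of_bool (x $ j = 0))" .
    have "\<gamma> * (potential x * h x) = (\<gamma> + \<gamma> * c * G 0) * (of_bool (x $ i = 0) + of_bool (x $ j = 0)) + R x"
      by (auto simp: potential_two[OF ij] h_def R_def algebra_simps)
    also have "\<gamma> + \<gamma> * c * G 0 = c" using c(2) by (simp add: algebra_simps)
    finally show ?thesis unfolding hamilton_eq 1 by (simp add: algebra_simps)
  qed
  \<comment> \<open>outside \<open>F\<close>, each of the two terms of \<open>R\<close> is at most \<open>\<gamma> c \<theta> = \<lambda> / 4\<close>\<close>
  define \<theta> where "\<theta> = lam / (4 * (\<gamma> * c))"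
  have \<theta>: "0 < \<theta>" using lam_pos c pos by (simp add: \<theta>_def)
  let ?pair = "\<lambda>(y, z). (\<chi> k. if k = i then y else z) :: int ^ 'd ^ 'p"
  define F where "F = ?pair ` (({0} \<times> {y. \<theta> < G y}) \<union> ({y. \<theta> < G y} \<times> {0}))"
  have F: "finite F" unfolding F_def using finite_level_set[OF G(2,1) \<theta>] by auto
  have R_small: "R x \<le> lam / 2" if "x \<notin> F" for x
  proof -
    have x: "x = ?pair (x $ i, x $ j)" using ij(2) by (auto simp: vec_eq_iff)
    have "of_bool (x $ i = 0) * G (x $ j) \<le> \<theta>"
    proof (cases "x $ i = 0")
      case True
      then have "\<not> \<theta> < G (x $ j)" using that x unfolding F_def by (intro notI) (blast intro: image_eqI)
      then show ?thesis using \<theta> by simp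
    qed (use \<theta> in simp)
    moreover have "of_bool (x $ j = 0) * G (x $ i) \<le> \<theta>"
    proof (cases "x $ j = 0")
      case True
      then have "\<not> \<theta> < G (x $ i)" using that x unfolding F_def by (intro notI) (blast intro: image_eqI)
      then show ?thesis using \<theta> by simp
    qed (use \<theta> in simp)
    ultimately have "R x \<le> \<gamma> * c * (\<theta> + \<theta>)"
      unfolding R_def using c pos by (intro mult_left_mono add_mono) auto
    also have "\<dots> = lam / 2" using c pos by (simp add: \<theta>_def field_simps)
    finally show ?thesis .
  qed
  define w where "w = \<gamma> * c * (m + m)"
  define W where "W x = w * indicator F x" for x
  have w: "0 \<le> w" using c pos m by (simp add: w_def)
  have C: "1 \<le> C" using h[of 0] by linarith
  \<comment> \<open>\<open>R - W h \<le> \<lambda> / 2\<close> leaves \<open>(H - W) h \<le> \<lambda> h - \<lambda> / 2\<close>, and \<open>h \<le> C\<close>\<close>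
  define s where "s = lam - lam / (2 * C)"
  have super: "hamilton \<kappa> \<rho> \<gamma> h x - W x * h x \<le> s * h x" for x
  proof -
    have "R x - W x * h x \<le> lam / 2"
    proof (cases "x \<in> F")
      case True
      have "w * 1 \<le> w * h x" using h(1) w by (rule mult_left_mono)
      then show ?thesis using True R(2)[of x] lam_pos by (simp add: W_def w_def)
    next
      case False
      then show ?thesis using R_small by (simp add: W_def)
    qed
    moreover have "lam / (2 * C) * h x \<le> lam / (2 * C) * C"
      using h(2)[of x] C lam_pos by (intro mult_left_mono) auto
    ultimately show ?thesis unfolding Hh s_def using C by (simp add: left_diff_distrib)
  qed
  have "s < lam" using lam_pos C by (simp add: s_def)
  then show ?thesis
    using F w h super
    by (intro exI[of _ h] exI[of _ W] exI[of _ F] exI[of _ C] exI[of _ w] exI[of _ s]) (auto simp: W_def indicator_def)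
qed

section \<open>Existence of the ground state and growth of the moments\<close>

theorem theorem5:
  fixes \<kappa> \<rho> \<gamma> lam :: real
    and N :: "'a measure" and X :: "real \<Rightarrow> 'a \<Rightarrow> int ^ 'd"
    and M :: "'b measure" and Y :: "real \<Rightarrow> 'b \<Rightarrow> int ^ 'd"
  assumes "\<kappa> > 0" and "\<rho> > 0" and "\<gamma> > 0"
    and X: "random_walk N \<kappa> X"
    and Y: "random_walk M \<rho> Y"
    and lam: "lam = Sup (l2_spectrum (hamilton \<kappa> \<rho> \<gamma> :: (int ^ 'd ^ 'p \<Rightarrow> real) \<Rightarrow> _))"
    and cond: "(CARD('p) = 1 \<or> CARD('p) = 2) \<and> lam > 0 \<or>
      \<gamma> > 4 * real CARD('d) * (\<kappa> * real CARD('p) + \<rho>)"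
  shows "lam > 0 \<and>
    (\<exists>v :: int ^ 'd ^ 'p \<Rightarrow> real.
      (\<forall>x. v x > 0) \<and> v summable_on UNIV \<and> v \<in> ell2 \<and>
      hamilton \<kappa> \<rho> \<gamma> v = (\<lambda>x. lam * v x) \<and> l2_norm v = 1 \<and>
      (\<forall>x. asymp_equiv (mixed_moment N X M Y \<gamma> x) at_top
             (\<lambda>t. exp (lam * t) * v x * l1_norm v)))"
proof (cases "\<gamma> * (real CARD('p) - 1) < lam")
  case True
  \<comment> \<open>constants are a supersolution, with the potential at the origin reduced by \<open>\<gamma>\<close>\<close>
  have "1 \<le> CARD('p)" by (simp add: Suc_le_eq)
  then have "0 \<le> \<gamma> * (real CARD('p) - 1)" using assms(3) by simp
  then have "0 < lam" using True by linarith
  moreover have "\<exists>v :: int ^ 'd ^ 'p \<Rightarrow> real.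
      (\<forall>x. v x > 0) \<and> v summable_on UNIV \<and> v \<in> ell2 \<and>
      hamilton \<kappa> \<rho> \<gamma> v = (\<lambda>x. lam * v x) \<and> l2_norm v = 1 \<and>
      (\<forall>x. asymp_equiv (mixed_moment N X M Y \<gamma> x) at_top
             (\<lambda>t. exp (lam * t) * v x * l1_norm v))"
    by (rule moment_asymptotics[OF assms(1-3) X Y lam, where F = "{0}" and W = "\<lambda>x. \<gamma> * indicator {0} x"
          and w = \<gamma> and h = "\<lambda>_. 1" and C = 1, OF _ _ _ _ _ _ constant_supersolution True])
       (use assms(3) in \<open>auto simp: indicator_def\<close>)
  ultimately show ?thesis by blast
next
  case False
  \<comment> \<open>\<open>\<gamma> > 4 d (\<kappa> p + \<rho>)\<close> would give \<open>\<lambda> \<ge> \<gamma> p - 2 d (\<kappa> p + \<rho>) > \<gamma> (p - 1)\<close>, so \<open>p = 2\<close> and \<open>\<lambda> > 0\<close> remain\<close>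
  have "exit_rate \<kappa> \<rho> TYPE('p) TYPE('d) \<le> 2 * real CARD('d) * (\<kappa> * real CARD('p) + \<rho>)"
    unfolding exit_rate_def using card_units_le[where 'd = 'd] assms(1,2)
    by (intro mult_right_mono) (auto simp flip: of_nat_mult)
  moreover have "\<gamma> * real CARD('p) - exit_rate \<kappa> \<rho> TYPE('p) TYPE('d) \<le> lam"
    unfolding lam by (rule lam_ge_diagonal) (use assms(1-3) in auto)
  moreover have "0 < real CARD('d) * (\<kappa> * real CARD('p) + \<rho>)"
    using assms(1,2) by (simp add: add_pos_pos)
  ultimately have "\<not> \<gamma> > 4 * real CARD('d) * (\<kappa> * real CARD('p) + \<rho>)"
    using False by (simp add: algebra_simps)
  with cond have c: "CARD('p) = 1 \<or> CARD('p) = 2" "0 < lam" by auto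
  with False have "CARD('p) = 2" by auto
  from two_particle_supersolution[OF assms(1-3) this lam c(2)]
  obtain h W :: "int ^ 'd ^ 'p \<Rightarrow> real" and F C w s where
    *: "finite F" "\<And>x. 0 \<le> W x" "\<And>x. W x \<le> w" "\<And>x. x \<notin> F \<Longrightarrow> W x = 0" "\<And>x. 1 \<le> h x" "\<And>x. h x \<le> C"
      "\<And>x. hamilton \<kappa> \<rho> \<gamma> h x - W x * h x \<le> s * h x" "s < lam"
    by blast
  show ?thesis
    using moment_asymptotics[OF assms(1-3) X Y lam *(1,2,4,3,5-8)] c(2) by blast
qed

end
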